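(* Let $D$ be an integral domain with quotient field $K$. Let $\mathrm{Kr}(D):=\mathrm{Kr}(D,b)$ be the $b$-Kronecker function ring of $D$ and let $\theta:\mathrm{Spec}(\mathrm{Kr}(D))\to\mathrm{Zar}(D)$ be the homeomorphism defined by $\theta(Q):=\mathrm{Kr}(D)_Q\cap K$ for each $Q\in\mathrm{Spec}(\mathrm{Kr}(D))$. Then: (1) The homeomorphism $\theta$ induces a continuous bijection $\boldsymbol\Theta:\mathrm{SStar}_{sp}(\mathrm{Kr}(D))\to\mathrm{SStar}_{val}(D)$ defined by setting $\boldsymbol\Theta(s_{\mathscr Y}):=\wedge_{Z(\mathscr Y)}$ for each $\mathscr Y\subseteq\mathrm{Spec}(\mathrm{Kr}(D))$, where $Z(\mathscr Y):=\{V\in\mathrm{Zar}(D)\mid M_V(\mathbb X)\cap\mathrm{Kr}(D)\in\mathscr Y\}$ and $M_V$ is the maximal ideal of $V$. (2) The map $\boldsymbol\Theta$, restricted to the semistar operations of finite type, gives rise to a homeomorphism $\boldsymbol\Theta_f:\mathrm{SStar}_{f,sp}(\mathrm{Kr}(D))\to\mathrm{SStar}_{f,eab}(D)$ of topological spaces (endowed with the Zariski topology). (3) $\mathrm{SStar}_{f,eab}(D)$ is a spectral space.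
   Context: For an integral domain $R$ with quotient field $L$: $\overline{\mathbf F}(R)$ is the set of nonzero $R$-submodules of $L$, $\mathbf f(R)$ the set of nonzero finitely generated fractional ideals of $R$. A semistar operation on $R$ is a map $\star:\overline{\mathbf F}(R)\to\overline{\mathbf F}(R)$, $E\mapsto E^\star$, such that for all $0\ne z\in L$ and $E,F\in\overline{\mathbf F}(R)$: $(zE)^\star=zE^\star$; $E\subseteq F\Rightarrow E^\star\subseteq F^\star$; $E\subseteq E^\star$; $(E^\star)^\star=E^\star$. $\mathrm{SStar}(R)$ is the set of all semistar operations on $R$; its Zariski topology has as subbasis of open sets the sets $V_E:=\{\star\mid 1\in E^\star\}$, $E\in\overline{\mathbf F}(R)$; all subsets of $\mathrm{SStar}(R)$ carry the subspace (Zariski) topology. $\star$ is of finite type if $E^\star=\bigcup\{F^\star\mid F\subseteq E,F\in\mathbf f(R)\}$ for all $E$. $\star$ is eab if for all $F,G,H\in\mathbf f(R)$, $(FG)^\star\subseteq(FH)^\star$ implies $G^\star\subseteq H^\star$. For $\mathscr Y\subseteq\mathrm{Spec}(R)$, $s_{\mathscr Y}$ is the semistar operation $E\mapsto\bigcap\{ER_P\mid P\in\mathscr Y\}$; operations of this form are called spectral. $\mathrm{Zar}(R)$ is the set of valuation overrings of $R$ (valuation domains $V$ with $R\subseteq V\subseteq L$, including $L$), with the Zariski topology having subbasic open sets $\mathrm{Zar}(R[x])$, $x\in L$. For $Y\subseteq\mathrm{Zar}(R)$, $\wedge_Y$ is the semistar operation $E\mapsto\bigcap\{EV\mid V\in Y\}$;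 operations of this form are called valutative. Empty intersections are equal to $L$. $\mathrm{SStar}_{sp}(R)$, $\mathrm{SStar}_{val}(R)$ are the sets of spectral, resp. valutative, semistar operations; $\mathrm{SStar}_{f,sp}(R)$, $\mathrm{SStar}_{f,eab}(R)$ are the sets of spectral, resp. eab, semistar operations of finite type (it is known that the eab operations of finite type are exactly the valutative operations of finite type). $b:=\wedge_{\mathrm{Zar}(D)}$. Let $\mathbb X$ be an indeterminate over $D$ and let $\mathbf c(h)$ be the ideal of $D$ generated by the coefficients of $h\in D[\mathbb X]$. Then $\mathrm{Kr}(D)=\mathrm{Kr}(D,b):=\{f/g\mid f,g\in D[\mathbb X],\ g\ne0,\ \mathbf c(f)\subseteq\mathbf c(g)^b\}$, which is known to be a Bézout domain with quotient field $K(\mathbb X)$. For $V\in\mathrm{Zar}(D)$ with maximal ideal $M_V$, $V(\mathbb X):=V[\mathbb X]_{M_V[\mathbb X]}$ is the Gaussian (trivial) extension of $V$ to $K(\mathbb X)$, and $M_V(\mathbb X)$ is its maximal ideal. A spectral space is a topological space homeomorphic to the prime spectrum of a commutative ring with the Zariski topology. It is known that $\theta$ is a homeomorphism. *)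

theory Defs
  imports "HOL-Algebra.Algebra" "HOL-Algebra.Algebraic_Closure_Type"
    "HOL-Analysis.Abstract_Topology"
begin

section \<open>Subrings of a field, modules and localizations\<close>

text \<open>
  An integral domain with quotient field \<open>L\<close> is a subset \<open>R\<close> of a type \<open>'l\<close> of class
  \<^class>\<open>field\<close>, the type playing the role of \<open>L\<close>.  All the rings involved (\<open>D\<close>, its
  overrings, \<open>Kr(D)\<close>, localizations) are subsets of \<open>K\<close> or of \<open>K(X)\<close>.
\<close>

abbreviation sub_ring :: "'l::field set \<Rightarrow> 'l ring" where
  "sub_ring R \<equiv> ring_of_type_algebra\<lparr>carrier := R\<rparr>"

definition domain_with_quotient_field :: "'l::field set \<Rightarrow> bool" where
  "domain_with_quotient_field R \<longleftrightarrow>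
     subdomain R ring_of_type_algebra \<and> (\<forall>x. \<exists>a\<in>R. \<exists>b\<in>R. b \<noteq> 0 \<and> x = a / b)"

definition field_module :: "('l::field, 'l) module" where
  "field_module = ring.extend ring_of_type_algebra (module.fields (*))"

abbreviation is_submodule :: "'l::field set \<Rightarrow> 'l set \<Rightarrow> bool" where
  "is_submodule R E \<equiv> submodule E (sub_ring R) field_module"

definition module_span :: "'l::field set \<Rightarrow> 'l set \<Rightarrow> 'l set" where
  "module_span R S = \<Inter>{E. is_submodule R E \<and> S \<subseteq> E}"

definition module_prod :: "'l::field set \<Rightarrow> 'l set \<Rightarrow> 'l set \<Rightarrow> 'l set" where
  "module_prod R E F = module_span R {e * f | e f. e \<in> E \<and> f \<in> F}"

text \<open>\<open>R\<^sub>P\<close>, as a subring of the field; meaningful for a prime ideal \<open>P\<close> of \<open>R\<close>.\<close>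

definition localize :: "'l::field set \<Rightarrow> 'l set \<Rightarrow> 'l set" where
  "localize R P = {a / b | a b. a \<in> R \<and> b \<in> R - P}"

text \<open>Used for local rings only, where the maximal ideal is unique.\<close>

definition max_ideal :: "'l::field set \<Rightarrow> 'l set" where
  "max_ideal R = (THE M. maximalideal M (sub_ring R))"

section \<open>Prime spectra and spectral spaces\<close>

definition Spec :: "('a, 'b) ring_scheme \<Rightarrow> 'a set set" where
  "Spec R = {P. primeideal P R}"

definition zariski_spec :: "('a, 'b) ring_scheme \<Rightarrow> 'a set topology" where
  "zariski_spec R = topology_generated_by {{P \<in> Spec R. f \<notin> P} | f. f \<in> carrier R}"

text \<open>
  HOL cannot quantify existentially over types, so the commutative ring has to live on a fixed
  type, chosen large enough in terms of the points of \<open>T\<close> for this to be no restriction: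
  Hochster's construction realizes every spectral space \<open>T\<close> by a ring of functions on \<open>T\<close> with
  values in a field of rational functions over a countable field in indeterminates indexed by
  the quasi-compact open subsets of \<open>T\<close>.  There are at most \<open>2 ^ max(|T|, \<aleph>\<^sub>0)\<close> such functions,
  so the ring can be transported into the type below.
\<close>

definition spectral_space :: "'x topology \<Rightarrow> bool" where
  "spectral_space T \<longleftrightarrow>
     (\<exists>A :: (nat \<times> 'x) set set ring. cring A \<and> T homeomorphic_space zariski_spec A)"

section \<open>Semistar operations\<close>

definition Fbar :: "'l::field set \<Rightarrow> 'l set set" where
  "Fbar R = {E. is_submodule R E \<and> E \<noteq> {0}}"

definition fg_fractional :: "'l::field set \<Rightarrow> 'l set set" where
  "fg_fractional R = {E \<in> Fbar R. (\<exists>d\<in>R. d \<noteq> 0 \<and> (\<lambda>x. d * x) ` E \<subseteq> R) \<and>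
                                  (\<exists>S. finite S \<and> E = module_span R S)}"

text \<open>
  A map on \<open>Fbar R\<close> is a HOL function that is \<^const>\<open>undefined\<close> outside \<open>Fbar R\<close>, so that
  equality of functions is equality of maps.
\<close>

definition SStar :: "'l::field set \<Rightarrow> ('l set \<Rightarrow> 'l set) set" where
  "SStar R = {s \<in> Fbar R \<rightarrow>\<^sub>E Fbar R.
     (\<forall>z. \<forall>E\<in>Fbar R. z \<noteq> 0 \<longrightarrow> s ((\<lambda>x. z * x) ` E) = (\<lambda>x. z * x) ` s E) \<and>
     (\<forall>E\<in>Fbar R. \<forall>F\<in>Fbar R. E \<subseteq> F \<longrightarrow> s E \<subseteq> s F) \<and>
     (\<forall>E\<in>Fbar R. E \<subseteq> s E) \<and>
     (\<forall>E\<in>Fbar R. s (s E) = s E)}"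

definition sstar_topology :: "'l::field set \<Rightarrow> ('l set \<Rightarrow> 'l set) topology" where
  "sstar_topology R = topology_generated_by {{s \<in> SStar R. 1 \<in> s E} | E. E \<in> Fbar R}"

definition finite_type :: "'l::field set \<Rightarrow> ('l set \<Rightarrow> 'l set) \<Rightarrow> bool" where
  "finite_type R s \<longleftrightarrow>
     (\<forall>E\<in>Fbar R. s E = \<Union>{s F | F. F \<in> fg_fractional R \<and> F \<subseteq> E})"

definition eab :: "'l::field set \<Rightarrow> ('l set \<Rightarrow> 'l set) \<Rightarrow> bool" where
  "eab R s \<longleftrightarrow>
     (\<forall>F\<in>fg_fractional R. \<forall>G\<in>fg_fractional R. \<forall>H\<in>fg_fractional R.
        s (module_prod R F G) \<subseteq> s (module_prod R F H) \<longrightarrow> s G \<subseteq> s H)"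

text \<open>In the next definitions an empty intersection is \<^const>\<open>UNIV\<close>, the whole field.\<close>

definition spectral_op :: "'l::field set \<Rightarrow> 'l set set \<Rightarrow> 'l set \<Rightarrow> 'l set" where
  "spectral_op R Y = (\<lambda>E\<in>Fbar R. \<Inter>P\<in>Y. module_prod R E (localize R P))"

definition wedge :: "'l::field set \<Rightarrow> 'l set set \<Rightarrow> 'l set \<Rightarrow> 'l set" where
  "wedge R Y = (\<lambda>E\<in>Fbar R. \<Inter>V\<in>Y. module_prod R E V)"

definition Zar :: "'l::field set \<Rightarrow> 'l set set" where
  "Zar R = {V. subring V ring_of_type_algebra \<and> R \<subseteq> V \<and>
               (\<forall>x. x \<noteq> 0 \<longrightarrow> x \<in> V \<or> inverse x \<in> V)}"

definition adjoin :: "'l::field set \<Rightarrow> 'l \<Rightarrow> 'l set" where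
  "adjoin R x = {poly p x | p. \<forall>i. Polynomial.coeff p i \<in> R}"

definition zar_topology :: "'l::field set \<Rightarrow> 'l set topology" where
  "zar_topology R = topology_generated_by {Zar (adjoin R x) | x. True}"

definition SStar_sp :: "'l::field set \<Rightarrow> ('l set \<Rightarrow> 'l set) set" where
  "SStar_sp R = {spectral_op R Y | Y. Y \<subseteq> Spec (sub_ring R)}"

definition SStar_val :: "'l::field set \<Rightarrow> ('l set \<Rightarrow> 'l set) set" where
  "SStar_val R = {wedge R Y | Y. Y \<subseteq> Zar R}"

definition SStar_f_sp :: "'l::field set \<Rightarrow> ('l set \<Rightarrow> 'l set) set" where
  "SStar_f_sp R = {s \<in> SStar_sp R. finite_type R s}"

definition SStar_f_eab :: "'l::field set \<Rightarrow> ('l set \<Rightarrow> 'l set) set" where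
  "SStar_f_eab R = {s \<in> SStar R. finite_type R s \<and> eab R s}"

section \<open>The Kronecker function ring\<close>

text \<open>\<open>K(X)\<close> is the type \<open>'k poly fract\<close>.\<close>

definition of_poly :: "'k::field poly \<Rightarrow> 'k poly fract" where
  "of_poly p = Fraction_Field.Fract p 1"

definition const_rat :: "'k::field \<Rightarrow> 'k poly fract" where
  "const_rat k = of_poly [:k:]"

definition polys_over :: "'k::field set \<Rightarrow> 'k poly fract set" where
  "polys_over A = {of_poly p | p. \<forall>i. Polynomial.coeff p i \<in> A}"

definition content_ideal :: "'k::field set \<Rightarrow> 'k poly \<Rightarrow> 'k set" where
  "content_ideal D h = genideal (sub_ring D) (set (coeffs h))"

definition b_op :: "'k::field set \<Rightarrow> 'k set \<Rightarrow> 'k set" where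
  "b_op D = wedge D (Zar D)"

definition Kr :: "'k::field set \<Rightarrow> 'k poly fract set" where
  "Kr D = {of_poly f / of_poly g | f g.
             (\<forall>i. Polynomial.coeff f i \<in> D) \<and> (\<forall>i. Polynomial.coeff g i \<in> D) \<and> g \<noteq> 0 \<and>
             content_ideal D f \<subseteq> b_op D (content_ideal D g)}"

definition gauss_ext :: "'k::field set \<Rightarrow> 'k poly fract set" where
  "gauss_ext V = localize (polys_over V) (polys_over (max_ideal V))"

text \<open>\<open>\<theta>(Q) = Kr(D)\<^sub>Q \<inter> K\<close>, where \<open>K\<close> sits inside \<open>K(X)\<close> via \<^const>\<open>const_rat\<close>.\<close>

definition theta :: "'k::field set \<Rightarrow> 'k poly fract set \<Rightarrow> 'k set" where
  "theta D Q = {x. const_rat x \<in> localize (Kr D) Q}"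

definition Zset :: "'k::field set \<Rightarrow> 'k poly fract set set \<Rightarrow> 'k set set" where
  "Zset D Y = {V \<in> Zar D. max_ideal (gauss_ext V) \<inter> Kr D \<in> Y}"

end

theory Submission
  imports Defs "HOL-Library.Set_Algebras" "HOL-Library.Poly_Mapping" "HOL-Library.Z2"
begin

text \<open>
  Everything rests on one dictionary between \<open>K\<close> and \<open>K(X)\<close>. Over a valuation domain \<open>V\<close>, a
  polynomial is a coefficient of largest value times a primitive polynomial, and primitive
  polynomials are units of \<open>V(X)\<close>. Hence \<open>f / g \<in> V(X)\<close> if and only if the coefficients of \<open>f\<close>
  lie in the \<open>V\<close>-module generated by the coefficients of \<open>g\<close> (\<open>fraction_mem_gauss_ext\<close>). It
  follows that \<open>Kr(D)\<close> is the intersection of the rings \<open>V(X)\<close>, \<open>V \<in> Zar(D)\<close>, and that over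
  \<open>Kr(D)\<close> a polynomial generates the same module as its coefficients. A ring with this last
  property, which passes to overrings, is called content closed below. Its localizations at
  primes are valuation rings (\<open>localize_mem_Zar\<close>), and each valuation overring \<open>W\<close> of \<open>Kr(D)\<close>
  is \<open>(W \<inter> K)(X)\<close> (\<open>Zar_Kr_eq_gauss_ext\<close>). So \<open>\<theta>\<close> is a bijection with inverse
  \<open>V \<mapsto> M\<^sub>V(X) \<inter> Kr(D)\<close>, and it is a homeomorphism because the basic open sets on both sides
  are given by divisibility conditions between finitely many elements of \<open>K\<close>.

  Under \<open>\<theta>\<close> the operation \<open>s\<^sub>Y\<close> becomes the intersection of the extensions \<open>F V(X)\<close> with
  \<open>V \<in> \<theta>(Y)\<close>, and \<open>x \<in> E V\<close> if and only if \<open>x \<in> E V(X)\<close> for \<open>x \<in> K\<close>. Therefore \<open>\<Theta>(s)\<close> is the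
  operation \<open>E \<mapsto> (E Kr(D))\<^sup>s \<inter> K\<close>. This description does not mention \<open>Y\<close>, so \<open>\<Theta>\<close> is well
  defined, and it shows at once that \<open>\<Theta>\<close> is continuous. Injectivity is the delicate point of
  the first part, since a \<open>Kr(D)\<close>-module need not be extended from \<open>D\<close>: an element \<open>x\<close> lies in
  \<open>F V(X)\<close> if some \<open>e \<in> F\<close> has \<open>x / e \<in> V(X)\<close>, so membership for all \<open>V\<close> is an intersection of
  unions, and rewriting it as a union of intersections by means of choice functions turns it
  into a statement on \<open>D\<close>-modules (\<open>wedge_Kr_subset_if_wedge_D_eq\<close>).

  For the second part let \<open>r\<close> be eab of finite type. Gauss's lemma for contents up to \<open>r\<close>
  (\<open>gauss_eab\<close>) makes the fractions \<open>p / q\<close> with \<open>c(p) \<subseteq> c(q)\<^sup>r\<close> a content closed ring,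
  \<open>kron D r\<close>, so this ring has enough valuation overrings to separate elements from its
  submodules. This yields first \<open>Kr(D) \<subseteq> kron D r\<close>, and then that the spectral operation given
  by the primes of \<open>Kr(D)\<close> whose localization contains \<open>kron D r\<close> is \<open>F \<mapsto> F kron D r\<close>
  (\<open>Theta_inv_eq_span\<close>). It has finite type, and intersecting with \<open>K\<close> gives \<open>r\<close> back
  (\<open>const_mem_span_kron_iff\<close>), so \<open>\<Theta>\<close> is onto. A relation \<open>1 \<in> F kron D r\<close> involves only
  finitely many conditions \<open>c \<in> c(q)\<^sup>r\<close>, so the inverse of \<open>\<Theta>\<close> is continuous.

  For the third part, an eab operation \<open>r\<close> of finite type is determined by the finite sets \<open>S\<close>
  with \<open>1 \<in> S\<^sup>r\<close>, and the families of finite sets which arise in this way are exactly those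
  closed under certain rules, each with finitely many premises (\<open>homeomorphic_models_eab\<close>).
  Thus the space consists of the models of a Horn theory, with the sets \<open>{F. i \<in> F}\<close> as a
  subbasis. Every such space is the spectrum of an explicit ring, in the spirit of Hochster:
  over the field with two elements take an indeterminate \<open>t\<^sub>i\<close> for each atom \<open>i\<close>, and let the
  ring consist of the rational functions which can be specialized at every model \<open>F\<close>, by
  letting \<open>t\<^sub>i\<close> tend to zero for \<open>i \<notin> F\<close>, in a compatible way for \<open>G \<subseteq> F\<close>. If \<open>h\<close> vanishes at
  all models where \<open>g\<close> does, then \<open>g\<close> divides a power of \<open>h\<close> in this ring (\<open>ex_divide_mem\<close>);
  and the models at which \<open>h\<close> does not vanish are those which contain one of finitely many
  finite sets (\<open>ex_basic_cover\<close>). These two facts force every prime ideal to be the vanishing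
  ideal of a model (\<open>point_support\<close>). It remains to transport the ring to the type prescribed
  in the definition of a spectral space.
\<close>

section \<open>Subrings, submodules and ideals of a field, elementwise\<close>

definition unital_subring :: "'l::field set \<Rightarrow> bool" where
  "unital_subring R \<longleftrightarrow> 1 \<in> R \<and> (\<forall>x\<in>R. \<forall>y\<in>R. x - y \<in> R \<and> x * y \<in> R)"

lemma unital_subringD:
  assumes "unital_subring R"
  shows "1 \<in> R" "0 \<in> R" "x \<in> R \<Longrightarrow> - x \<in> R"
    "x \<in> R \<Longrightarrow> y \<in> R \<Longrightarrow> x - y \<in> R"
    "x \<in> R \<Longrightarrow> y \<in> R \<Longrightarrow> x + y \<in> R"
    "x \<in> R \<Longrightarrow> y \<in> R \<Longrightarrow> x * y \<in> R"
proof -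
  show 1: "1 \<in> R" using assms unfolding unital_subring_def by blast
  have d: "x - y \<in> R" if "x \<in> R" "y \<in> R" for x y using assms that unfolding unital_subring_def by blast
  show 0: "0 \<in> R" using d[OF 1 1] by simp
  have n: "- x \<in> R" if "x \<in> R" for x using d[OF 0 that] by simp
  show "x \<in> R \<Longrightarrow> - x \<in> R" by (rule n)
  show "x \<in> R \<Longrightarrow> y \<in> R \<Longrightarrow> x - y \<in> R" by (rule d)
  show "x \<in> R \<Longrightarrow> y \<in> R \<Longrightarrow> x + y \<in> R" using d[of x "-y"] n[of y] by simp
  show "x \<in> R \<Longrightarrow> y \<in> R \<Longrightarrow> x * y \<in> R" using assms unfolding unital_subring_def by blast
qed

lemma unital_subring_power: "unital_subring R \<Longrightarrow> x \<in> R \<Longrightarrow> x ^ n \<in> R"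
  by (induction n) (auto intro: unital_subringD)

lemma unital_subring_sum:
  "unital_subring R \<Longrightarrow> (\<And>i. i \<in> I \<Longrightarrow> f i \<in> R) \<Longrightarrow> sum f I \<in> R"
  by (induction I rule: infinite_finite_induct) (auto intro: unital_subringD)

lemma ring_of_type_algebra_simps [simp]:
  "carrier ring_of_type_algebra = UNIV"
  "monoid.mult ring_of_type_algebra = (*)"
  "monoid.one ring_of_type_algebra = 1"
  "ring.zero ring_of_type_algebra = 0"
  "ring.add ring_of_type_algebra = (+)"
  by (simp_all add: ring_of_type_algebra_def)

lemma a_inv_ring_of_type_algebra: "a_inv (ring_of_type_algebra :: 'l::field ring) x = - x"
proof -
  interpret cring "ring_of_type_algebra :: 'l ring" by (rule cring_from_type_algebra)
  show ?thesis by (rule sum_zero_eq_neg[symmetric]) auto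
qed

lemma subring_iff_unital_subring:
  fixes R :: "'l::field set"
  shows "subring R ring_of_type_algebra \<longleftrightarrow> unital_subring R"
proof -
  interpret cring "ring_of_type_algebra :: 'l ring" by (rule cring_from_type_algebra)
  show ?thesis
  proof
    assume *: "subring R ring_of_type_algebra"
    have "x - y \<in> R" if "x \<in> R" "y \<in> R" for x y
      using subringE(7)[OF * that(1), of "- y"] subringE(5)[OF * that(2)]
      by (simp add: a_inv_ring_of_type_algebra)
    then show "unital_subring R"
      unfolding unital_subring_def using subringE(3,6)[OF *] by auto
  next
    assume *: "unital_subring R"
    show "subring R ring_of_type_algebra"
      by (rule subringI) (auto simp: a_inv_ring_of_type_algebra intro: unital_subringD[OF *])
  qed
qed

lemma subdomain_imp_unital_subring:
  fixes R :: "'l::field set"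
  assumes "subdomain R ring_of_type_algebra"
  shows "unital_subring R"
proof -
  interpret domain "ring_of_type_algebra :: 'l ring"
    using field.axioms(1)[OF field_from_type_algebra] .
  show ?thesis
    using subcring.axioms(1)[OF subdomain.axioms(1)[OF assms]] by (simp add: subring_iff_unital_subring)
qed

lemma sub_ring_cring:
  fixes R :: "'l::field set"
  assumes "unital_subring R"
  shows "cring (sub_ring R)"
proof -
  interpret cring "ring_of_type_algebra :: 'l ring" by (rule cring_from_type_algebra)
  have s: "subring R ring_of_type_algebra" using assms by (simp add: subring_iff_unital_subring)
  show ?thesis
    using subcring_iff[of R] subcringI'[OF s] by simp
qed

lemma a_inv_sub_ring:
  fixes R :: "'l::field set"
  assumes "unital_subring R" "x \<in> R"
  shows "a_inv (sub_ring R) x = - x"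
proof -
  interpret cring "sub_ring R" by (rule sub_ring_cring[OF assms(1)])
  show ?thesis
    by (rule sum_zero_eq_neg[symmetric]) (use assms unital_subringD in auto)
qed

text \<open>For a subring of a field the module axioms reduce to three closure conditions; negatives
  are multiples by \<open>-1\<close>.\<close>

definition submod :: "'l::field set \<Rightarrow> 'l set \<Rightarrow> bool" where
  "submod R E \<longleftrightarrow> 0 \<in> E \<and> (\<forall>x\<in>E. \<forall>y\<in>E. x + y \<in> E) \<and> (\<forall>a\<in>R. \<forall>x\<in>E. a * x \<in> E)"

lemma field_module_simps [simp]:
  "carrier (field_module :: ('l::field, 'l) module) = UNIV"
  "ring.add (field_module :: ('l::field, 'l) module) = (+)"
  "ring.zero (field_module :: ('l::field, 'l) module) = 0"
  "module.smult (field_module :: ('l::field, 'l) module) = (*)"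
  by (simp_all add: field_module_def ring.defs module.defs ring_of_type_algebra_def)

lemma is_submodule_iff:
  fixes R :: "'l::field set"
  assumes R: "unital_subring R"
  shows "is_submodule R E \<longleftrightarrow> submod R E"
proof -
  interpret R: cring "sub_ring R" by (rule sub_ring_cring[OF R])
  interpret M: abelian_group "field_module :: ('l, 'l) module"
  proof (rule abelian_groupI)
    fix x :: 'l assume "x \<in> carrier field_module"
    show "\<exists>y\<in>carrier field_module. y \<oplus>\<^bsub>field_module\<^esub> x = \<zero>\<^bsub>field_module\<^esub>"
      by (intro bexI[of _ "-x"]) auto
  qed (auto simp: add.assoc add.commute)
  interpret M: module "sub_ring R" "field_module :: ('l, 'l) module"
    by unfold_locales (auto simp: algebra_simps)
  have inv: "a_inv (field_module :: ('l, 'l) module) x = - x" for x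
    by (rule M.minus_equality) auto
  show ?thesis
  proof
    assume *: "is_submodule R E"
    have "0 \<in> E"
      using subgroup.one_closed[OF submodule.axioms(1)[OF *]] by simp
    then show "submod R E"
      using M.submoduleE(4,5)[OF *] unfolding submod_def by auto
  next
    assume *: "submod R E"
    have "- x \<in> E" if "x \<in> E" for x
    proof -
      have "(- 1) * x \<in> E" using * that unital_subringD(1,3)[OF R] unfolding submod_def by blast
      then show ?thesis by simp
    qed
    then show "is_submodule R E"
      by (intro M.submoduleI) (use * inv in \<open>auto simp: submod_def\<close>)
  qed
qed

lemma submod_self: "unital_subring R \<Longrightarrow> submod R R"
  by (simp add: submod_def unital_subringD)

lemma submodD:
  assumes "submod R E"
  shows "0 \<in> E" "x \<in> E \<Longrightarrow> y \<in> E \<Longrightarrow> x + y \<in> E" "a \<in> R \<Longrightarrow> x \<in> E \<Longrightarrow> a * x \<in> E"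
  using assms unfolding submod_def by auto

lemma submod_sum:
  "submod R E \<Longrightarrow> (\<And>i. i \<in> I \<Longrightarrow> f i \<in> E) \<Longrightarrow> sum f I \<in> E"
  by (induction I rule: infinite_finite_induct) (auto simp: submodD)

lemma submod_scale:
  assumes "submod R E"
  shows "submod R ((\<lambda>x. z * x) ` E)"
  unfolding submod_def
proof (intro conjI ballI)
  show "0 \<in> (\<lambda>x. z * x) ` E" using submodD(1)[OF assms] by force
  fix x y assume "x \<in> (\<lambda>x. z * x) ` E" "y \<in> (\<lambda>x. z * x) ` E"
  then show "x + y \<in> (\<lambda>x. z * x) ` E"
    using submodD(2)[OF assms] by (auto simp: distrib_left[symmetric])
next
  fix a x assume "a \<in> R" "x \<in> (\<lambda>x. z * x) ` E"
  then obtain w where "w \<in> E" "x = z * w" by auto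
  then have "a * x = z * (a * w)" "a * w \<in> E" using submodD(3)[OF assms \<open>a \<in> R\<close>] by auto
  then show "a * x \<in> (\<lambda>x. z * x) ` E" by blast
qed

lemma submod_Int: "(\<And>i. i \<in> I \<Longrightarrow> submod R (E i)) \<Longrightarrow> submod R (\<Inter>i\<in>I. E i)"
  unfolding submod_def by auto

lemma Fbar_iff:
  "unital_subring R \<Longrightarrow> E \<in> Fbar R \<longleftrightarrow> submod R E \<and> (\<exists>e\<in>E. e \<noteq> 0)"
  unfolding Fbar_def by (auto simp: is_submodule_iff dest: submodD(1))

lemma Fbar_scale:
  assumes "unital_subring R" "E \<in> Fbar R" "z \<noteq> 0"
  shows "(\<lambda>x. z * x) ` E \<in> Fbar R"
  using assms by (auto simp: Fbar_iff submod_scale)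

lemma module_span_eq:
  "unital_subring R \<Longrightarrow> module_span R S = \<Inter>{E. submod R E \<and> S \<subseteq> E}"
  unfolding module_span_def by (simp add: is_submodule_iff)

lemma submod_module_span: "unital_subring R \<Longrightarrow> submod R (module_span R S)"
  unfolding module_span_eq submod_def by auto

lemma module_span_superset: "unital_subring R \<Longrightarrow> S \<subseteq> module_span R S"
  unfolding module_span_eq by auto

lemma module_span_least: "unital_subring R \<Longrightarrow> submod R E \<Longrightarrow> S \<subseteq> E \<Longrightarrow> module_span R S \<subseteq> E"
  unfolding module_span_eq by auto

lemma module_span_mono: "unital_subring R \<Longrightarrow> S \<subseteq> T \<Longrightarrow> module_span R S \<subseteq> module_span R T"
  unfolding module_span_eq by auto

lemma module_span_Fbar:
  "unital_subring R \<Longrightarrow> s \<in> S \<Longrightarrow> s \<noteq> 0 \<Longrightarrow> module_span R S \<in> Fbar R"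
  using module_span_superset[of R S] submod_module_span[of R S] by (auto simp: Fbar_iff)

lemma module_span_scale:
  assumes R: "unital_subring R"
  shows "module_span R ((\<lambda>x. z * x) ` S) = (\<lambda>x. z * x) ` module_span R S"
proof
  show "module_span R ((\<lambda>x. z * x) ` S) \<subseteq> (\<lambda>x. z * x) ` module_span R S"
    by (intro module_span_least[OF R] submod_scale[OF submod_module_span[OF R]])
      (use module_span_superset[OF R] in blast)
  have "module_span R S \<subseteq> {x. z * x \<in> module_span R ((\<lambda>x. z * x) ` S)}"
  proof (rule module_span_least[OF R])
    let ?M = "module_span R ((\<lambda>x. z * x) ` S)"
    have M: "submod R ?M" by (rule submod_module_span[OF R])
    show "submod R {x. z * x \<in> ?M}"
      using submodD[OF M] unfolding submod_def by (auto simp: distrib_left mult.left_commute)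
    show "S \<subseteq> {x. z * x \<in> ?M}"
      using module_span_superset[OF R] by blast
  qed
  then show "(\<lambda>x. z * x) ` module_span R S \<subseteq> module_span R ((\<lambda>x. z * x) ` S)" by auto
qed

text \<open>The elements supported by finite subsets of \<open>S\<close> already form a submodule containing \<open>S\<close>.\<close>

lemma module_span_finite_support:
  assumes R: "unital_subring R" and x: "x \<in> module_span R S"
  shows "\<exists>T. finite T \<and> T \<subseteq> S \<and> x \<in> module_span R T"
proof -
  let ?E = "{x. \<exists>T. finite T \<and> T \<subseteq> S \<and> x \<in> module_span R T}"
  have "module_span R S \<subseteq> ?E"
  proof (rule module_span_least[OF R])
    show "submod R ?E"
      unfolding submod_def
    proof (intro conjI ballI)
      show "0 \<in> ?E" using submodD(1)[OF submod_module_span[OF R]] by blast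
    next
      fix x y assume "x \<in> ?E" "y \<in> ?E"
      then obtain T U where "finite T" "T \<subseteq> S" "x \<in> module_span R T" "finite U" "U \<subseteq> S" "y \<in> module_span R U"
        by blast
      then have "x + y \<in> module_span R (T \<union> U)"
        using submodD(2)[OF submod_module_span[OF R]] module_span_mono[OF R, of T "T \<union> U"]
          module_span_mono[OF R, of U "T \<union> U"] by blast
      then show "x + y \<in> ?E" using \<open>finite T\<close> \<open>finite U\<close> \<open>T \<subseteq> S\<close> \<open>U \<subseteq> S\<close>
        by (intro CollectI exI[of _ "T \<union> U"]) auto
    next
      fix a x assume "a \<in> R" "x \<in> ?E"
      then show "a * x \<in> ?E" using submodD(3)[OF submod_module_span[OF R]] by blast
    qed
    show "S \<subseteq> ?E"
    proof
      fix s assume "s \<in> S"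
      then show "s \<in> ?E" using module_span_superset[OF R, of "{s}"] by (intro CollectI exI[of _ "{s}"]) auto
    qed
  qed
  then show ?thesis using x by blast
qed

lemma module_span_finite_sum:
  assumes R: "unital_subring R" and "finite T" and x: "x \<in> module_span R T"
  shows "\<exists>a. (\<forall>t\<in>T. a t \<in> R) \<and> x = (\<Sum>t\<in>T. a t * t)"
proof -
  let ?E = "{x. \<exists>a. (\<forall>t\<in>T. a t \<in> R) \<and> x = (\<Sum>t\<in>T. a t * t)}"
  have "module_span R T \<subseteq> ?E"
  proof (rule module_span_least[OF R])
    show "submod R ?E"
      unfolding submod_def
    proof (intro conjI ballI)
      show "0 \<in> ?E" by (rule CollectI, rule exI[of _ "\<lambda>_. 0"]) (auto simp: unital_subringD[OF R])
    next
      fix x y assume "x \<in> ?E" "y \<in> ?E"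
      then obtain a b where "\<forall>t\<in>T. a t \<in> R" "x = (\<Sum>t\<in>T. a t * t)" "\<forall>t\<in>T. b t \<in> R" "y = (\<Sum>t\<in>T. b t * t)"
        by blast
      then show "x + y \<in> ?E"
        by (intro CollectI exI[of _ "\<lambda>t. a t + b t"])
          (auto simp: unital_subringD[OF R] distrib_right sum.distrib)
    next
      fix c x assume "c \<in> R" "x \<in> ?E"
      then obtain a where "\<forall>t\<in>T. a t \<in> R" "x = (\<Sum>t\<in>T. a t * t)" by blast
      then show "c * x \<in> ?E" using \<open>c \<in> R\<close>
        by (intro CollectI exI[of _ "\<lambda>t. c * a t"])
          (auto simp: unital_subringD[OF R] sum_distrib_left mult.assoc)
    qed
    show "T \<subseteq> ?E"
    proof
      fix s assume s: "s \<in> T"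
      have "(\<Sum>t\<in>T. (if t = s then 1 else 0) * t) = (\<Sum>t\<in>T. if t = s then s else 0)"
        by (intro sum.cong) auto
      also have "\<dots> = s" using s \<open>finite T\<close> by simp
      finally show "s \<in> ?E"
        by (intro CollectI exI[of _ "\<lambda>t. if t = s then 1 else 0"]) (auto simp: unital_subringD[OF R])
    qed
  qed
  then show ?thesis using x by blast
qed

text \<open>The product of the denominators of the elements of \<open>S\<close>. This is what makes finitely
  generated submodules of the quotient field fractional.\<close>

lemma common_denominator:
  assumes R: "unital_subring R" and quot: "\<And>x. \<exists>a\<in>R. \<exists>b\<in>R. b \<noteq> 0 \<and> x = a / b" and "finite S"
  shows "\<exists>d\<in>R. d \<noteq> 0 \<and> (\<forall>s\<in>S. d * s \<in> R)"
  using \<open>finite S\<close>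
proof induction
  case empty
  then show ?case using unital_subringD(1)[OF R] by (intro bexI[of _ 1]) auto
next
  case (insert x S)
  then obtain d where d: "d \<in> R" "d \<noteq> 0" "\<forall>s\<in>S. d * s \<in> R" by blast
  obtain a b where ab: "a \<in> R" "b \<in> R" "b \<noteq> 0" "x = a / b" using quot by blast
  have "(d * b) * x = d * a" using ab by simp
  moreover have "(d * b) * s = b * (d * s)" for s by simp
  ultimately have "\<forall>s\<in>insert x S. (d * b) * s \<in> R"
    using d ab unital_subringD(6)[OF R] by (metis insert_iff)
  then show ?case using d ab unital_subringD(6)[OF R] by (intro bexI[of _ "d * b"]) auto
qed

text \<open>A common denominator of the generators is a common denominator of the module, so finite
  generation alone is what has to be checked.\<close>

lemma fg_fractional_iff:
  assumes R: "unital_subring R" and quot: "\<And>x. \<exists>a\<in>R. \<exists>b\<in>R. b \<noteq> 0 \<and> x = a / b"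
  shows "E \<in> fg_fractional R \<longleftrightarrow> (\<exists>S. finite S \<and> (\<exists>s\<in>S. s \<noteq> 0) \<and> E = module_span R S)"
proof
  assume "E \<in> fg_fractional R"
  then obtain S where S: "finite S" "E = module_span R S" and E: "E \<in> Fbar R"
    unfolding fg_fractional_def by blast
  have "\<exists>s\<in>S. s \<noteq> 0"
  proof (rule ccontr)
    assume "\<not> ?thesis"
    then have "S \<subseteq> {0}" by auto
    then have "module_span R S \<subseteq> {0}" by (intro module_span_least[OF R]) (auto simp: submod_def)
    then show False using E S(2) by (auto simp: Fbar_iff[OF R])
  qed
  then show "\<exists>S. finite S \<and> (\<exists>s\<in>S. s \<noteq> 0) \<and> E = module_span R S" using S by blast
next
  assume "\<exists>S. finite S \<and> (\<exists>s\<in>S. s \<noteq> 0) \<and> E = module_span R S"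
  then obtain S s where S: "finite S" "s \<in> S" "s \<noteq> 0" "E = module_span R S" by blast
  obtain d where d: "d \<in> R" "d \<noteq> 0" "\<forall>s\<in>S. d * s \<in> R"
    using common_denominator[OF R quot S(1)] by blast
  have "(\<lambda>x. d * x) ` E = module_span R ((\<lambda>x. d * x) ` S)"
    using S by (simp add: module_span_scale[OF R])
  also have "\<dots> \<subseteq> R"
    by (rule module_span_least[OF R]) (use d in \<open>auto simp: submod_def unital_subringD[OF R]\<close>)
  finally show "E \<in> fg_fractional R"
    unfolding fg_fractional_def using S d module_span_Fbar[OF R S(2,3)] by blast
qed

lemma ideal_sub_ring_iff:
  assumes R: "unital_subring R"
  shows "ideal I (sub_ring R) \<longleftrightarrow> submod R I \<and> I \<subseteq> R"
proof -
  interpret R: cring "sub_ring R" by (rule sub_ring_cring[OF R])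
  show ?thesis
  proof
    assume I: "ideal I (sub_ring R)"
    interpret ideal I "sub_ring R" by fact
    show "submod R I \<and> I \<subseteq> R"
      using zero_closed a_closed I_l_closed Icarr unfolding submod_def by auto
  next
    assume I: "submod R I \<and> I \<subseteq> R"
    show "ideal I (sub_ring R)"
    proof (rule idealI)
      show "ring (sub_ring R)" by (rule R.ring_axioms)
      show "subgroup I (add_monoid (sub_ring R))"
      proof (rule R.add.subgroupI)
        show "I \<subseteq> carrier (sub_ring R)" using I by simp
        show "I \<noteq> {}" using I submodD(1) by blast
        fix a assume a: "a \<in> I"
        then have "(- 1) * a \<in> I" using I submodD(3)[of R I "-1" a] unital_subringD(1,3)[OF R] by blast
        then show "\<ominus>\<^bsub>sub_ring R\<^esub> a \<in> I" using I a by (subst a_inv_sub_ring[OF R]) auto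
      qed (use I submodD(2) in auto)
      fix a x assume "a \<in> I" "x \<in> carrier (sub_ring R)"
      then have "x * a \<in> I" using I submodD(3)[of R I x a] by auto
      then show "x \<otimes>\<^bsub>sub_ring R\<^esub> a \<in> I" "a \<otimes>\<^bsub>sub_ring R\<^esub> x \<in> I"
        by (auto simp: mult.commute)
    qed
  qed
qed

text \<open>The coefficients beyond the degree are zero, and an ideal generated by elements of \<open>R\<close>
  is the \<open>R\<close>-module that they generate. Working with the whole range of the coefficient
  function avoids a case distinction for the zero polynomial.\<close>

lemma content_ideal_eq_module_span:
  assumes R: "unital_subring R" and f: "\<And>i. Polynomial.coeff f i \<in> R"
  shows "content_ideal R f = module_span R (range (Polynomial.coeff f))"
proof -
  interpret R: cring "sub_ring R" by (rule sub_ring_cring[OF R])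
  have idl: "ideal I (sub_ring R) \<longleftrightarrow> submod R I \<and> I \<subseteq> R" for I
    by (rule ideal_sub_ring_iff[OF R])
  have sR: "submod R R" using unital_subringD[OF R] by (auto simp: submod_def)
  have c: "range (Polynomial.coeff f) \<subseteq> I \<longleftrightarrow> set (coeffs f) \<subseteq> I" if "0 \<in> I" for I
    using that by (auto simp: range_coeff)
  have "content_ideal R f = \<Inter>{I. submod R I \<and> I \<subseteq> R \<and> set (coeffs f) \<subseteq> I}"
    unfolding content_ideal_def genideal_def idl by (simp add: conj_assoc)
  also have "\<dots> = \<Inter>{I. submod R I \<and> I \<subseteq> R \<and> range (Polynomial.coeff f) \<subseteq> I}"
    using c submodD(1) by (intro arg_cong[of _ _ Inter]) blast
  also have "\<dots> = module_span R (range (Polynomial.coeff f))"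
  proof
    show "\<Inter>{I. submod R I \<and> I \<subseteq> R \<and> range (Polynomial.coeff f) \<subseteq> I} \<subseteq> module_span R (range (Polynomial.coeff f))"
      using submod_module_span[OF R] module_span_superset[OF R]
        module_span_least[OF R sR, of "range (Polynomial.coeff f)"] f by blast
    show "module_span R (range (Polynomial.coeff f)) \<subseteq> \<Inter>{I. submod R I \<and> I \<subseteq> R \<and> range (Polynomial.coeff f) \<subseteq> I}"
      by (auto simp: module_span_eq[OF R])
  qed
  finally show ?thesis .
qed

definition prime_in :: "'l::field set \<Rightarrow> 'l set \<Rightarrow> bool" where
  "prime_in R P \<longleftrightarrow> submod R P \<and> P \<subseteq> R \<and> 1 \<notin> P \<and> (\<forall>x\<in>R. \<forall>y\<in>R. x * y \<in> P \<longrightarrow> x \<in> P \<or> y \<in> P)"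

lemma primeideal_sub_ring_iff:
  assumes R: "unital_subring R"
  shows "primeideal P (sub_ring R) \<longleftrightarrow> prime_in R P"
proof
  assume P: "primeideal P (sub_ring R)"
  interpret primeideal P "sub_ring R" by fact
  have i: "submod R P" "P \<subseteq> R" using is_ideal ideal_sub_ring_iff[OF R] by auto
  have "1 \<notin> P" using I_notcarr one_imp_carrier by auto
  then show "prime_in R P" using i I_prime unfolding prime_in_def by auto
next
  assume P: "prime_in R P"
  show "primeideal P (sub_ring R)"
    by (rule primeidealI)
      (use P unital_subringD(1)[OF R] ideal_sub_ring_iff[OF R] sub_ring_cring[OF R] in \<open>auto simp: prime_in_def\<close>)
qed

lemma Spec_sub_ring: "unital_subring R \<Longrightarrow> Spec (sub_ring R) = {P. prime_in R P}"
  unfolding Spec_def by (simp add: primeideal_sub_ring_iff)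

lemma prime_inD:
  assumes "prime_in R P"
  shows "submod R P" "P \<subseteq> R" "1 \<notin> P" "x \<in> R \<Longrightarrow> y \<in> R \<Longrightarrow> x * y \<in> P \<Longrightarrow> x \<in> P \<or> y \<in> P"
    "0 \<in> P"
  using assms submodD(1) unfolding prime_in_def by auto

section \<open>Topologies given by a subbasis\<close>

text \<open>Continuity needs to be tested on a subbasis only. Subbases here are always given as the
  image of a set comprehension, whence the form of the first premise.\<close>

lemma continuous_map_into_generated:
  assumes "T' = topology_generated_by S" "f ` topspace T \<subseteq> topspace T'"
    and "\<And>U. U \<in> S \<Longrightarrow> openin T (f -` U \<inter> topspace T)"
  shows "continuous_map T T' f"
  using assms unfolding assms(1)
  by (intro continuous_on_generated_topo) (simp_all add: topology_generated_by_topspace)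

lemma topspace_zariski_spec:
  assumes "cring R"
  shows "topspace (zariski_spec R) = Spec R"
proof -
  interpret cring R by fact
  have "\<one>\<^bsub>R\<^esub> \<notin> P" if "primeideal P R" for P
    using primeideal.I_notcarr[OF that] ideal.one_imp_carrier[OF primeideal.axioms(1)[OF that]] by metis
  then have "{P \<in> Spec R. \<one>\<^bsub>R\<^esub> \<notin> P} = Spec R" unfolding Spec_def by blast
  then show ?thesis unfolding zariski_spec_def topology_generated_by_topspace using one_closed by blast
qed

section \<open>Valuation rings and localizations inside a field\<close>

text \<open>For a valuation ring \<open>V\<close> and a set \<open>S\<close> with a nonzero element, this is the \<open>V\<close>-module
  generated by \<open>S\<close>. No sums occur, because among finitely many elements of \<open>S\<close> one divides all
  the others in \<open>V\<close>. As a consequence membership is a union of conditions, each on a single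
  quotient.\<close>

definition val_extension :: "'l::field set \<Rightarrow> 'l set \<Rightarrow> 'l set" where
  "val_extension V S = {x. \<exists>s\<in>S. s \<noteq> 0 \<and> x / s \<in> V}"

lemma Zar_iff:
  "V \<in> Zar R \<longleftrightarrow> unital_subring V \<and> R \<subseteq> V \<and> (\<forall>x. x \<noteq> 0 \<longrightarrow> x \<in> V \<or> inverse x \<in> V)"
  unfolding Zar_def by (simp add: subring_iff_unital_subring)

lemma ZarD:
  assumes "V \<in> Zar R"
  shows "unital_subring V" "R \<subseteq> V" "x \<noteq> 0 \<Longrightarrow> x \<in> V \<or> inverse x \<in> V"
    "x \<noteq> 0 \<Longrightarrow> y \<noteq> 0 \<Longrightarrow> x / y \<in> V \<or> y / x \<in> V"
proof -
  show "unital_subring V" "R \<subseteq> V" using assms by (auto simp: Zar_iff)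
  show *: "x \<noteq> 0 \<Longrightarrow> x \<in> V \<or> inverse x \<in> V" for x using assms by (auto simp: Zar_iff)
  show "x \<noteq> 0 \<Longrightarrow> y \<noteq> 0 \<Longrightarrow> x / y \<in> V \<or> y / x \<in> V" using *[of "x / y"] by auto
qed

lemma Zar_div_trans:
  "V \<in> Zar R \<Longrightarrow> y \<noteq> 0 \<Longrightarrow> x / y \<in> V \<Longrightarrow> y / z \<in> V \<Longrightarrow> x / z \<in> V"
  using unital_subringD(6)[OF ZarD(1), of V R "x / y" "y / z"] by simp

text \<open>Divisibility in \<open>V\<close> is a total preorder on the nonzero elements, so a finite set has an
  element that divides all others.\<close>

lemma Zar_max_elem:
  assumes V: "V \<in> Zar R" and "finite T" "\<exists>t\<in>T. t \<noteq> 0"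
  shows "\<exists>m\<in>T. m \<noteq> 0 \<and> (\<forall>t\<in>T. t / m \<in> V)"
  using assms(2,3)
proof (induction T)
  case (insert x T)
  show ?case
  proof (cases "\<exists>t\<in>T. t \<noteq> 0")
    case False
    then show ?thesis using insert unital_subringD(1,2)[OF ZarD(1)[OF V]] by (intro bexI[of _ x]) auto
  next
    case True
    then obtain m where m: "m \<in> T" "m \<noteq> 0" "\<forall>t\<in>T. t / m \<in> V" using insert by blast
    show ?thesis
    proof (cases "x / m \<in> V")
      case True then show ?thesis using m by blast
    next
      case False
      then have x: "x \<noteq> 0" using unital_subringD(2)[OF ZarD(1)[OF V]] by auto
      then have "m / x \<in> V" using ZarD(4)[OF V x m(2)] False by blast
      then have "\<forall>t\<in>insert x T. t / x \<in> V"
        using m x Zar_div_trans[OF V m(2)] unital_subringD(1)[OF ZarD(1)[OF V]] by auto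
      then show ?thesis using x by blast
    qed
  qed
qed auto

lemma submod_val_extension:
  assumes V: "V \<in> Zar R" and "\<exists>s\<in>S. s \<noteq> 0"
  shows "submod V (val_extension V S)"
  unfolding submod_def
proof (intro conjI ballI)
  note u = unital_subringD[OF ZarD(1)[OF V]]
  show "0 \<in> val_extension V S" using assms u(2) unfolding val_extension_def by auto
  fix x y assume "x \<in> val_extension V S" "y \<in> val_extension V S"
  then obtain s t where s: "s \<in> S" "s \<noteq> 0" "x / s \<in> V" and t: "t \<in> S" "t \<noteq> 0" "y / t \<in> V"
    unfolding val_extension_def by blast
  have "\<exists>r\<in>S. r \<noteq> 0 \<and> x / r \<in> V \<and> y / r \<in> V"
    using ZarD(4)[OF V s(2) t(2)] Zar_div_trans[OF V s(2) s(3)] Zar_div_trans[OF V t(2) t(3)] s t by blast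
  then show "x + y \<in> val_extension V S" using u(5) unfolding val_extension_def by (auto simp: add_divide_distrib)
next
  note u = unital_subringD[OF ZarD(1)[OF V]]
  fix a x assume "a \<in> V" "x \<in> val_extension V S"
  then obtain s where "s \<in> S" "s \<noteq> 0" "x / s \<in> V" unfolding val_extension_def by blast
  then show "a * x \<in> val_extension V S" using u(6)[OF \<open>a \<in> V\<close>, of "x / s"] unfolding val_extension_def by auto
qed

lemma submod_subring_mono: "submod V E \<Longrightarrow> R \<subseteq> V \<Longrightarrow> submod R E"
  unfolding submod_def by blast

lemma val_extension_superset: "V \<in> Zar R \<Longrightarrow> s \<in> S \<Longrightarrow> s \<noteq> 0 \<Longrightarrow> s \<in> val_extension V S"
  unfolding val_extension_def using unital_subringD(1)[OF ZarD(1)] by force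

lemma val_extension_mono: "S \<subseteq> T \<Longrightarrow> val_extension V S \<subseteq> val_extension V T"
  unfolding val_extension_def by blast

lemma val_extension_subset_val_extension:
  assumes V: "V \<in> Zar R" and "S \<subseteq> val_extension V T"
  shows "val_extension V S \<subseteq> val_extension V T"
proof
  fix x assume "x \<in> val_extension V S"
  then obtain s where s: "s \<in> S" "s \<noteq> 0" "x / s \<in> V" unfolding val_extension_def by blast
  then obtain t where "t \<in> T" "t \<noteq> 0" "s / t \<in> V" using assms unfolding val_extension_def by blast
  then show "x \<in> val_extension V T" using Zar_div_trans[OF V s(2,3)] unfolding val_extension_def by blast
qed

lemma val_extension_module_span:
  assumes R: "unital_subring R" and V: "V \<in> Zar R" and S: "\<exists>s\<in>S. s \<noteq> 0"
  shows "val_extension V (module_span R S) = val_extension V S"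
proof
  show "val_extension V S \<subseteq> val_extension V (module_span R S)" by (rule val_extension_mono[OF module_span_superset[OF R]])
  have "module_span R S \<subseteq> val_extension V S"
  proof (rule module_span_least[OF R])
    show m: "submod R (val_extension V S)"
      by (rule submod_subring_mono[OF submod_val_extension[OF V S] ZarD(2)[OF V]])
    show "S \<subseteq> val_extension V S" using val_extension_superset[OF V] submodD(1)[OF m] by (metis subsetI)
  qed
  then show "val_extension V (module_span R S) \<subseteq> val_extension V S" by (rule val_extension_subset_val_extension[OF V])
qed

text \<open>\<open>E V\<close> is reached without sums for the same reason as in the definition of
  \<open>val_extension\<close>.\<close>

lemma module_prod_Zar:
  assumes R: "unital_subring R" and V: "V \<in> Zar R" and E: "E \<in> Fbar R"
  shows "module_prod R E V = val_extension V E"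
proof
  have nz: "\<exists>e\<in>E. e \<noteq> 0" using E Fbar_iff[OF R] by blast
  note m = submod_val_extension[OF V nz]
  show "module_prod R E V \<subseteq> val_extension V E"
    unfolding module_prod_def
  proof (rule module_span_least[OF R])
    show "submod R (val_extension V E)" by (rule submod_subring_mono[OF m ZarD(2)[OF V]])
    show "{e * f |e f. e \<in> E \<and> f \<in> V} \<subseteq> val_extension V E"
    proof safe
      fix e f assume "e \<in> E" "f \<in> V"
      then show "e * f \<in> val_extension V E"
        using submodD(1)[OF m] submodD(3)[OF m, of f e] val_extension_superset[OF V, of e E]
        by (cases "e = 0") (auto simp: mult.commute)
    qed
  qed
  show "val_extension V E \<subseteq> module_prod R E V"
  proof
    fix x assume "x \<in> val_extension V E"
    then obtain e where "e \<in> E" "e \<noteq> 0" "x / e \<in> V" unfolding val_extension_def by blast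
    then have "x \<in> {e * f |e f. e \<in> E \<and> f \<in> V}"
      by (intro CollectI exI[of _ e] exI[of _ "x / e"]) auto
    then show "x \<in> module_prod R E V"
      unfolding module_prod_def by (rule subsetD[OF module_span_superset[OF R]])
  qed
qed

definition nonunits :: "'l::field set \<Rightarrow> 'l set" where
  "nonunits V = {x \<in> V. x = 0 \<or> inverse x \<notin> V}"

lemma inverse_mem_if_mult_mem:
  assumes "unital_subring V" "x \<in> V" "y \<in> V" "x * y \<noteq> 0" "inverse (x * y) \<in> V"
  shows "inverse x \<in> V"
proof -
  have "inverse x = y * inverse (x * y)" using assms(4) by (auto simp: field_simps)
  then show ?thesis using unital_subringD(6)[OF assms(1,3,5)] by metis
qed

lemma prime_in_nonunits:
  assumes V: "V \<in> Zar R"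
  shows "prime_in V (nonunits V)"
proof -
  note s = ZarD(1)[OF V]
  note u = unital_subringD[OF s]
  have mul: "a * x \<in> nonunits V" if "a \<in> V" "x \<in> nonunits V" for a x
    using that inverse_mem_if_mult_mem[OF s, of x a] u(6)[of a x]
    unfolding nonunits_def by (auto simp: mult.commute)
  have add1: "x + y \<in> nonunits V" if x: "x \<in> nonunits V" and y: "y \<in> nonunits V" "y \<noteq> 0" and xy: "x / y \<in> V" for x y
  proof -
    have "x + y = (x / y + 1) * y" using y(2) by (simp add: field_simps)
    then show ?thesis using mul[OF u(5)[OF xy u(1)] y(1)] by simp
  qed
  have "x + y \<in> nonunits V" if x: "x \<in> nonunits V" and y: "y \<in> nonunits V" for x y
  proof (cases "x = 0 \<or> y = 0")
    case True then show ?thesis using x y by auto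
  next
    case False
    then show ?thesis using ZarD(4)[OF V, of x y] add1[OF x y] add1[OF y x] by (auto simp: add.commute)
  qed
  then have "submod V (nonunits V)"
    using mul u(2) unfolding submod_def by (auto simp: nonunits_def)
  moreover have "x \<in> nonunits V \<or> y \<in> nonunits V" if "x \<in> V" "y \<in> V" "x * y \<in> nonunits V" for x y
    using that u(6)[of "inverse x" "inverse y"] unfolding nonunits_def by (auto simp: mult.commute)
  ultimately show ?thesis using u(1) unfolding prime_in_def nonunits_def by auto
qed

text \<open>The nonunits of a valuation ring form an ideal, which contains every proper ideal; it is
  therefore the one maximal ideal.\<close>

lemma max_ideal_Zar:
  assumes V: "V \<in> Zar R"
  shows "max_ideal V = nonunits V"
proof -
  note s = ZarD(1)[OF V]
  note u = unital_subringD[OF s]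
  note p = prime_inD[OF prime_in_nonunits[OF V]]
  have big: "J = V" if J: "submod V J" "J \<subseteq> V" "\<not> J \<subseteq> nonunits V" for J
  proof -
    obtain x where "x \<in> J" "x \<noteq> 0" "inverse x \<in> V" using J unfolding nonunits_def by blast
    then have "1 \<in> J" using submodD(3)[OF J(1), of "inverse x" x] by auto
    then have "a \<in> J" if "a \<in> V" for a using submodD(3)[OF J(1) that] by force
    then show "J = V" using J(2) by blast
  qed
  have "maximalideal M (sub_ring V) \<longleftrightarrow> M = nonunits V" for M
  proof
    assume "maximalideal M (sub_ring V)"
    then interpret maximalideal M "sub_ring V" .
    have M: "submod V M" "M \<subseteq> V" using is_ideal ideal_sub_ring_iff[OF s] by auto
    have "M \<subseteq> nonunits V" using big[OF M] I_notcarr by auto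
    moreover have "nonunits V = M \<or> nonunits V = V"
      using I_maximal[of "nonunits V"] p(1,2) ideal_sub_ring_iff[OF s] calculation by auto
    ultimately show "M = nonunits V" using p(3) u(1) by auto
  next
    assume M: "M = nonunits V"
    show "maximalideal M (sub_ring V)"
    proof (rule maximalidealI)
      show "ideal M (sub_ring V)" using M p(1,2) ideal_sub_ring_iff[OF s] by auto
      show "carrier (sub_ring V) \<noteq> M" using M p(3) u(1) by auto
      fix J assume J: "ideal J (sub_ring V)" "M \<subseteq> J" "J \<subseteq> carrier (sub_ring V)"
      then show "J = M \<or> J = carrier (sub_ring V)" using big[of J] M ideal_sub_ring_iff[OF s] by auto
    qed
  qed
  then show ?thesis unfolding max_ideal_def by simp
qed

lemma localize_superset: "unital_subring R \<Longrightarrow> prime_in R P \<Longrightarrow> R \<subseteq> localize R P"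
  unfolding localize_def using unital_subringD(1) prime_inD(3) by force

lemma unital_subring_localize:
  assumes R: "unital_subring R" and P: "prime_in R P"
  shows "unital_subring (localize R P)"
proof -
  note u = unital_subringD[OF R] and p = prime_inD[OF P]
  have m: "b * d \<in> R - P" "b \<noteq> 0" if "b \<in> R - P" "d \<in> R - P" for b d
    using that u(6) p(4,5) by auto
  have "x - y \<in> localize R P \<and> x * y \<in> localize R P" if xy: "x \<in> localize R P" "y \<in> localize R P" for x y
  proof -
    obtain a b c d where ab: "a \<in> R" "b \<in> R - P" "x = a / b" "c \<in> R" "d \<in> R - P" "y = c / d"
      using xy unfolding localize_def by blast
    have "x - y = (a * d - c * b) / (b * d)" "x * y = (a * c) / (b * d)"
      using ab m(2)[of b b] m(2)[of d d] by (auto simp: divide_simps algebra_simps)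
    moreover have "a * d - c * b \<in> R" "a * c \<in> R" using ab u(4,6) by auto
    ultimately show ?thesis using m(1)[OF ab(2,5)] unfolding localize_def by blast
  qed
  then show ?thesis
    using localize_superset[OF R P] u(1) unfolding unital_subring_def by blast
qed

text \<open>A prime is recovered from its localization as the contraction of the maximal ideal. This
  is why the localization determines the prime.\<close>

lemma mem_prime_iff_nonunit_localize:
  assumes R: "unital_subring R" and P: "prime_in R P" and x: "x \<in> R"
  shows "x \<in> P \<longleftrightarrow> x \<in> nonunits (localize R P)"
proof
  assume "x \<in> P"
  have "x = 0" if inv: "inverse x \<in> localize R P"
  proof (rule ccontr)
    assume "x \<noteq> 0"
    obtain a b where ab: "a \<in> R" "b \<in> R - P" "inverse x = a / b" using inv unfolding localize_def by blast
    then have "b \<noteq> 0" using prime_inD(5)[OF P] by auto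
    then have "b = a * x" using ab(3) \<open>x \<noteq> 0\<close> by (auto simp: field_simps)
    then have "b \<in> P" using submodD(3)[OF prime_inD(1)[OF P] ab(1) \<open>x \<in> P\<close>] by simp
    then show False using ab(2) by blast
  qed
  then show "x \<in> nonunits (localize R P)"
    using localize_superset[OF R P] x unfolding nonunits_def by blast
next
  assume n: "x \<in> nonunits (localize R P)"
  show "x \<in> P"
  proof (rule ccontr)
    assume "x \<notin> P"
    then have "x \<in> R - P" using x by blast
    moreover have "inverse x = 1 / x" by (simp add: divide_simps)
    ultimately have "inverse x \<in> localize R P" unfolding localize_def using unital_subringD(1)[OF R] by blast
    then show False using n \<open>x \<notin> P\<close> prime_inD(5)[OF P] unfolding nonunits_def by auto
  qed
qed

section \<open>Polynomials over a subring and Gaussian extensions\<close>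

lemma of_poly_simps [simp]:
  "of_poly (p + q) = of_poly p + of_poly q" "of_poly (p - q) = of_poly p - of_poly q"
  "of_poly (p * q) = of_poly p * of_poly q" "of_poly 0 = 0" "of_poly 1 = 1"
  "of_poly (- p) = - of_poly p"
  by (simp_all add: of_poly_def Zero_fract_def One_fract_def)

lemma of_poly_eq_iff [simp]: "of_poly p = of_poly q \<longleftrightarrow> p = q"
  by (simp add: of_poly_def eq_fract)

lemma of_poly_eq_0_iff [simp]: "of_poly p = 0 \<longleftrightarrow> p = 0"
  using of_poly_eq_iff[of p 0] by (simp del: of_poly_eq_iff)

lemma const_rat_simps [simp]:
  "const_rat (x + y) = const_rat x + const_rat y" "const_rat (x - y) = const_rat x - const_rat y"
  "const_rat (x * y) = const_rat x * const_rat y" "const_rat 0 = 0" "const_rat 1 = 1"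
  "const_rat x = const_rat y \<longleftrightarrow> x = y" "const_rat x = 0 \<longleftrightarrow> x = 0"
  using of_poly_simps(1)[of "[:x:]" "[:y:]"] of_poly_simps(2)[of "[:x:]" "[:y:]"]
    of_poly_simps(3)[of "[:x:]" "[:y:]"] of_poly_simps(5)
  by (simp_all add: const_rat_def pCons_one mult.commute del: of_poly_simps)

lemma const_rat_inverse [simp]: "const_rat (inverse x) = inverse (const_rat x)"
proof (cases "x = 0")
  case False
  then have "const_rat x * const_rat (inverse x) = 1"
    unfolding const_rat_simps(3)[symmetric] by simp
  then show ?thesis by (metis inverse_unique)
qed simp

lemma const_rat_divide [simp]: "const_rat (x / y) = const_rat x / const_rat y"
  by (simp add: divide_inverse)

lemma fraction_cases:
  obtains f g where "g \<noteq> 0" "x = of_poly f / of_poly g"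
proof (cases x)
  case (Fract a b)
  then show ?thesis using that[of b a] by (simp add: of_poly_def)
qed

text \<open>Zero is always a member, since coefficients vanish beyond the degree. So the set never
  depends on the degree, and \<open>coeff_set 0 = {0}\<close>.\<close>

definition coeff_set :: "'k::field poly \<Rightarrow> 'k set" where
  "coeff_set f = range (Polynomial.coeff f)"

lemma coeff_set_subset_iff: "coeff_set f \<subseteq> A \<longleftrightarrow> (\<forall>i. Polynomial.coeff f i \<in> A)"
  by (auto simp: coeff_set_def)

lemma coeff_set_iff: "x \<in> coeff_set f \<longleftrightarrow> (\<exists>i. x = Polynomial.coeff f i)"
  by (auto simp: coeff_set_def)

lemma coeff_in_coeff_set [simp, intro]: "Polynomial.coeff f i \<in> coeff_set f"
  by (simp add: coeff_set_def)

lemma finite_coeff_set: "finite (coeff_set f)"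
  by (simp add: coeff_set_def range_coeff)

lemma ex_nonzero_coeff_set: "f \<noteq> 0 \<Longrightarrow> \<exists>s\<in>coeff_set f. s \<noteq> 0"
  using leading_coeff_0_iff[of f] by (auto simp: coeff_set_def simp del: leading_coeff_0_iff)

lemma coeffs_closed:
  assumes R: "unital_subring R" and "coeff_set f \<subseteq> R" "coeff_set g \<subseteq> R"
  shows "coeff_set (f + g) \<subseteq> R" "coeff_set (f - g) \<subseteq> R" "coeff_set (f * g) \<subseteq> R"
proof -
  have fg: "Polynomial.coeff f i \<in> R" "Polynomial.coeff g i \<in> R" for i
    using assms by (auto simp: coeff_set_subset_iff)
  show "coeff_set (f + g) \<subseteq> R" "coeff_set (f - g) \<subseteq> R" using fg by (auto simp: coeff_set_subset_iff unital_subringD[OF R])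
  show "coeff_set (f * g) \<subseteq> R"
    using fg by (auto simp: coeff_set_subset_iff coeff_mult unital_subringD(6)[OF R] intro!: unital_subring_sum[OF R])
qed

lemma polys_over_iff: "of_poly f \<in> polys_over A \<longleftrightarrow> coeff_set f \<subseteq> A"
  unfolding polys_over_def by (auto simp: coeff_set_subset_iff)

lemma unital_subring_polys_over:
  assumes R: "unital_subring R"
  shows "unital_subring (polys_over R)"
proof -
  have "x - y \<in> polys_over R \<and> x * y \<in> polys_over R" if xy: "x \<in> polys_over R" "y \<in> polys_over R" for x y
  proof -
    obtain f g where fg: "x = of_poly f" "y = of_poly g" using xy unfolding polys_over_def by blast
    then have "coeff_set f \<subseteq> R" "coeff_set g \<subseteq> R" using xy polys_over_iff by auto
    then have "of_poly (f - g) \<in> polys_over R" "of_poly (f * g) \<in> polys_over R"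
      unfolding polys_over_iff using coeffs_closed[OF R] by auto
    then show ?thesis using fg by simp
  qed
  moreover have "of_poly 1 \<in> polys_over R"
    unfolding polys_over_iff using unital_subringD(1,2)[OF R] by (auto simp: coeff_set_subset_iff coeff_1)
  ultimately show ?thesis unfolding unital_subring_def by simp
qed

text \<open>If \<open>i\<close> and \<open>j\<close> are the least indices of coefficients of \<open>f\<close> and \<open>g\<close> outside \<open>P\<close>, then in
  the coefficient of \<open>f g\<close> at \<open>i + j\<close> every term but one lies in \<open>P\<close>.\<close>

lemma gauss_lemma:
  assumes R: "unital_subring R" and P: "prime_in R P"
    and f: "coeff_set f \<subseteq> R" and g: "coeff_set g \<subseteq> R" and fg: "coeff_set (f * g) \<subseteq> P"
  shows "coeff_set f \<subseteq> P \<or> coeff_set g \<subseteq> P"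
proof (rule ccontr)
  assume "\<not> ?thesis"
  then have ex: "\<exists>i. Polynomial.coeff f i \<notin> P" "\<exists>i. Polynomial.coeff g i \<notin> P" by (auto simp: coeff_set_subset_iff)
  define i where "i = (LEAST i. Polynomial.coeff f i \<notin> P)"
  define j where "j = (LEAST i. Polynomial.coeff g i \<notin> P)"
  have i: "Polynomial.coeff f i \<notin> P" and i': "\<And>k. k < i \<Longrightarrow> Polynomial.coeff f k \<in> P"
    unfolding i_def using LeastI_ex[OF ex(1)] not_less_Least by auto
  have j: "Polynomial.coeff g j \<notin> P" and j': "\<And>k. k < j \<Longrightarrow> Polynomial.coeff g k \<in> P"
    unfolding j_def using LeastI_ex[OF ex(2)] not_less_Least by auto
  have R': "Polynomial.coeff f k \<in> R" "Polynomial.coeff g k \<in> R" for k using f g by (auto simp: coeff_set_subset_iff)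
  have mP: "submod R P" by (rule prime_inD(1)[OF P])
  let ?h = "\<lambda>k. Polynomial.coeff f k * Polynomial.coeff g (i + j - k)"
  have "?h k \<in> P" if "k \<in> {..i + j} - {i}" for k
  proof (cases "k < i")
    case True
    then show ?thesis using submodD(3)[OF mP R'(2) i'] by (simp add: mult.commute)
  next
    case False
    then have "i + j - k < j" using that by auto
    then show ?thesis using submodD(3)[OF mP R'(1) j'] by simp
  qed
  then have s: "(\<Sum>k\<in>{..i + j} - {i}. ?h k) \<in> P" by (intro submod_sum[OF mP])
  have "Polynomial.coeff (f * g) (i + j) = ?h i + (\<Sum>k\<in>{..i + j} - {i}. ?h k)"
    unfolding coeff_mult by (rule sum.remove) auto
  then have "?h i = Polynomial.coeff (f * g) (i + j) + (- 1) * (\<Sum>k\<in>{..i + j} - {i}. ?h k)" by simp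
  also have "\<dots> \<in> P"
    using fg s unital_subringD(1,3)[OF R] by (intro submodD(2,3)[OF mP]) (auto simp: coeff_set_subset_iff)
  finally have "Polynomial.coeff f i * Polynomial.coeff g j \<in> P" by simp
  then show False using prime_inD(4)[OF P R'] i j by blast
qed

lemma prime_in_polys_over:
  assumes R: "unital_subring R" and P: "prime_in R P"
  shows "prime_in (polys_over R) (polys_over P)"
proof -
  have mP: "submod R P" by (rule prime_inD(1)[OF P])
  have o: "\<exists>f. x = of_poly f \<and> coeff_set f \<subseteq> A" if "x \<in> polys_over A" for x :: "'a poly fract" and A
    using that unfolding polys_over_def coeff_set_subset_iff by blast
  have "x + y \<in> polys_over P" if xy: "x \<in> polys_over P" "y \<in> polys_over P" for x y
  proof -
    obtain f g where fg: "x = of_poly f" "coeff_set f \<subseteq> P" "y = of_poly g" "coeff_set g \<subseteq> P" using o xy by metis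
    then have "of_poly (f + g) \<in> polys_over P"
      unfolding polys_over_iff coeff_set_subset_iff using submodD(2)[OF mP] by auto
    then show ?thesis using fg by simp
  qed
  moreover have "a * x \<in> polys_over P" if ax: "a \<in> polys_over R" "x \<in> polys_over P" for a x
  proof -
    obtain f g where fg: "a = of_poly f" "coeff_set f \<subseteq> R" "x = of_poly g" "coeff_set g \<subseteq> P" using o ax by metis
    then have "of_poly (f * g) \<in> polys_over P"
      unfolding polys_over_iff coeff_set_subset_iff by (auto simp: coeff_mult intro!: submod_sum[OF mP] submodD(3)[OF mP])
    then show ?thesis using fg by simp
  qed
  moreover have "of_poly 0 \<in> polys_over P" using submodD(1)[OF mP] unfolding polys_over_iff coeff_set_subset_iff by auto
  ultimately have "submod (polys_over R) (polys_over P)" unfolding submod_def by simp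
  moreover have "polys_over P \<subseteq> polys_over R" using prime_inD(2)[OF P] unfolding polys_over_def by blast
  moreover have "of_poly 1 \<notin> polys_over P"
  proof
    assume "of_poly 1 \<in> polys_over P"
    then have "Polynomial.coeff 1 0 \<in> P" unfolding polys_over_iff coeff_set_subset_iff by blast
    then show False using prime_inD(3)[OF P] by simp
  qed
  moreover have "x \<in> polys_over P \<or> y \<in> polys_over P"
    if xy: "x \<in> polys_over R" "y \<in> polys_over R" "x * y \<in> polys_over P" for x y
  proof -
    obtain f g where fg: "x = of_poly f" "coeff_set f \<subseteq> R" "y = of_poly g" "coeff_set g \<subseteq> R" using o xy by metis
    then have "of_poly (f * g) \<in> polys_over P" using xy by simp
    then have "coeff_set (f * g) \<subseteq> P" by (simp add: polys_over_iff del: of_poly_simps)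
    then show ?thesis using gauss_lemma[OF R P fg(2,4)] fg by (simp add: polys_over_iff)
  qed
  ultimately show ?thesis unfolding prime_in_def by simp
qed

text \<open>Dividing a polynomial by a coefficient of largest value makes it primitive, and
  primitive polynomials are units of \<open>V(X)\<close>. What remains of the fraction is a quotient of two
  constants, and the question whether it lies in \<open>V\<close>. The criterion holds for every
  representation of the fraction.\<close>

lemma fraction_mem_gauss_ext:
  assumes V: "V \<in> Zar R" and g: "g \<noteq> 0"
  shows "of_poly f / of_poly g \<in> gauss_ext V \<longleftrightarrow> coeff_set f \<subseteq> val_extension V (coeff_set g)"
proof -
  note s = ZarD(1)[OF V]
  note u = unital_subringD[OF s]
  note P = prime_in_nonunits[OF V]
  have ge: "gauss_ext V = localize (polys_over V) (polys_over (nonunits V))"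
    unfolding gauss_ext_def max_ideal_Zar[OF V] ..
  \<comment> \<open>\<open>h\<close> is a coefficient \<open>c\<close> of largest value times a primitive polynomial.\<close>
  have norm: "\<exists>c h'. c \<noteq> 0 \<and> c \<in> coeff_set h \<and> h = [:c:] * h' \<and> coeff_set h' \<subseteq> V \<and> 1 \<in> coeff_set h'" if h: "h \<noteq> 0" for h
  proof -
    obtain c where c: "c \<in> coeff_set h" "c \<noteq> 0" "\<forall>t\<in>coeff_set h. t / c \<in> V"
      using Zar_max_elem[OF V finite_coeff_set ex_nonzero_coeff_set[OF h]] by blast
    have "h = [:c:] * ([:inverse c:] * h)" using c(2) by simp
    moreover have cc: "Polynomial.coeff ([:inverse c:] * h) i = Polynomial.coeff h i / c" for i
      by (simp add: divide_inverse mult.commute)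
    moreover have "coeff_set ([:inverse c:] * h) \<subseteq> V" using c cc by (auto simp: coeff_set_subset_iff)
    moreover have "1 \<in> coeff_set ([:inverse c:] * h)"
    proof -
      obtain i where "c = Polynomial.coeff h i" using c(1) by (auto simp: coeff_set_iff)
      then have "Polynomial.coeff ([:inverse c:] * h) i = 1" using cc[of i] c(2) by simp
      then show ?thesis by (metis coeff_in_coeff_set)
    qed
    ultimately show ?thesis using c by blast
  qed
  have one: "1 \<notin> nonunits V" using u(1) unfolding nonunits_def by auto
  obtain d g' where d: "d \<noteq> 0" "d \<in> coeff_set g" "g = [:d:] * g'" "coeff_set g' \<subseteq> V" "1 \<in> coeff_set g'"
    using norm[OF g] by blast
  show ?thesis
  proof
    assume "of_poly f / of_poly g \<in> gauss_ext V"
    then obtain a b where ab: "coeff_set a \<subseteq> V" "coeff_set b \<subseteq> V" "\<not> coeff_set b \<subseteq> nonunits V"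
      and eq: "of_poly f / of_poly g = of_poly a / of_poly b"
      unfolding ge localize_def polys_over_def coeff_set_subset_iff by blast
    have b: "b \<noteq> 0" using ab(3) prime_inD(5)[OF P] by (auto simp: coeff_set_subset_iff)
    have "of_poly (f * b) = of_poly (a * g)" using eq g b by (simp add: field_simps)
    then have fb: "f * b = a * g" by (simp del: of_poly_simps)
    show "coeff_set f \<subseteq> val_extension V (coeff_set g)"
    proof (cases "f = 0")
      case True
      have "submod V (val_extension V (coeff_set g))" by (rule submod_val_extension[OF V ex_nonzero_coeff_set[OF g]])
      then show ?thesis using True submodD(1) by (auto simp: coeff_set_subset_iff)
    next
      case False
      obtain c f' where c: "c \<noteq> 0" "c \<in> coeff_set f" "f = [:c:] * f'" "coeff_set f' \<subseteq> V" "1 \<in> coeff_set f'"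
        using norm[OF False] by blast
      have "\<not> coeff_set (f' * b) \<subseteq> nonunits V"
        using gauss_lemma[OF s P c(4) ab(2)] ab(3) c(5) one by auto
      then obtain k where k: "Polynomial.coeff (f' * b) k \<notin> nonunits V" by (auto simp: coeff_set_subset_iff)
      let ?w = "Polynomial.coeff (f' * b) k"
      have w: "?w \<in> V" using coeffs_closed(3)[OF s c(4) ab(2)] by (auto simp: coeff_set_subset_iff)
      then have w': "?w \<noteq> 0" "inverse ?w \<in> V" using k unfolding nonunits_def by auto
      have v: "Polynomial.coeff (a * g') k \<in> V" (is "?v \<in> V") using coeffs_closed(3)[OF s ab(1) d(4)] by (auto simp: coeff_set_subset_iff)
      have "[:c:] * (f' * b) = [:d:] * (a * g')" using fb c(3) d(3) by (simp only: mult.assoc mult.left_commute)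
      then have "Polynomial.coeff ([:c:] * (f' * b)) k = Polynomial.coeff ([:d:] * (a * g')) k" by simp
      then have "c * ?w = d * ?v" by simp
      then have "c / d = ?v * inverse ?w" using w'(1) d(1) by (simp add: field_simps)
      then have cd: "c / d \<in> V" using u(6)[OF v w'(2)] by metis
      show ?thesis
      proof
        fix x assume "x \<in> coeff_set f"
        then obtain i where "x = c * Polynomial.coeff f' i" using c(3) by (auto simp: coeff_set_iff)
        moreover have "Polynomial.coeff f' i \<in> V" using c(4) by (auto simp: coeff_set_subset_iff)
        ultimately have "x / d \<in> V" using u(6)[OF cd] by (metis times_divide_eq_left)
        then show "x \<in> val_extension V (coeff_set g)" using d(1,2) unfolding val_extension_def by blast
      qed
    qed
  next
    assume f: "coeff_set f \<subseteq> val_extension V (coeff_set g)"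
    have "Polynomial.coeff ([:inverse d:] * f) i \<in> V" for i
    proof -
      obtain j where j: "Polynomial.coeff g j \<noteq> 0" "Polynomial.coeff f i / Polynomial.coeff g j \<in> V"
        using f unfolding val_extension_def coeff_set_subset_iff coeff_set_iff mem_Collect_eq Bex_def by metis
      have "Polynomial.coeff g j / d = Polynomial.coeff g' j" using d(1,3) by simp
      then have "Polynomial.coeff g j / d \<in> V" using d(4) by (auto simp: coeff_set_subset_iff)
      then show ?thesis using Zar_div_trans[OF V j] by (simp add: divide_inverse mult.commute)
    qed
    then have "of_poly ([:inverse d:] * f) \<in> polys_over V" unfolding polys_over_iff coeff_set_subset_iff by blast
    moreover have "of_poly g' \<in> polys_over V - polys_over (nonunits V)"
      using d(4,5) one by (auto simp: polys_over_iff subset_iff)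
    moreover have "of_poly f / of_poly g = of_poly ([:inverse d:] * f) / of_poly g'"
    proof -
      have 1: "of_poly g = const_rat d * of_poly g'"
        unfolding const_rat_def by (subst d(3)) (rule of_poly_simps(3))
      have 2: "of_poly ([:inverse d:] * f) = inverse (const_rat d) * of_poly f"
        using of_poly_simps(3)[of "[:inverse d:]" f] unfolding const_rat_def[symmetric] const_rat_inverse .
      show ?thesis unfolding 1 2 using d(1) by (simp add: field_simps)
    qed
    ultimately show "of_poly f / of_poly g \<in> gauss_ext V" unfolding ge localize_def by blast
  qed
qed

lemma unital_subring_gauss_ext:
  assumes V: "V \<in> Zar R"
  shows "unital_subring (gauss_ext V)"
  unfolding gauss_ext_def max_ideal_Zar[OF V]
  by (rule unital_subring_localize[OF unital_subring_polys_over prime_in_polys_over])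
    (use ZarD(1)[OF V] prime_in_nonunits[OF V] in auto)

text \<open>The modules generated by two finite sets are comparable over a valuation ring.\<close>

lemma gauss_ext_valuation:
  assumes V: "V \<in> Zar R" and x: "x \<noteq> 0"
  shows "x \<in> gauss_ext V \<or> inverse x \<in> gauss_ext V"
proof -
  obtain f g where fg: "g \<noteq> 0" "x = of_poly f / of_poly g" by (rule fraction_cases)
  have f: "f \<noteq> 0" using fg x by auto
  have c: "coeff_set p \<subseteq> val_extension V (coeff_set q)" if "m \<in> coeff_set q" "m \<noteq> 0" "\<forall>t\<in>coeff_set p \<union> coeff_set q. t / m \<in> V" for p q m
    using that unfolding val_extension_def by blast
  obtain m where m: "m \<in> coeff_set f \<union> coeff_set g" "m \<noteq> 0" "\<forall>t\<in>coeff_set f \<union> coeff_set g. t / m \<in> V"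
    using Zar_max_elem[OF V, of "coeff_set f \<union> coeff_set g"] finite_coeff_set[of f] finite_coeff_set[of g] ex_nonzero_coeff_set[OF f] by blast
  have "coeff_set f \<subseteq> val_extension V (coeff_set g) \<or> coeff_set g \<subseteq> val_extension V (coeff_set f)" using m c[of m g f] c[of m f g] by blast
  then show ?thesis
    using fraction_mem_gauss_ext[OF V fg(1), of f] fraction_mem_gauss_ext[OF V f, of g] fg(2) by simp
qed

lemma const_mem_gauss_ext:
  assumes V: "V \<in> Zar R"
  shows "const_rat x \<in> gauss_ext V \<longleftrightarrow> x \<in> V"
proof -
  have "const_rat x = of_poly [:x:] / of_poly 1" by (simp add: const_rat_def)
  moreover have "coeff_set [:x:] \<subseteq> val_extension V (coeff_set 1) \<longleftrightarrow> x \<in> V"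
  proof
    assume "coeff_set [:x:] \<subseteq> val_extension V (coeff_set 1)"
    moreover have "x \<in> coeff_set [:x:]" using coeff_in_coeff_set[of "[:x:]" 0] by simp
    ultimately have "x \<in> val_extension V (coeff_set 1)" by blast
    then show "x \<in> V" unfolding val_extension_def by (auto simp: coeff_set_iff coeff_1 split: if_splits)
  next
    assume x: "x \<in> V"
    have 1: "(1::'a) \<in> coeff_set 1" using coeff_in_coeff_set[of "1 :: 'a poly" 0] by simp
    have "y \<in> V" if "y \<in> coeff_set [:x:]" for y
    proof -
      obtain i where "y = Polynomial.coeff [:x:] i" using \<open>y \<in> coeff_set [:x:]\<close> by (auto simp: coeff_set_iff)
      then show ?thesis using x unital_subringD(2)[OF ZarD(1)[OF V]] by (cases i) auto
    qed
    then have "y \<in> val_extension V (coeff_set 1)" if "y \<in> coeff_set [:x:]" for y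
      using that 1 unfolding val_extension_def by (intro CollectI bexI[of _ 1]) auto
    then show "coeff_set [:x:] \<subseteq> val_extension V (coeff_set 1)" by blast
  qed
  ultimately show ?thesis using fraction_mem_gauss_ext[OF V, of 1 "[:x:]"] by simp
qed

section \<open>Content-closed subrings of the rational function field\<close>

text \<open>With a coefficient of \<open>h\<close> as \<open>f\<close>, this says that \<open>h\<close> divides each of its coefficients;
  with \<open>h = 1\<close> and a power of the indeterminate as \<open>f\<close>, that \<open>B\<close> contains \<open>X\<close>, so that
  conversely the coefficients generate \<open>h\<close>. Hence over \<open>B\<close> a polynomial generates the same
  module as its coefficients. The property holds for \<open>Kr(D)\<close> and for the Kronecker function
  rings of eab operations, and it passes to overrings.\<close>

definition content_closed :: "'k::field poly fract set \<Rightarrow> bool" where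
  "content_closed B \<longleftrightarrow> unital_subring B \<and>
     (\<forall>f h. h \<noteq> 0 \<longrightarrow> coeff_set f \<subseteq> insert 0 (coeff_set h) \<longrightarrow> of_poly f / of_poly h \<in> B)"

lemma content_closedD:
  assumes "content_closed B"
  shows "unital_subring B" "h \<noteq> 0 \<Longrightarrow> coeff_set f \<subseteq> insert 0 (coeff_set h) \<Longrightarrow> of_poly f / of_poly h \<in> B"
  using assms unfolding content_closed_def by blast+

lemma content_closed_mono:
  "content_closed B \<Longrightarrow> B \<subseteq> W \<Longrightarrow> unital_subring W \<Longrightarrow> content_closed W"
  unfolding content_closed_def by blast

lemma coeff_set_const: "coeff_set [:c:] \<subseteq> {c, 0}"
  by (auto simp: coeff_set_iff coeff_pCons gr0_conv_Suc split: nat.splits)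

lemma one_in_coeff_set_1: "1 \<in> coeff_set 1"
  using coeff_in_coeff_set[of "1 :: 'a::field poly" 0] by simp

lemma coeff_set_monom: "coeff_set (Polynomial.monom 1 n :: 'k::field poly) \<subseteq> {0, 1}" "1 \<in> coeff_set (Polynomial.monom 1 n :: 'k poly)"
proof -
  show "coeff_set (Polynomial.monom 1 n :: 'k poly) \<subseteq> {0, 1}" by (auto simp: coeff_set_iff split: if_splits)
  show "1 \<in> coeff_set (Polynomial.monom 1 n :: 'k poly)"
    using coeff_in_coeff_set[of "Polynomial.monom 1 n :: 'k poly" n] by simp
qed

lemma coeff_div_mem:
  assumes "content_closed B" "f \<noteq> 0" "c \<in> coeff_set f"
  shows "const_rat c / of_poly f \<in> B"
  unfolding const_rat_def using coeff_set_const[of c] assms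
  by (intro content_closedD(2)) auto

lemma X_power_mem:
  assumes "content_closed B"
  shows "of_poly (Polynomial.monom 1 n) \<in> B"
proof -
  have "of_poly (Polynomial.monom 1 n) / of_poly 1 \<in> B"
    using coeff_set_monom(1) one_in_coeff_set_1 by (intro content_closedD(2)[OF assms]) auto
  then show ?thesis by simp
qed

text \<open>A shift of \<open>g\<close> beyond the degree of \<open>f\<close> keeps the coefficients of the two polynomials
  apart.\<close>

lemma coeff_set_shifted_sum:
  fixes f g :: "'k::field poly"
  assumes "Polynomial.degree f < n"
  shows "coeff_set (f + Polynomial.monom 1 n * g) = coeff_set f \<union> coeff_set g"
proof
  show "coeff_set (f + Polynomial.monom 1 n * g) \<subseteq> coeff_set f \<union> coeff_set g"
    using assms by (auto simp: coeff_set_subset_iff coeff_monom_mult coeff_eq_0)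
  have "Polynomial.coeff f i = Polynomial.coeff (f + Polynomial.monom 1 n * g) i" if "i < n" for i
    using that by (simp add: coeff_monom_mult)
  moreover have "Polynomial.coeff f i = Polynomial.coeff f n" if "\<not> i < n" for i
    using that assms by (simp add: coeff_eq_0)
  moreover have "Polynomial.coeff g i = Polynomial.coeff (f + Polynomial.monom 1 n * g) (n + i)" for i
    using assms by (simp add: coeff_monom_mult coeff_eq_0)
  moreover have "Polynomial.coeff f n \<in> coeff_set (f + Polynomial.monom 1 n * g)"
  proof -
    have "Polynomial.coeff (f + Polynomial.monom 1 n * g) (n + Suc (Polynomial.degree g)) = 0"
      using assms by (simp add: coeff_monom_mult coeff_eq_0)
    moreover have "Polynomial.coeff f n = 0" using assms by (simp add: coeff_eq_0)
    ultimately show ?thesis by (metis coeff_in_coeff_set)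
  qed
  ultimately show "coeff_set f \<union> coeff_set g \<subseteq> coeff_set (f + Polynomial.monom 1 n * g)"
    unfolding Un_subset_iff coeff_set_subset_iff by (metis coeff_in_coeff_set)
qed

text \<open>The polynomial \<open>h\<close> carries the coefficients of both \<open>f\<close> and \<open>g\<close>, so it divides both over
  \<open>B\<close>.\<close>

lemma bezout_split:
  fixes f g :: "'k::field poly"
  assumes B: "content_closed B" and "f \<noteq> 0 \<or> g \<noteq> 0"
  obtains h n where "h \<noteq> 0" "h = f + Polynomial.monom 1 n * g"
    "of_poly f / of_poly h \<in> B" "of_poly g / of_poly h \<in> B"
proof -
  define n where "n = Suc (Polynomial.degree f)"
  define h where "h = f + Polynomial.monom 1 n * g"
  have c: "coeff_set h = coeff_set f \<union> coeff_set g" unfolding h_def by (rule coeff_set_shifted_sum) (simp add: n_def)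
  have "\<exists>s\<in>coeff_set h. s \<noteq> 0" using assms c ex_nonzero_coeff_set by blast
  then have "h \<noteq> 0" by (auto simp: coeff_set_iff)
  then show ?thesis
    using that[OF _ h_def] c content_closedD(2)[OF B, of h f] content_closedD(2)[OF B, of h g] by blast
qed

text \<open>For \<open>x = f / g\<close> and \<open>h = f + X\<^sup>n g\<close> as above, the elements \<open>f / h\<close> and \<open>X\<^sup>n (g / h)\<close> of
  \<open>B\<close> have sum 1, so one of them is not in \<open>N\<close>. Hence \<open>f / h\<close> or \<open>g / h\<close> is a unit of the
  localization, which makes \<open>x\<close> or its inverse a member.\<close>

lemma localize_mem_Zar:
  assumes B: "content_closed B" and N: "prime_in B N"
  shows "localize B N \<in> Zar B"
proof -
  note s = content_closedD(1)[OF B]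
  have "x \<in> localize B N \<or> inverse x \<in> localize B N" if x: "x \<noteq> 0" for x
  proof -
    obtain f g where fg: "g \<noteq> 0" "x = of_poly f / of_poly g" by (rule fraction_cases)
    then have f: "f \<noteq> 0" using x by auto
    obtain h n where h: "h \<noteq> 0" "h = f + Polynomial.monom 1 n * g"
      "of_poly f / of_poly h \<in> B" "of_poly g / of_poly h \<in> B"
      using bezout_split[OF B, of f g] fg(1) by metis
    define u v w where "u = of_poly f / of_poly h" and "v = of_poly g / of_poly h"
      and "w = of_poly (Polynomial.monom 1 n :: 'a poly)"
    have B': "u \<in> B" "v \<in> B" "w \<in> B"
      using h(3,4) X_power_mem[OF B] unfolding u_def v_def w_def by auto
    have hs: "of_poly h = of_poly f + w * of_poly g" unfolding w_def h(2) by simp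
    have "u + w * v = (of_poly f + w * of_poly g) / of_poly h"
      unfolding u_def v_def by (simp add: add_divide_distrib)
    also have "\<dots> = 1" unfolding hs[symmetric] using h(1) by simp
    finally have 1: "u + w * v = 1" .
    have x: "x = u / v" using fg(2) h(1) unfolding u_def v_def by simp
    have "u \<notin> N \<or> v \<notin> N"
      using 1 prime_inD(3)[OF N] submodD(2)[OF prime_inD(1)[OF N], of u "w * v"]
        submodD(3)[OF prime_inD(1)[OF N] B'(3), of v] by auto
    then show ?thesis
    proof
      assume "u \<notin> N"
      then have "v / u \<in> localize B N" using B' unfolding localize_def by blast
      then show ?thesis using x by simp
    next
      assume "v \<notin> N"
      then have "u / v \<in> localize B N" using B' unfolding localize_def by blast
      then show ?thesis using x by simp
    qed
  qed
  then show ?thesis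
    unfolding Zar_iff using unital_subring_localize[OF s N] localize_superset[OF s N] by blast
qed

lemma Zar_trace:
  assumes W: "W \<in> Zar B" and D: "\<And>d. d \<in> D \<Longrightarrow> const_rat d \<in> B"
  shows "{x. const_rat x \<in> W} \<in> Zar D"
proof -
  note u = unital_subringD[OF ZarD(1)[OF W]]
  have "unital_subring {x. const_rat x \<in> W}" unfolding unital_subring_def using u by simp
  moreover have "D \<subseteq> {x. const_rat x \<in> W}" using D ZarD(2)[OF W] by blast
  moreover have "x \<in> {x. const_rat x \<in> W} \<or> inverse x \<in> {x. const_rat x \<in> W}" if "x \<noteq> 0" for x
    using ZarD(3)[OF W, of "const_rat x"] that by simp
  ultimately show ?thesis unfolding Zar_iff by blast
qed

text \<open>\<open>X\<close> lies in \<open>B\<close>, so a polynomial is a \<open>B\<close>-linear combination of its coefficients.\<close>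

lemma of_poly_mem_submod:
  assumes B: "content_closed B" and M: "submod B M" and f: "\<And>i. const_rat (Polynomial.coeff f i) \<in> M"
  shows "of_poly f \<in> M"
  using f
proof (induction f)
  case 0 then show ?case using submodD(1)[OF M] by simp
next
  case (pCons a p)
  have "const_rat (Polynomial.coeff p i) \<in> M" for i using pCons.prems[of "Suc i"] by simp
  then have "of_poly p \<in> M" by (rule pCons.IH)
  moreover have "const_rat a \<in> M" using pCons.prems[of 0] by simp
  moreover have "of_poly [:0, 1:] \<in> B" using X_power_mem[OF B, of 1] by (auto simp: monom_Suc pCons_one)
  moreover have "of_poly (pCons a p) = const_rat a + of_poly [:0, 1:] * of_poly p"
  proof -
    have "pCons a p = [:a:] + [:0, 1:] * p" by simp
    then show ?thesis unfolding const_rat_def by (metis of_poly_simps(1,3))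
  qed
  ultimately show ?case using submodD(2,3)[OF M] by metis
qed

section \<open>The Kronecker function ring and its prime ideals\<close>

text \<open>The prime of \<open>Kr(D)\<close> over which \<open>V(X)\<close> lies; the inverse of \<open>\<theta>\<close>.\<close>

definition center :: "'k::field set \<Rightarrow> 'k set \<Rightarrow> 'k poly fract set" where
  "center D V = nonunits (gauss_ext V) \<inter> Kr D"

locale quotient_field_domain =
  fixes D :: "'k::field set"
  assumes domain_with_quotient_field: "domain_with_quotient_field D"
begin

lemma D_subring: "unital_subring D"
  using domain_with_quotient_field subdomain_imp_unital_subring
  unfolding domain_with_quotient_field_def by blast

lemma D_quotient: "\<exists>a\<in>D. \<exists>b\<in>D. b \<noteq> 0 \<and> x = a / b"
  using domain_with_quotient_field unfolding domain_with_quotient_field_def by blast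

text \<open>An ideal and a set of generators have the same extension to \<open>V\<close>.\<close>

lemma b_op_content_ideal:
  assumes "g \<noteq> 0" "coeff_set g \<subseteq> D"
  shows "b_op D (content_ideal D g) = (\<Inter>V\<in>Zar D. val_extension V (coeff_set g))"
proof -
  obtain s where s: "s \<in> coeff_set g" "s \<noteq> 0" using ex_nonzero_coeff_set[OF assms(1)] by blast
  have c: "content_ideal D g = module_span D (coeff_set g)"
    unfolding coeff_set_def using assms(2) by (intro content_ideal_eq_module_span[OF D_subring]) (auto simp: coeff_set_subset_iff)
  have F: "module_span D (coeff_set g) \<in> Fbar D" by (rule module_span_Fbar[OF D_subring s])
  have "module_prod D (module_span D (coeff_set g)) V = val_extension V (coeff_set g)" if "V \<in> Zar D" for V
    using module_prod_Zar[OF D_subring that F] val_extension_module_span[OF D_subring that] s by blast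
  then show ?thesis unfolding b_op_def wedge_def c using F by simp
qed

text \<open>Multiplying numerator and denominator by a common denominator of the coefficients brings
  every fraction into the form required in the definition of \<open>Kr(D)\<close>. The condition
  \<open>c(f) \<subseteq> c(g)\<^sup>b\<close> is then tested at one valuation ring at a time, where it says that the
  fraction lies in \<open>V(X)\<close>.\<close>

lemma Kr_eq: "Kr D = {x. \<forall>V\<in>Zar D. x \<in> gauss_ext V}"
proof (intro equalityI subsetI)
  fix x assume "x \<in> Kr D"
  then obtain f g where fg: "x = of_poly f / of_poly g" "coeff_set f \<subseteq> D" "coeff_set g \<subseteq> D" "g \<noteq> 0"
    "content_ideal D f \<subseteq> b_op D (content_ideal D g)"
    unfolding Kr_def coeff_set_subset_iff by blast
  have "content_ideal D f = module_span D (coeff_set f)"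
    unfolding coeff_set_def using fg(2) by (intro content_ideal_eq_module_span[OF D_subring]) (auto simp: coeff_set_subset_iff)
  then have "coeff_set f \<subseteq> val_extension V (coeff_set g)" if "V \<in> Zar D" for V
    using fg(5) module_span_superset[OF D_subring, of "coeff_set f"] that
    unfolding b_op_content_ideal[OF fg(4,3)] by blast
  then show "x \<in> {x. \<forall>V\<in>Zar D. x \<in> gauss_ext V}"
    using fraction_mem_gauss_ext[OF _ fg(4)] fg(1) by blast
next
  fix x assume "x \<in> {x. \<forall>V\<in>Zar D. x \<in> gauss_ext V}"
  then have x: "x \<in> gauss_ext V" if "V \<in> Zar D" for V using that by blast
  obtain f g where fg: "g \<noteq> 0" "x = of_poly f / of_poly g" by (rule fraction_cases)
  obtain d where d: "d \<in> D" "d \<noteq> 0" "\<forall>t\<in>coeff_set f \<union> coeff_set g. d * t \<in> D"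
    using common_denominator[OF D_subring D_quotient, of "coeff_set f \<union> coeff_set g"] finite_coeff_set[of f] finite_coeff_set[of g] by blast
  define f' g' where "f' = [:d:] * f" and "g' = [:d:] * g"
  have x': "x = of_poly f' / of_poly g'"
    using fg d(2) unfolding f'_def g'_def of_poly_simps(3) by simp
  have g': "g' \<noteq> 0" using fg(1) d(2) unfolding g'_def by simp
  have D: "coeff_set f' \<subseteq> D" "coeff_set g' \<subseteq> D" using d(3) unfolding f'_def g'_def by (auto simp: coeff_set_subset_iff)
  have "content_ideal D f' = module_span D (coeff_set f')"
    unfolding coeff_set_def using D(1) by (intro content_ideal_eq_module_span[OF D_subring]) (auto simp: coeff_set_subset_iff)
  also have "\<dots> \<subseteq> (\<Inter>V\<in>Zar D. val_extension V (coeff_set g'))"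
  proof (rule module_span_least[OF D_subring])
    show "submod D (\<Inter>V\<in>Zar D. val_extension V (coeff_set g'))"
      by (rule submod_Int)
        (rule submod_subring_mono[OF submod_val_extension[OF _ ex_nonzero_coeff_set[OF g']] ZarD(2)])
    show "coeff_set f' \<subseteq> (\<Inter>V\<in>Zar D. val_extension V (coeff_set g'))"
      using x fraction_mem_gauss_ext[OF _ g'] unfolding x' by blast
  qed
  also have "\<dots> = b_op D (content_ideal D g')"
    by (rule b_op_content_ideal[OF g' D(2), symmetric])
  finally show "x \<in> Kr D"
    unfolding Kr_def using D g' x' by (auto simp: coeff_set_subset_iff)
qed

lemma fraction_mem_Kr:
  "g \<noteq> 0 \<Longrightarrow> of_poly f / of_poly g \<in> Kr D \<longleftrightarrow> (\<forall>V\<in>Zar D. coeff_set f \<subseteq> val_extension V (coeff_set g))"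
  unfolding Kr_eq using fraction_mem_gauss_ext by blast

lemma Kr_subring: "unital_subring (Kr D)"
  unfolding Kr_eq unital_subring_def using unital_subringD(1,4,6)[OF unital_subring_gauss_ext] by blast

lemma fraction_mem_Kr_if_coeff_set_subset:
  assumes "h \<noteq> 0" "coeff_set f \<subseteq> insert 0 (coeff_set h)"
  shows "of_poly f / of_poly h \<in> Kr D"
proof -
  have "coeff_set f \<subseteq> val_extension V (coeff_set h)" if V: "V \<in> Zar D" for V
  proof
    fix x assume "x \<in> coeff_set f"
    then show "x \<in> val_extension V (coeff_set h)"
      using assms(2) val_extension_superset[OF V, of x "coeff_set h"]
        submodD(1)[OF submod_val_extension[OF V ex_nonzero_coeff_set[OF assms(1)]]] by (cases "x = 0") auto
  qed
  then show ?thesis by (simp add: fraction_mem_Kr[OF assms(1)])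
qed

lemma content_closed_Kr: "content_closed (Kr D)"
  unfolding content_closed_def using Kr_subring fraction_mem_Kr_if_coeff_set_subset by blast

lemma const_mem_Kr: "d \<in> D \<Longrightarrow> const_rat d \<in> Kr D"
  unfolding Kr_eq using const_mem_gauss_ext ZarD(2) by blast

lemma Kr_domain: "\<exists>a\<in>Kr D. \<exists>b\<in>Kr D. b \<noteq> 0 \<and> x = a / b"
proof -
  obtain f g where fg: "g \<noteq> 0" "x = of_poly f / of_poly g" by (rule fraction_cases)
  obtain h n where h: "h \<noteq> 0" "of_poly f / of_poly h \<in> Kr D" "of_poly g / of_poly h \<in> Kr D"
    using bezout_split[OF content_closed_Kr, of f g] fg(1) by metis
  have "x = (of_poly f / of_poly h) / (of_poly g / of_poly h)" using fg h(1) by simp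
  moreover have "of_poly g / of_poly h \<noteq> 0" using fg h(1) by simp
  ultimately show ?thesis using h by blast
qed

lemma gauss_ext_mem_Zar_Kr: "V \<in> Zar D \<Longrightarrow> gauss_ext V \<in> Zar (Kr D)"
  unfolding Zar_iff[of "gauss_ext V"]
  using unital_subring_gauss_ext[of V D] gauss_ext_valuation[of V D] Kr_eq by blast

text \<open>A nonzero polynomial and its coefficient of largest value at \<open>W \<inter> K\<close> divide each other
  in \<open>W\<close>: one way because \<open>W\<close> contains \<open>Kr(D)\<close>, the other because \<open>W\<close> contains \<open>X\<close>. So
  membership in \<open>W\<close> depends on the contents alone, by the same criterion as membership in the
  Gaussian extension.\<close>

lemma Zar_Kr_eq_gauss_ext:
  assumes W: "W \<in> Zar (Kr D)"
  shows "W = gauss_ext {x. const_rat x \<in> W}"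
proof -
  define V where "V = {x. const_rat x \<in> W}"
  have V: "V \<in> Zar D" unfolding V_def by (rule Zar_trace[OF W const_mem_Kr])
  note s = ZarD(1)[OF W] and A = ZarD(2)[OF W]
  note cc = content_closed_mono[OF content_closed_Kr A s]
  note u = unital_subringD[OF s]
  have V_iff: "x \<in> V \<longleftrightarrow> const_rat x \<in> W" for x by (simp add: V_def)
  have sc: "of_poly p / const_rat c \<in> W" if "c \<noteq> 0" "\<And>i. Polynomial.coeff p i / c \<in> V" for p c
  proof -
    have "of_poly ([:inverse c:] * p) \<in> W"
    proof (rule of_poly_mem_submod[OF cc submod_self[OF s]])
      fix i
      have "Polynomial.coeff ([:inverse c:] * p) i = Polynomial.coeff p i / c" by (simp add: field_simps)
      then show "const_rat (Polynomial.coeff ([:inverse c:] * p) i) \<in> W" using that(2) by (simp only: V_iff)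
    qed
    moreover have "of_poly ([:inverse c:] * p) = inverse (const_rat c) * of_poly p"
      using of_poly_simps(3)[of "[:inverse c:]" p] unfolding const_rat_def[symmetric] const_rat_inverse .
    ultimately show ?thesis by (simp add: field_simps)
  qed
  have "x \<in> W \<longleftrightarrow> x \<in> gauss_ext V" for x
  proof -
    obtain f g where fg: "g \<noteq> 0" "x = of_poly f / of_poly g" by (rule fraction_cases)
    obtain c where c: "c \<in> coeff_set g" "c \<noteq> 0" "\<forall>t\<in>coeff_set g. t / c \<in> V"
      using Zar_max_elem[OF V finite_coeff_set ex_nonzero_coeff_set[OF fg(1)]] by blast
    have gc: "of_poly g / const_rat c \<in> W" using c by (intro sc) auto
    have cg: "const_rat c / of_poly g \<in> W"
      by (rule coeff_div_mem[OF cc fg(1) c(1)])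
    show ?thesis
    proof
      assume x: "x \<in> W"
      have "Polynomial.coeff f i / c \<in> V" for i
      proof (cases "f = 0")
        case True then show ?thesis using u(2) by (simp add: V_iff)
      next
        case False
        have "const_rat (Polynomial.coeff f i) / of_poly f \<in> W" by (rule coeff_div_mem[OF cc False coeff_in_coeff_set])
        then have "(const_rat (Polynomial.coeff f i) / of_poly f) * (x * (of_poly g / const_rat c)) \<in> W"
          using u(6) x gc by blast
        then show ?thesis using False fg c(2) by (simp add: V_iff)
      qed
      then have "coeff_set f \<subseteq> val_extension V (coeff_set g)" unfolding val_extension_def coeff_set_subset_iff using c by blast
      then show "x \<in> gauss_ext V" using fraction_mem_gauss_ext[OF V fg(1)] fg(2) by simp
    next
      assume "x \<in> gauss_ext V"
      then have f: "coeff_set f \<subseteq> val_extension V (coeff_set g)" using fraction_mem_gauss_ext[OF V fg(1)] fg(2) by simp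
      have "Polynomial.coeff f i / c \<in> V" for i
      proof -
        have "Polynomial.coeff f i \<in> val_extension V (coeff_set g)" using f by (auto simp: coeff_set_subset_iff)
        then obtain t where t: "t \<in> coeff_set g" "t \<noteq> 0" "Polynomial.coeff f i / t \<in> V"
          unfolding val_extension_def by blast
        then show ?thesis using Zar_div_trans[OF V t(2,3)] c(3) by blast
      qed
      then have "of_poly f / const_rat c \<in> W" by (intro sc c)
      then have "(of_poly f / const_rat c) * (const_rat c / of_poly g) \<in> W" using cg u(6) by blast
      then show "x \<in> W" using c(2) fg(2) by simp
    qed
  qed
  then show ?thesis unfolding V_def by blast
qed

lemma mem_Spec_Kr: "Q \<in> Spec (sub_ring (Kr D)) \<longleftrightarrow> prime_in (Kr D) Q"
  by (simp add: Spec_sub_ring[OF Kr_subring])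

lemma theta_mem_Zar: "prime_in (Kr D) Q \<Longrightarrow> theta D Q \<in> Zar D"
  unfolding theta_def by (rule Zar_trace[OF localize_mem_Zar[OF content_closed_Kr] const_mem_Kr])

lemma localize_Kr_eq: "prime_in (Kr D) Q \<Longrightarrow> localize (Kr D) Q = gauss_ext (theta D Q)"
  unfolding theta_def by (rule Zar_Kr_eq_gauss_ext[OF localize_mem_Zar[OF content_closed_Kr]])

text \<open>The localization at \<open>Q\<close> is the Gaussian extension of \<open>\<theta>(Q)\<close>, and it determines \<open>Q\<close>.\<close>

lemma center_theta: "prime_in (Kr D) Q \<Longrightarrow> center D (theta D Q) = Q"
  unfolding center_def localize_Kr_eq[symmetric]
  using mem_prime_iff_nonunit_localize[OF Kr_subring, of Q] prime_inD(2)[of "Kr D" Q] by blast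

text \<open>The coefficient 1 of \<open>1 + x X\<close> is a unit, so over every valuation ring both constants
  are multiples of the content.\<close>

lemma linear_fraction_mem_Kr:
  "of_poly 1 / of_poly [:1, x:] \<in> Kr D" "const_rat x / of_poly [:1, x:] \<in> Kr D"
proof -
  have c: "1 \<in> coeff_set [:1, x:]" "x \<in> coeff_set [:1, x:]"
    using coeff_in_coeff_set[of "[:1, x:]" 0] coeff_in_coeff_set[of "[:1, x:]" 1] by simp_all
  have "coeff_set (1 :: 'k poly) \<subseteq> {0, 1}" by (auto simp: coeff_set_iff)
  then show "of_poly 1 / of_poly [:1, x:] \<in> Kr D"
    using c by (intro fraction_mem_Kr_if_coeff_set_subset) auto
  show "const_rat x / of_poly [:1, x:] \<in> Kr D"
    unfolding const_rat_def using c coeff_set_const[of x] by (intro fraction_mem_Kr_if_coeff_set_subset) auto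
qed

text \<open>So the element \<open>1 / (1 + x X)\<close> of \<open>Kr(D)\<close> is a unit of \<open>V(X)\<close> exactly if \<open>x \<in> V\<close>. It
  detects the basic open subset of the Zariski-Riemann space given by \<open>x\<close>.\<close>

lemma linear_mem_gauss_ext_iff:
  assumes V: "V \<in> Zar D"
  shows "of_poly [:1, x:] \<in> gauss_ext V \<longleftrightarrow> x \<in> V"
proof -
  have "coeff_set [:1, x:] \<subseteq> val_extension V (coeff_set 1) \<longleftrightarrow> x \<in> V"
  proof
    assume "coeff_set [:1, x:] \<subseteq> val_extension V (coeff_set 1)"
    moreover have "x \<in> coeff_set [:1, x:]" using coeff_in_coeff_set[of "[:1, x:]" 1] by simp
    ultimately have "x \<in> val_extension V (coeff_set 1)" by blast
    then show "x \<in> V" unfolding val_extension_def by (auto simp: coeff_set_iff coeff_1 split: if_splits)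
  next
    assume x: "x \<in> V"
    have 1: "(1::'k) \<in> coeff_set 1" using coeff_in_coeff_set[of "1 :: 'k poly" 0] by simp
    have "Polynomial.coeff [:1, x:] i \<in> V" for i
      using x unital_subringD(1,2)[OF ZarD(1)[OF V]] by (auto simp: coeff_pCons split: nat.splits)
    then have "Polynomial.coeff [:1, x:] i \<in> val_extension V (coeff_set 1)" for i
      using 1 unfolding val_extension_def by (intro CollectI bexI[of _ 1]) auto
    then show "coeff_set [:1, x:] \<subseteq> val_extension V (coeff_set 1)" by (simp add: coeff_set_subset_iff)
  qed
  then show ?thesis using fraction_mem_gauss_ext[OF V, of 1 "[:1, x:]"] by simp
qed

lemma prime_in_center:
  assumes V: "V \<in> Zar D"
  shows "prime_in (Kr D) (center D V)"
proof -
  note W = gauss_ext_mem_Zar_Kr[OF V]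
  note p = prime_inD[OF prime_in_nonunits[OF W]]
  have sub: "Kr D \<subseteq> gauss_ext V" by (rule ZarD(2)[OF W])
  note s = submodD[OF p(1)] and k = unital_subringD[OF Kr_subring]
  have "submod (Kr D) (center D V)"
    unfolding submod_def center_def
  proof (intro conjI ballI)
    show "0 \<in> nonunits (gauss_ext V) \<inter> Kr D" using s(1) k(2) by blast
  next
    fix x y assume "x \<in> nonunits (gauss_ext V) \<inter> Kr D" "y \<in> nonunits (gauss_ext V) \<inter> Kr D"
    then show "x + y \<in> nonunits (gauss_ext V) \<inter> Kr D" using s(2) k(5) by simp
  next
    fix a x assume "a \<in> Kr D" "x \<in> nonunits (gauss_ext V) \<inter> Kr D"
    then show "a * x \<in> nonunits (gauss_ext V) \<inter> Kr D" using s(3)[of a x] k(6)[of a x] sub by auto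
  qed
  moreover have "x \<in> center D V \<or> y \<in> center D V" if "x \<in> Kr D" "y \<in> Kr D" "x * y \<in> center D V" for x y
    using that p(4)[of x y] sub unfolding center_def by auto
  moreover have "1 \<notin> center D V" using p(3) unfolding center_def by simp
  ultimately show ?thesis
    unfolding prime_in_def center_def by blast
qed

text \<open>An element \<open>x\<close> of \<open>V\<close> is the quotient of \<open>x / (1 + x X)\<close> by \<open>1 / (1 + x X)\<close>. Both are in
  \<open>Kr(D)\<close>, and the latter is a unit of \<open>V(X)\<close>, so it is outside the center.\<close>

lemma theta_center:
  assumes V: "V \<in> Zar D"
  shows "theta D (center D V) = V"
proof -
  define W where "W = localize (Kr D) (center D V)"
  note P = prime_in_center[OF V]
  have W: "W = gauss_ext (theta D (center D V))" unfolding W_def by (rule localize_Kr_eq[OF P])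
  note u = unital_subringD[OF unital_subring_gauss_ext[OF V]]
  have "W \<subseteq> gauss_ext V"
  proof
    fix x assume "x \<in> W"
    then obtain a b where ab: "a \<in> Kr D" "b \<in> Kr D" "b \<notin> center D V" "x = a / b"
      unfolding W_def localize_def by blast
    then have "a \<in> gauss_ext V" "inverse b \<in> gauss_ext V"
      using ZarD(2)[OF gauss_ext_mem_Zar_Kr[OF V]] unfolding center_def nonunits_def by auto
    then show "x \<in> gauss_ext V" using u(6) ab(4) by (simp add: divide_inverse)
  qed
  then have 1: "theta D (center D V) \<subseteq> V"
    unfolding theta_def W_def[symmetric] using const_mem_gauss_ext[OF V] by blast
  have "V \<subseteq> theta D (center D V)"
  proof
    fix x assume x: "x \<in> V"
    let ?l = "of_poly [:1, x:]"
    have l: "?l \<in> gauss_ext V" using x by (simp add: linear_mem_gauss_ext_iff[OF V])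
    have "inverse ?l \<notin> center D V" using l unfolding center_def nonunits_def by auto
    moreover have "inverse ?l \<in> Kr D" using linear_fraction_mem_Kr(1)[of x] by (simp add: divide_inverse)
    ultimately have "(const_rat x / ?l) / inverse ?l \<in> W"
      unfolding W_def localize_def using linear_fraction_mem_Kr(2)[of x] by blast
    then show "x \<in> theta D (center D V)" unfolding theta_def W_def by simp
  qed
  then show ?thesis using 1 by blast
qed

lemma max_ideal_gauss_ext: "V \<in> Zar D \<Longrightarrow> max_ideal (gauss_ext V) \<inter> Kr D = center D V"
  unfolding center_def using max_ideal_Zar[OF gauss_ext_mem_Zar_Kr] by blast

lemma Zset_eq:
  assumes Y: "Y \<subseteq> Spec (sub_ring (Kr D))"
  shows "Zset D Y = theta D ` Y"
proof -
  have "V \<in> Zset D Y \<longleftrightarrow> V \<in> theta D ` Y" for V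
    using Y theta_center[of V] center_theta theta_mem_Zar
    unfolding Zset_def by (auto simp: max_ideal_gauss_ext mem_Spec_Kr subset_iff image_iff) metis+
  then show ?thesis by blast
qed

section \<open>The homeomorphism onto the Zariski-Riemann space\<close>

text \<open>\<open>D[x]\<close> is the smallest ring containing \<open>D\<close> and \<open>x\<close>.\<close>

lemma mem_Zar_adjoin_iff: "V \<in> Zar (adjoin D x) \<longleftrightarrow> V \<in> Zar D \<and> x \<in> V"
proof -
  have "adjoin D x \<subseteq> V \<longleftrightarrow> D \<subseteq> V \<and> x \<in> V" if V: "unital_subring V"
  proof
    assume *: "adjoin D x \<subseteq> V"
    have "d \<in> adjoin D x" if "d \<in> D" for d
      unfolding adjoin_def using that unital_subringD(2)[OF D_subring]
      by (intro CollectI exI[of _ "[:d:]"]) (auto simp: coeff_pCons split: nat.splits)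
    moreover have "x \<in> adjoin D x"
      unfolding adjoin_def using unital_subringD(1,2)[OF D_subring]
      by (intro CollectI exI[of _ "[:0, 1:]"]) (auto simp: coeff_pCons split: nat.splits)
    ultimately show "D \<subseteq> V \<and> x \<in> V" using * by blast
  next
    assume *: "D \<subseteq> V \<and> x \<in> V"
    then have "poly p x \<in> V" if "\<forall>i. Polynomial.coeff p i \<in> D" for p
      using that unfolding poly_altdef
      by (intro unital_subring_sum[OF V] unital_subringD(6)[OF V] unital_subring_power[OF V]) auto
    then show "adjoin D x \<subseteq> V" unfolding adjoin_def by blast
  qed
  then show ?thesis unfolding Zar_iff by blast
qed

lemma topspace_zariski_spec_Kr: "topspace (zariski_spec (sub_ring (Kr D))) = {Q. prime_in (Kr D) Q}"
  using topspace_zariski_spec[OF sub_ring_cring[OF Kr_subring]] by (auto simp: mem_Spec_Kr)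

lemma topspace_zar_topology: "topspace (zar_topology D) = Zar D"
proof -
  have "Zar (adjoin D 1) = Zar D" using mem_Zar_adjoin_iff[of _ 1] unital_subringD(1)[OF ZarD(1)] by blast
  then show ?thesis
    unfolding zar_topology_def topology_generated_by_topspace using mem_Zar_adjoin_iff by blast
qed

lemma openin_zar_topology_basic: "openin (zar_topology D) {V \<in> Zar D. x \<in> V}"
proof -
  have "{V \<in> Zar D. x \<in> V} = Zar (adjoin D x)" using mem_Zar_adjoin_iff by blast
  then show ?thesis unfolding zar_topology_def by (auto intro: topology_generated_by_Basis)
qed

text \<open>The preimage of the set of all \<open>V\<close> containing \<open>x\<close> is the basic open set of
  \<open>1 / (1 + x X)\<close>.\<close>

lemma continuous_map_theta: "continuous_map (zariski_spec (sub_ring (Kr D))) (zar_topology D) (theta D)"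
proof (rule continuous_map_into_generated[OF zar_topology_def])
  show "theta D ` topspace (zariski_spec (sub_ring (Kr D))) \<subseteq> topspace (zar_topology D)"
    unfolding topspace_zariski_spec_Kr topspace_zar_topology using theta_mem_Zar by blast
next
  fix U assume "U \<in> {Zar (adjoin D x) |x. True}"
  then obtain x where U: "U = Zar (adjoin D x)" by blast
  let ?a = "of_poly 1 / of_poly [:1, x:]"
  have "x \<in> theta D Q \<longleftrightarrow> ?a \<notin> Q" if Q: "prime_in (Kr D) Q" for Q
  proof -
    have "?a \<notin> Q \<longleftrightarrow> ?a \<notin> nonunits (gauss_ext (theta D Q))"
      using center_theta[OF Q] linear_fraction_mem_Kr(1)[of x] unfolding center_def by blast
    also have "\<dots> \<longleftrightarrow> of_poly [:1, x:] \<in> gauss_ext (theta D Q)"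
      using linear_fraction_mem_Kr(1)[of x] ZarD(2)[OF gauss_ext_mem_Zar_Kr[OF theta_mem_Zar[OF Q]]]
      unfolding nonunits_def by (auto simp: divide_inverse)
    finally show ?thesis using linear_mem_gauss_ext_iff[OF theta_mem_Zar[OF Q]] by simp
  qed
  then have "theta D -` U \<inter> topspace (zariski_spec (sub_ring (Kr D))) = {Q \<in> Spec (sub_ring (Kr D)). ?a \<notin> Q}"
    unfolding U topspace_zariski_spec_Kr using theta_mem_Zar by (auto simp: mem_Zar_adjoin_iff mem_Spec_Kr)
  moreover have "openin (zariski_spec (sub_ring (Kr D))) {Q \<in> Spec (sub_ring (Kr D)). ?a \<notin> Q}"
    unfolding zariski_spec_def using linear_fraction_mem_Kr(1)[of x]
    by (intro topology_generated_by_Basis) auto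
  ultimately show "openin (zariski_spec (sub_ring (Kr D))) (theta D -` U \<inter> topspace (zariski_spec (sub_ring (Kr D))))"
    by simp
qed

text \<open>An element \<open>f / g\<close> of \<open>Kr(D)\<close> is a unit of \<open>V(X)\<close> if and only if \<open>g / f \<in> V(X)\<close>, that
  is, if each of the finitely many coefficients \<open>t\<close> of \<open>g\<close> satisfies \<open>t / s \<in> V\<close> for one of
  the finitely many coefficients \<open>s\<close> of \<open>f\<close>.\<close>

lemma continuous_map_center: "continuous_map (zar_topology D) (zariski_spec (sub_ring (Kr D))) (center D)"
proof (rule continuous_map_into_generated[OF zariski_spec_def])
  show "center D ` topspace (zar_topology D) \<subseteq> topspace (zariski_spec (sub_ring (Kr D)))"
    unfolding topspace_zariski_spec_Kr topspace_zar_topology using prime_in_center by blast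
next
  fix U assume "U \<in> {{P \<in> Spec (sub_ring (Kr D)). a \<notin> P} |a. a \<in> carrier (sub_ring (Kr D))}"
  then obtain a where a: "a \<in> Kr D" and U: "U = {P \<in> Spec (sub_ring (Kr D)). a \<notin> P}" by auto
  obtain f g where fg: "g \<noteq> 0" "a = of_poly f / of_poly g" by (rule fraction_cases)
  have eq: "center D -` U \<inter> topspace (zar_topology D) = {V \<in> Zar D. a \<notin> nonunits (gauss_ext V)}"
    unfolding U topspace_zar_topology using prime_in_center a by (auto simp: mem_Spec_Kr center_def)
  have "openin (zar_topology D) {V \<in> Zar D. a \<notin> nonunits (gauss_ext V)}"
  proof (cases "f = 0")
    case True
    then have "a \<in> nonunits (gauss_ext V)" if "V \<in> Zar D" for V
      using fg unital_subringD(2)[OF unital_subring_gauss_ext[OF that]] unfolding nonunits_def by auto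
    then have empty: "{V \<in> Zar D. a \<notin> nonunits (gauss_ext V)} = {}" by blast
    show ?thesis unfolding empty by simp
  next
    case False
    have mem: "a \<notin> nonunits (gauss_ext V) \<longleftrightarrow> coeff_set g \<subseteq> val_extension V (coeff_set f)" if V: "V \<in> Zar D" for V
      using fraction_mem_gauss_ext[OF V False, of g] fg False a ZarD(2)[OF gauss_ext_mem_Zar_Kr[OF V]]
      unfolding nonunits_def by auto
    then have "{V \<in> Zar D. a \<notin> nonunits (gauss_ext V)} =
       topspace (zar_topology D) \<inter> (\<Inter>t\<in>coeff_set g. \<Union>s\<in>coeff_set f - {0}. {V \<in> Zar D. t / s \<in> V})"
      unfolding topspace_zar_topology val_extension_def by (auto simp: subset_iff) blast
    moreover have "openin (zar_topology D) (topspace (zar_topology D) \<inter> (\<Inter>t\<in>coeff_set g. \<Union>s\<in>coeff_set f - {0}. {V \<in> Zar D. t / s \<in> V}))"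
    proof (rule openin_Int_Inter)
      show "finite ((\<lambda>t. \<Union>s\<in>coeff_set f - {0}. {V \<in> Zar D. t / s \<in> V}) ` coeff_set g)" using finite_coeff_set by blast
    qed (auto intro!: openin_Union openin_zar_topology_basic)
    ultimately show ?thesis by simp
  qed
  then show "openin (zar_topology D) (center D -` U \<inter> topspace (zar_topology D))" unfolding eq .
qed

lemma homeomorphic_map_theta:
  "homeomorphic_map (zariski_spec (sub_ring (Kr D))) (zar_topology D) (theta D)"
proof (rule homeomorphic_maps_imp_map)
  show "homeomorphic_maps (zariski_spec (sub_ring (Kr D))) (zar_topology D) (theta D) (center D)"
    unfolding homeomorphic_maps_def topspace_zariski_spec_Kr topspace_zar_topology
    using continuous_map_theta continuous_map_center center_theta theta_center by blast
qed

end

section \<open>Semistar operations defined by valuation overrings\<close>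

lemma SStarD:
  assumes "s \<in> SStar R"
  shows "E \<in> Fbar R \<Longrightarrow> s E \<in> Fbar R"
    "E \<in> Fbar R \<Longrightarrow> z \<noteq> 0 \<Longrightarrow> s ((\<lambda>x. z * x) ` E) = (\<lambda>x. z * x) ` s E"
    "E \<in> Fbar R \<Longrightarrow> F \<in> Fbar R \<Longrightarrow> E \<subseteq> F \<Longrightarrow> s E \<subseteq> s F"
    "E \<in> Fbar R \<Longrightarrow> E \<subseteq> s E" "E \<in> Fbar R \<Longrightarrow> s (s E) = s E"
    "s \<in> extensional (Fbar R)"
proof -
  have *: "s \<in> Fbar R \<rightarrow> Fbar R" "s \<in> extensional (Fbar R)"
    "\<forall>z. \<forall>E\<in>Fbar R. z \<noteq> 0 \<longrightarrow> s ((\<lambda>x. z * x) ` E) = (\<lambda>x. z * x) ` s E"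
    "\<forall>E\<in>Fbar R. \<forall>F\<in>Fbar R. E \<subseteq> F \<longrightarrow> s E \<subseteq> s F"
    "\<forall>E\<in>Fbar R. E \<subseteq> s E" "\<forall>E\<in>Fbar R. s (s E) = s E"
    using assms unfolding SStar_def PiE_def by simp_all
  show "E \<in> Fbar R \<Longrightarrow> s E \<in> Fbar R" using *(1) by (rule funcset_mem)
  show "s \<in> extensional (Fbar R)" by (rule *(2))
  show "E \<in> Fbar R \<Longrightarrow> z \<noteq> 0 \<Longrightarrow> s ((\<lambda>x. z * x) ` E) = (\<lambda>x. z * x) ` s E" using *(3) by simp
  show "E \<in> Fbar R \<Longrightarrow> F \<in> Fbar R \<Longrightarrow> E \<subseteq> F \<Longrightarrow> s E \<subseteq> s F" using *(4) by simp
  show "E \<in> Fbar R \<Longrightarrow> E \<subseteq> s E" "E \<in> Fbar R \<Longrightarrow> s (s E) = s E" using *(5,6) by simp_all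
qed

lemma subring_mem_Fbar: "unital_subring R \<Longrightarrow> R \<in> Fbar R"
  using unital_subringD[of R] by (auto simp: Fbar_iff submod_def intro!: bexI[of _ 1])

lemma topspace_sstar_topology:
  assumes R: "unital_subring R"
  shows "topspace (sstar_topology R) = SStar R"
proof -
  have "1 \<in> s R" if "s \<in> SStar R" for s
    using SStarD(4)[OF that subring_mem_Fbar[OF R]] unital_subringD(1)[OF R] by blast
  then have "SStar R \<in> {{s \<in> SStar R. 1 \<in> s E} | E. E \<in> Fbar R}"
    using subring_mem_Fbar[OF R] by (intro CollectI exI[of _ R]) auto
  then show ?thesis unfolding sstar_topology_def topology_generated_by_topspace by blast
qed

lemma val_extension_scale:
  assumes "z \<noteq> 0"
  shows "val_extension V ((\<lambda>x. z * x) ` E) = (\<lambda>x. z * x) ` val_extension V E"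
proof (intro equalityI subsetI)
  fix x assume "x \<in> val_extension V ((\<lambda>x. z * x) ` E)"
  then obtain e where e: "e \<in> E" "z * e \<noteq> 0" "x / (z * e) \<in> V" unfolding val_extension_def by blast
  then have "x / z \<in> val_extension V E" unfolding val_extension_def by auto
  moreover have "x = z * (x / z)" using assms by simp
  ultimately show "x \<in> (\<lambda>x. z * x) ` val_extension V E" by blast
next
  fix x assume "x \<in> (\<lambda>x. z * x) ` val_extension V E"
  then obtain y e where "x = z * y" "e \<in> E" "e \<noteq> 0" "y / e \<in> V" unfolding val_extension_def by blast
  then show "x \<in> val_extension V ((\<lambda>x. z * x) ` E)" using assms unfolding val_extension_def by auto
qed

lemma wedge_eq:
  assumes "unital_subring R" "Y \<subseteq> Zar R" "E \<in> Fbar R"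
  shows "wedge R Y E = (\<Inter>V\<in>Y. val_extension V E)"
  unfolding wedge_def using assms module_prod_Zar[OF assms(1) _ assms(3)] by auto

text \<open>Extension to a single valuation ring is a closure operator compatible with scaling.
  Idempotence of the intersection follows since each \<open>E V\<close> is its own extension to \<open>V\<close>.\<close>

lemma wedge_mem_SStar:
  assumes R: "unital_subring R" and Y: "Y \<subseteq> Zar R"
  shows "wedge R Y \<in> SStar R"
proof -
  note w = wedge_eq[OF R Y]
  have sup: "E \<subseteq> wedge R Y E" if E: "E \<in> Fbar R" for E
  proof
    fix x assume x: "x \<in> E"
    have "x \<in> val_extension V E" if V: "V \<in> Y" for V
    proof (cases "x = 0")
      case True
      then show ?thesis using E V Y submodD(1)[OF submod_val_extension[of V R E]] by (auto simp: Fbar_iff[OF R])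
    next
      case False
      then show ?thesis using val_extension_superset x V Y by blast
    qed
    then show "x \<in> wedge R Y E" by (simp add: w[OF E])
  qed
  have F: "wedge R Y E \<in> Fbar R" if E: "E \<in> Fbar R" for E
  proof -
    have "submod R (\<Inter>V\<in>Y. val_extension V E)"
    proof (rule submod_Int)
      fix V assume "V \<in> Y"
      then have V: "V \<in> Zar R" using Y by blast
      show "submod R (val_extension V E)"
        using submod_subring_mono[OF submod_val_extension[OF V] ZarD(2)[OF V]] E by (auto simp: Fbar_iff[OF R])
    qed
    then show ?thesis using sup[OF E] E w[OF E] by (auto simp: Fbar_iff[OF R])
  qed
  have mono: "wedge R Y E \<subseteq> wedge R Y E'" if "E \<in> Fbar R" "E' \<in> Fbar R" "E \<subseteq> E'" for E E'
    using val_extension_mono[OF that(3)] by (auto simp: w[OF that(1)] w[OF that(2)])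
  have idem: "wedge R Y (wedge R Y E) \<subseteq> wedge R Y E" if E: "E \<in> Fbar R" for E
  proof -
    have "val_extension V (wedge R Y E) \<subseteq> val_extension V E" if "V \<in> Y" for V
      using that Y by (intro val_extension_subset_val_extension[of V R]) (auto simp: w[OF E])
    then show ?thesis unfolding w[OF F[OF E]] by (auto simp: w[OF E])
  qed
  have sc: "wedge R Y ((\<lambda>x. z * x) ` E) = (\<lambda>x. z * x) ` wedge R Y E" if E: "E \<in> Fbar R" and z: "z \<noteq> 0" for E z
  proof -
    have "(\<Inter>V\<in>Y. (\<lambda>x. z * x) ` val_extension V E) = (\<lambda>x. z * x) ` (\<Inter>V\<in>Y. val_extension V E)"
    proof (intro equalityI subsetI)
      fix x assume x: "x \<in> (\<Inter>V\<in>Y. (\<lambda>x. z * x) ` val_extension V E)"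
      have "x / z \<in> val_extension V E" if "V \<in> Y" for V
        using x that z by auto
      then have "x / z \<in> (\<Inter>V\<in>Y. val_extension V E)" by blast
      moreover have "x = z * (x / z)" using z by simp
      ultimately show "x \<in> (\<lambda>x. z * x) ` (\<Inter>V\<in>Y. val_extension V E)" by blast
    qed auto
    then show ?thesis unfolding w[OF E] w[OF Fbar_scale[OF R E z]] val_extension_scale[OF z] .
  qed
  have ex: "wedge R Y \<in> extensional (Fbar R)" unfolding wedge_def by simp
  show ?thesis
    unfolding SStar_def
  proof (intro CollectI conjI ballI allI impI)
    show "wedge R Y \<in> Fbar R \<rightarrow>\<^sub>E Fbar R" using F ex by (simp add: PiE_def)
    fix E assume E: "E \<in> Fbar R"
    show "E \<subseteq> wedge R Y E" by (rule sup[OF E])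
    show "wedge R Y (wedge R Y E) = wedge R Y E" using idem[OF E] sup[OF F[OF E]] by blast
  qed (simp_all add: sc mono)
qed

context quotient_field_domain
begin

lemma wedge_D_eq: "Y \<subseteq> Zar D \<Longrightarrow> E \<in> Fbar D \<Longrightarrow> wedge D Y E = (\<Inter>V\<in>Y. val_extension V E)"
  by (rule wedge_eq[OF D_subring])

lemma gauss_image_subset: "Y \<subseteq> Zar D \<Longrightarrow> gauss_ext ` Y \<subseteq> Zar (Kr D)"
  using gauss_ext_mem_Zar_Kr by blast

lemma wedge_Kr_eq:
  "Y \<subseteq> Zar D \<Longrightarrow> F \<in> Fbar (Kr D) \<Longrightarrow> wedge (Kr D) (gauss_ext ` Y) F = (\<Inter>V\<in>Y. val_extension (gauss_ext V) F)"
  using wedge_eq[OF Kr_subring gauss_image_subset] by simp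

text \<open>The localizations of \<open>Kr(D)\<close> at primes are the Gaussian extensions of the valuation
  rings that correspond to the primes.\<close>

lemma spectral_op_eq_wedge:
  assumes "Y \<subseteq> Spec (sub_ring (Kr D))"
  shows "spectral_op (Kr D) Y = wedge (Kr D) (gauss_ext ` theta D ` Y)"
  unfolding spectral_op_def wedge_def using assms by (auto simp: localize_Kr_eq mem_Spec_Kr subset_iff)

lemma theta_image_subset: "Y \<subseteq> Spec (sub_ring (Kr D)) \<Longrightarrow> theta D ` Y \<subseteq> Zar D"
  using theta_mem_Zar mem_Spec_Kr by blast

lemma ex_theta_image:
  assumes "Y \<subseteq> Zar D"
  shows "\<exists>Y' \<subseteq> Spec (sub_ring (Kr D)). theta D ` Y' = Y"
  using assms theta_center prime_in_center
  by (intro exI[of _ "center D ` Y"]) (auto simp: mem_Spec_Kr image_iff subset_iff)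

lemma SStar_sp_eq: "SStar_sp (Kr D) = (\<lambda>Y. wedge (Kr D) (gauss_ext ` Y)) ` Pow (Zar D)"
proof (intro equalityI subsetI)
  fix s assume "s \<in> SStar_sp (Kr D)"
  then obtain Y where Y: "Y \<subseteq> Spec (sub_ring (Kr D))" "s = spectral_op (Kr D) Y" unfolding SStar_sp_def by blast
  then show "s \<in> (\<lambda>Y. wedge (Kr D) (gauss_ext ` Y)) ` Pow (Zar D)"
    using spectral_op_eq_wedge[OF Y(1)] theta_image_subset[OF Y(1)] by blast
next
  fix s assume "s \<in> (\<lambda>Y. wedge (Kr D) (gauss_ext ` Y)) ` Pow (Zar D)"
  then obtain Y where Y: "Y \<subseteq> Zar D" "s = wedge (Kr D) (gauss_ext ` Y)" by blast
  obtain Y' where Y': "Y' \<subseteq> Spec (sub_ring (Kr D))" "theta D ` Y' = Y" using ex_theta_image[OF Y(1)] by blast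
  then show "s \<in> SStar_sp (Kr D)"
    unfolding SStar_sp_def using spectral_op_eq_wedge[OF Y'(1)] Y(2) by (intro CollectI exI[of _ Y']) simp
qed

lemma SStar_sp_subset: "SStar_sp (Kr D) \<subseteq> SStar (Kr D)"
  unfolding SStar_sp_eq using wedge_mem_SStar[OF Kr_subring gauss_image_subset] by blast

lemma SStar_val_subset: "SStar_val D \<subseteq> SStar D"
  unfolding SStar_val_def using wedge_mem_SStar[OF D_subring] by blast

definition extend :: "'k set \<Rightarrow> 'k poly fract set" where
  "extend E = module_span (Kr D) (const_rat ` E)"

text \<open>Nothing here refers to a set of primes defining \<open>s\<close>: \<open>\<Theta>(s\<^sub>Y)\<close> depends on the operation
  only, and the value at \<open>E\<close> is a condition on the value of \<open>s\<close> at one module.\<close>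

definition Theta :: "('k poly fract set \<Rightarrow> 'k poly fract set) \<Rightarrow> 'k set \<Rightarrow> 'k set" where
  "Theta s = (\<lambda>E\<in>Fbar D. {x. const_rat x \<in> s (extend E)})"

lemma extend_mem_Fbar:
  assumes "\<exists>e\<in>E. e \<noteq> 0"
  shows "extend E \<in> Fbar (Kr D)"
proof -
  obtain e where "e \<in> E" "e \<noteq> 0" using assms by blast
  then show ?thesis unfolding extend_def by (intro module_span_Fbar[OF Kr_subring, of "const_rat e"]) auto
qed

text \<open>A constant lies in \<open>V(X)\<close> exactly if it lies in \<open>V\<close>, and \<open>V(X)\<close> contains \<open>Kr(D)\<close>.\<close>

lemma const_mem_val_extension_extend:
  assumes V: "V \<in> Zar D" and E: "\<exists>e\<in>E. e \<noteq> 0"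
  shows "const_rat x \<in> val_extension (gauss_ext V) (extend E) \<longleftrightarrow> x \<in> val_extension V E"
proof -
  have "val_extension (gauss_ext V) (extend E) = val_extension (gauss_ext V) (const_rat ` E)"
    unfolding extend_def using E
    by (intro val_extension_module_span[OF Kr_subring gauss_ext_mem_Zar_Kr[OF V]]) auto
  also have "const_rat x \<in> \<dots> \<longleftrightarrow> x \<in> val_extension V E"
    unfolding val_extension_def using const_mem_gauss_ext[OF V] by (auto simp flip: const_rat_divide)
  finally show ?thesis .
qed

lemma Theta_wedge:
  assumes Y: "Y \<subseteq> Zar D"
  shows "Theta (wedge (Kr D) (gauss_ext ` Y)) = wedge D Y"
proof
  fix E
  show "Theta (wedge (Kr D) (gauss_ext ` Y)) E = wedge D Y E"
  proof (cases "E \<in> Fbar D")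
    case True
    then have nz: "\<exists>e\<in>E. e \<noteq> 0" by (simp add: Fbar_iff[OF D_subring])
    have "const_rat x \<in> wedge (Kr D) (gauss_ext ` Y) (extend E) \<longleftrightarrow> x \<in> wedge D Y E" for x
      unfolding wedge_Kr_eq[OF Y extend_mem_Fbar[OF nz]] wedge_D_eq[OF Y True]
      using const_mem_val_extension_extend[OF _ nz] Y by blast
    then show ?thesis unfolding Theta_def using True by auto
  qed (simp add: Theta_def wedge_def)
qed

text \<open>Let \<open>x\<close> be outside \<open>F V'(X)\<close>. For each nonzero \<open>e\<close> in \<open>F\<close> write \<open>x / e = p\<^sub>e / q\<^sub>e\<close>. As
  the fraction is not in \<open>V'(X)\<close>, some coefficient \<open>c\<^sub>e\<close> of \<open>p\<^sub>e\<close> is not in the \<open>V'\<close>-module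
  generated by the coefficients of \<open>q\<^sub>e\<close>. Choose such a witness for every \<open>e\<close> and let \<open>E\<close> be
  the \<open>D\<close>-module generated by all quotients \<open>t / c\<^sub>e\<close> with \<open>t\<close> a coefficient of \<open>q\<^sub>e\<close>. Then 1
  is not in \<open>E V'\<close>. If however \<open>V\<close> is such that \<open>x \<in> F V(X)\<close>, then \<open>x / e \<in> V(X)\<close> for some
  \<open>e\<close>, hence \<open>c\<^sub>e\<close> is in the \<open>V\<close>-module generated by the coefficients of \<open>q\<^sub>e\<close>, and 1 is in
  \<open>E V\<close>. So a difference of the two operations at \<open>F\<close> produces one at \<open>E\<close>.\<close>

lemma wedge_Kr_subset_if_wedge_D_eq:
  assumes Y: "Y \<subseteq> Zar D" "Y' \<subseteq> Zar D" and eq: "wedge D Y = wedge D Y'" and F: "F \<in> Fbar (Kr D)"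
  shows "wedge (Kr D) (gauss_ext ` Y) F \<subseteq> wedge (Kr D) (gauss_ext ` Y') F"
proof
  fix x assume "x \<in> wedge (Kr D) (gauss_ext ` Y) F"
  then have x: "x \<in> val_extension (gauss_ext V) F" if "V \<in> Y" for V
    using that unfolding wedge_Kr_eq[OF Y(1) F] by blast
  show "x \<in> wedge (Kr D) (gauss_ext ` Y') F"
  proof (rule ccontr)
    assume "x \<notin> wedge (Kr D) (gauss_ext ` Y') F"
    then obtain V' where V': "V' \<in> Y'" "x \<notin> val_extension (gauss_ext V') F"
      unfolding wedge_Kr_eq[OF Y(2) F] by blast
    then have Z: "V' \<in> Zar D" using Y(2) by blast
    have "\<exists>p q. q \<noteq> 0 \<and> x / e = of_poly p / of_poly q" for e
      by (rule fraction_cases[of "x / e"]) blast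
    then obtain p q where pq: "\<And>e. q e \<noteq> 0" "\<And>e. x / e = of_poly (p e) / of_poly (q e)" by metis
    have "\<exists>c. c \<in> coeff_set (p e) \<and> c \<notin> val_extension V' (coeff_set (q e))" if "e \<in> F - {0}" for e
    proof -
      have "x / e \<notin> gauss_ext V'" using V'(2) that unfolding val_extension_def by blast
      then show ?thesis using fraction_mem_gauss_ext[OF Z pq(1), of "p e" e] pq(2)[of e] by auto
    qed
    then obtain c where c: "\<And>e. e \<in> F - {0} \<Longrightarrow> c e \<in> coeff_set (p e) \<and> c e \<notin> val_extension V' (coeff_set (q e))" by metis
    have c0: "c e \<noteq> 0" if "e \<in> F - {0}" for e
      using c[OF that] submodD(1)[OF submod_val_extension[OF Z ex_nonzero_coeff_set[OF pq(1)[of e]]]] by auto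
    define T where "T = (\<Union>e\<in>F - {0}. (\<lambda>t. t / c e) ` coeff_set (q e))"
    obtain e where e: "e \<in> F - {0}" using F by (auto simp: Fbar_iff[OF Kr_subring])
    obtain t where "t \<in> coeff_set (q e)" "t \<noteq> 0" using ex_nonzero_coeff_set[OF pq(1)[of e]] by blast
    then have Tnz: "t / c e \<in> T" "t / c e \<noteq> 0" using e c0[OF e] unfolding T_def by auto
    then have E: "module_span D T \<in> Fbar D" by (rule module_span_Fbar[OF D_subring])
    have gen: "val_extension V (module_span D T) = val_extension V T" if "V \<in> Zar D" for V
      using val_extension_module_span[OF D_subring that] Tnz by blast
    have "1 \<in> val_extension V T" if V: "V \<in> Y" for V
    proof -
      have VZ: "V \<in> Zar D" using V Y(1) by blast
      obtain e where e: "e \<in> F - {0}" "x / e \<in> gauss_ext V" using x[OF V] unfolding val_extension_def by blast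
      then have "coeff_set (p e) \<subseteq> val_extension V (coeff_set (q e))" using fraction_mem_gauss_ext[OF VZ pq(1), of "p e" e] pq(2)[of e] by simp
      then have "c e \<in> val_extension V (coeff_set (q e))" using c[OF e(1)] by blast
      then obtain t where t: "t \<in> coeff_set (q e)" "t \<noteq> 0" "c e / t \<in> V" unfolding val_extension_def by blast
      then have "t / c e \<in> T" "t / c e \<noteq> 0" "1 / (t / c e) \<in> V" using e(1) c0[OF e(1)] unfolding T_def by auto
      then show ?thesis unfolding val_extension_def by blast
    qed
    then have "1 \<in> wedge D Y (module_span D T)" unfolding wedge_D_eq[OF Y(1) E] using gen Y(1) by blast
    then have "1 \<in> val_extension V' T" unfolding eq wedge_D_eq[OF Y(2) E] using gen[OF Z] V'(1) by blast
    then obtain e t where et: "e \<in> F - {0}" "t \<in> coeff_set (q e)" "t / c e \<noteq> 0" "1 / (t / c e) \<in> V'"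
      unfolding val_extension_def T_def by blast
    then have "c e \<in> val_extension V' (coeff_set (q e))" unfolding val_extension_def by (intro CollectI bexI[of _ t]) auto
    then show False using c[OF et(1)] by blast
  qed
qed

lemma wedge_Kr_eq_if_wedge_D_eq:
  assumes Y: "Y \<subseteq> Zar D" "Y' \<subseteq> Zar D" and eq: "wedge D Y = wedge D Y'"
  shows "wedge (Kr D) (gauss_ext ` Y) = wedge (Kr D) (gauss_ext ` Y')"
proof
  fix F
  show "wedge (Kr D) (gauss_ext ` Y) F = wedge (Kr D) (gauss_ext ` Y') F"
  proof (cases "F \<in> Fbar (Kr D)")
    case True
    then show ?thesis
      using wedge_Kr_subset_if_wedge_D_eq[OF Y eq] wedge_Kr_subset_if_wedge_D_eq[OF Y(2,1) eq[symmetric]] by blast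
  qed (simp add: wedge_def)
qed

lemma Theta_spectral_op:
  assumes Y: "Y \<subseteq> Spec (sub_ring (Kr D))"
  shows "Theta (spectral_op (Kr D) Y) = wedge D (Zset D Y)"
  by (simp add: spectral_op_eq_wedge[OF Y] Theta_wedge[OF theta_image_subset[OF Y]] Zset_eq[OF Y])

lemma bij_betw_Theta: "bij_betw Theta (SStar_sp (Kr D)) (SStar_val D)"
proof (rule bij_betw_imageI)
  show "inj_on Theta (SStar_sp (Kr D))"
  proof (rule inj_onI)
    fix s s' assume s: "s \<in> SStar_sp (Kr D)" "s' \<in> SStar_sp (Kr D)" and eq: "Theta s = Theta s'"
    obtain Y Y' where Y: "Y \<subseteq> Zar D" "s = wedge (Kr D) (gauss_ext ` Y)"
      "Y' \<subseteq> Zar D" "s' = wedge (Kr D) (gauss_ext ` Y')"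
      using s unfolding SStar_sp_eq by blast
    then have "wedge D Y = wedge D Y'" using eq Theta_wedge by simp
    then show "s = s'" using wedge_Kr_eq_if_wedge_D_eq[OF Y(1,3)] Y(2,4) by simp
  qed
  show "Theta ` SStar_sp (Kr D) = SStar_val D"
    unfolding SStar_sp_eq SStar_val_def using Theta_wedge by (auto simp: image_iff)
qed

text \<open>The preimage of the subbasic set given by \<open>E\<close> is the subbasic set given by the extension
  of \<open>E\<close>.\<close>

lemma continuous_map_Theta:
  assumes "A \<subseteq> SStar (Kr D)" "Theta ` A \<subseteq> B" "B \<subseteq> SStar D"
  shows "continuous_map (subtopology (sstar_topology (Kr D)) A) (subtopology (sstar_topology D) B) Theta"
proof -
  have top: "topspace (subtopology (sstar_topology (Kr D)) A) = A"
    using assms(1) by (auto simp: topspace_sstar_topology[OF Kr_subring])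
  have "continuous_map (subtopology (sstar_topology (Kr D)) A) (sstar_topology D) Theta"
  proof (rule continuous_map_into_generated[OF sstar_topology_def])
    show "Theta ` topspace (subtopology (sstar_topology (Kr D)) A) \<subseteq> topspace (sstar_topology D)"
      unfolding top using assms by (auto simp: topspace_sstar_topology[OF D_subring])
  next
    fix U assume "U \<in> {{s \<in> SStar D. 1 \<in> s E} |E. E \<in> Fbar D}"
    then obtain E where E: "E \<in> Fbar D" "U = {s \<in> SStar D. 1 \<in> s E}" by blast
    have nz: "\<exists>e\<in>E. e \<noteq> 0" using E(1) by (simp add: Fbar_iff[OF D_subring])
    have "Theta -` U \<inter> A = {s \<in> SStar (Kr D). 1 \<in> s (extend E)} \<inter> A"
      using assms E unfolding Theta_def by auto
    moreover have "openin (sstar_topology (Kr D)) {s \<in> SStar (Kr D). 1 \<in> s (extend E)}"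
      unfolding sstar_topology_def using extend_mem_Fbar[OF nz] by (intro topology_generated_by_Basis) blast
    ultimately show "openin (subtopology (sstar_topology (Kr D)) A)
        (Theta -` U \<inter> topspace (subtopology (sstar_topology (Kr D)) A))"
      unfolding top openin_subtopology by blast
  qed
  then show ?thesis using assms(2) top by (simp add: continuous_map_in_subtopology image_subset_iff_funcset)
qed

end

section \<open>Maximal ideals\<close>

text \<open>Zorn's lemma for the ideals that avoid 1; maximal ideals are prime.\<close>

lemma ex_prime_in_superset:
  assumes B: "unital_subring B" and I: "submod B I" "I \<subseteq> B" "1 \<notin> I"
  shows "\<exists>N. prime_in B N \<and> I \<subseteq> N"
proof -
  note u = unital_subringD[OF B]
  define C where "C = {J. submod B J \<and> J \<subseteq> B \<and> I \<subseteq> J \<and> 1 \<notin> J}"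
  have "\<exists>M\<in>C. \<forall>J\<in>C. M \<subseteq> J \<longrightarrow> J = M"
  proof (rule subset_Zorn_nonempty)
    show "C \<noteq> {}" using I unfolding C_def by blast
    fix \<C> assume ch: "\<C> \<noteq> {}" "subset.chain C \<C>"
    then have mem: "J \<in> C" if "J \<in> \<C>" for J using that unfolding subset.chain_def by blast
    obtain J0 where J0: "J0 \<in> \<C>" using ch(1) by blast
    have "submod B (\<Union>\<C>)"
      unfolding submod_def
    proof (intro conjI ballI)
      show "0 \<in> \<Union>\<C>" using J0 mem[OF J0] submodD(1) unfolding C_def by blast
    next
      fix x y assume "x \<in> \<Union>\<C>" "y \<in> \<Union>\<C>"
      then obtain J J' where J: "J \<in> \<C>" "x \<in> J" "J' \<in> \<C>" "y \<in> J'" by blast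
      then have "J \<subseteq> J' \<or> J' \<subseteq> J" using ch(2) unfolding subset.chain_def subset_chain_def by blast
      then have "\<exists>J''\<in>\<C>. x \<in> J'' \<and> y \<in> J''" using J by blast
      then obtain J'' where J'': "J'' \<in> \<C>" "x \<in> J''" "y \<in> J''" by blast
      then have "x + y \<in> J''" using mem[OF J''(1)] submodD(2) unfolding C_def by blast
      then show "x + y \<in> \<Union>\<C>" using J'' by blast
    next
      fix a x assume "a \<in> B" "x \<in> \<Union>\<C>"
      then obtain J where J: "J \<in> \<C>" "x \<in> J" by blast
      then have "a * x \<in> J" using mem[OF J(1)] submodD(3)[of B J a x] \<open>a \<in> B\<close> unfolding C_def by blast
      then show "a * x \<in> \<Union>\<C>" using J by blast
    qed
    then show "\<Union>\<C> \<in> C" using mem J0 unfolding C_def by blast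
  qed
  then obtain M where M: "M \<in> C" "\<And>J. J \<in> C \<Longrightarrow> M \<subseteq> J \<Longrightarrow> J = M" by blast
  have m: "submod B M" "M \<subseteq> B" "I \<subseteq> M" "1 \<notin> M" using M(1) unfolding C_def by auto
  have reach: "\<exists>m\<in>M. \<exists>b\<in>B. 1 = m + b * x" if x: "x \<in> B" "x \<notin> M" for x
  proof -
    define J where "J = {m + b * x | m b. m \<in> M \<and> b \<in> B}"
    have J: "m + b * x \<in> J" if "m \<in> M" "b \<in> B" for m b using that unfolding J_def by blast
    have JE: "\<exists>m\<in>M. \<exists>b\<in>B. z = m + b * x" if "z \<in> J" for z using that unfolding J_def by blast
    have "submod B J"
      unfolding submod_def
    proof (intro conjI ballI)
      show "0 \<in> J" using J[OF submodD(1)[OF m(1)] u(2)] by simp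
    next
      fix y z assume "y \<in> J" "z \<in> J"
      then obtain m1 b1 m2 b2 where "m1 \<in> M" "b1 \<in> B" "y = m1 + b1 * x" "m2 \<in> M" "b2 \<in> B" "z = m2 + b2 * x"
        using JE by metis
      then have "y + z = (m1 + m2) + (b1 + b2) * x" "m1 + m2 \<in> M" "b1 + b2 \<in> B"
        using submodD(2)[OF m(1)] u(5) by (auto simp: algebra_simps)
      then show "y + z \<in> J" using J by metis
    next
      fix a z assume "a \<in> B" "z \<in> J"
      then obtain m1 b1 where "m1 \<in> M" "b1 \<in> B" "z = m1 + b1 * x" using JE by metis
      then have "a * z = a * m1 + (a * b1) * x" "a * m1 \<in> M" "a * b1 \<in> B"
        using submodD(3)[OF m(1)] u(6) \<open>a \<in> B\<close> by (auto simp: algebra_simps)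
      then show "a * z \<in> J" using J by metis
    qed
    moreover have "J \<subseteq> B" using m(2) u(5,6) x(1) unfolding J_def by blast
    moreover have MJ: "M \<subseteq> J" using J[OF _ u(2)] by auto
    moreover have "x \<in> J" using J[OF submodD(1)[OF m(1)] u(1)] by simp
    ultimately have "1 \<in> J" using M(2)[of J] x(2) m(3) unfolding C_def by blast
    then show ?thesis using JE by blast
  qed
  have "x \<in> M \<or> y \<in> M" if xy: "x \<in> B" "y \<in> B" "x * y \<in> M" for x y
  proof (rule ccontr)
    assume "\<not> ?thesis"
    then obtain m1 b1 m2 b2 where e: "m1 \<in> M" "b1 \<in> B" "1 = m1 + b1 * x" "m2 \<in> M" "b2 \<in> B" "1 = m2 + b2 * y"
      using reach[OF xy(1)] reach[OF xy(2)] by blast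
    have "1 = (m1 + b1 * x) * (m2 + b2 * y)" using e(3,6) by simp
    also have "\<dots> = (m2 + b2 * y) * m1 + (b1 * x) * m2 + (b1 * b2) * (x * y)" by (simp add: algebra_simps)
    also have "\<dots> \<in> M"
      using e xy u(1,5,6) submodD(2,3)[OF m(1)] m(2) by (metis (no_types, lifting))
    finally show False using m(4) by blast
  qed
  then show ?thesis using m unfolding prime_in_def by blast
qed

section \<open>The closure operator of a semistar operation\<close>

text \<open>A semistar operation, seen as a closure operator on subsets of the field through the
  modules that they generate. Products of sets are much easier to handle than products of
  modules, and the two agree up to generated modules.\<close>

definition star_closure :: "'l::field set \<Rightarrow> ('l set \<Rightarrow> 'l set) \<Rightarrow> 'l set \<Rightarrow> 'l set" where
  "star_closure R s S = s (module_span R S)"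

text \<open>Semistar operations are defined on nonzero modules only, so this condition accompanies
  every set of generators.\<close>

definition has_nonzero :: "'l::field set \<Rightarrow> bool" where
  "has_nonzero S \<longleftrightarrow> (\<exists>s\<in>S. s \<noteq> 0)"

lemma has_nonzero_times: "has_nonzero S \<Longrightarrow> has_nonzero T \<Longrightarrow> has_nonzero (S * T)"
  unfolding has_nonzero_def set_times_def by force

lemma has_nonzero_mono: "has_nonzero S \<Longrightarrow> S \<subseteq> T \<Longrightarrow> has_nonzero T"
  unfolding has_nonzero_def by blast

lemma has_nonzero_coeff_set: "f \<noteq> 0 \<Longrightarrow> has_nonzero (coeff_set f)"
  unfolding has_nonzero_def by (rule ex_nonzero_coeff_set)

lemma has_nonzero_span: "unital_subring R \<Longrightarrow> has_nonzero S \<Longrightarrow> module_span R S \<in> Fbar R"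
  unfolding has_nonzero_def using module_span_Fbar by blast

lemma finite_set_times_fields: "finite S \<Longrightarrow> finite T \<Longrightarrow> finite (S * T :: 'l::field set)"
  by (rule finite_set_times)

text \<open>Multiplication is bilinear, so products of generators generate the product module.\<close>

lemma module_prod_span:
  assumes R: "unital_subring R"
  shows "module_prod R (module_span R S) (module_span R T) = module_span R (S * T)"
proof
  let ?M = "module_span R (S * T)"
  have M: "submod R ?M" by (rule submod_module_span[OF R])
  have 1: "x * t \<in> ?M" if "x \<in> module_span R S" "t \<in> T" for x t
  proof -
    have "module_span R S \<subseteq> {x. x * t \<in> ?M}"
    proof (rule module_span_least[OF R])
      show "submod R {x. x * t \<in> ?M}"
        using submodD[OF M] unfolding submod_def by (auto simp: distrib_right mult.assoc)
      show "S \<subseteq> {x. x * t \<in> ?M}"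
        using subsetD[OF module_span_superset[OF R] set_times_intro[OF _ that(2)]] by blast
    qed
    then show ?thesis using that(1) by blast
  qed
  have 2: "x * y \<in> ?M" if "x \<in> module_span R S" "y \<in> module_span R T" for x y
  proof -
    have "module_span R T \<subseteq> {y. x * y \<in> ?M}"
    proof (rule module_span_least[OF R])
      show "submod R {y. x * y \<in> ?M}"
        using submodD[OF M] unfolding submod_def by (auto simp: distrib_left mult.left_commute)
      show "T \<subseteq> {y. x * y \<in> ?M}" using 1[OF that(1)] by blast
    qed
    then show ?thesis using that(2) by blast
  qed
  show "module_prod R (module_span R S) (module_span R T) \<subseteq> ?M"
    unfolding module_prod_def by (rule module_span_least[OF R M]) (use 2 in blast)
  show "?M \<subseteq> module_prod R (module_span R S) (module_span R T)"
    unfolding module_prod_def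
  proof (rule module_span_mono[OF R], rule subsetI)
    fix x assume "x \<in> S * T"
    then obtain a t where "x = a * t" "a \<in> S" "t \<in> T" by (rule set_times_elim)
    then show "x \<in> {e * f |e f. e \<in> module_span R S \<and> f \<in> module_span R T}"
      using module_span_superset[OF R] by blast
  qed
qed

locale semistar =
  fixes R :: "'l::field set" and s :: "'l set \<Rightarrow> 'l set"
  assumes R: "unital_subring R" and s: "s \<in> SStar R"
begin

lemma star_closure_Fbar: "has_nonzero S \<Longrightarrow> star_closure R s S \<in> Fbar R"
  unfolding star_closure_def by (rule SStarD(1)[OF s has_nonzero_span[OF R]])

lemma submod_star_closure: "has_nonzero S \<Longrightarrow> submod R (star_closure R s S)"
  using star_closure_Fbar Fbar_iff[OF R] by blast

lemma span_subset_star_closure: "has_nonzero S \<Longrightarrow> module_span R S \<subseteq> star_closure R s S"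
  unfolding star_closure_def by (rule SStarD(4)[OF s has_nonzero_span[OF R]])

lemma star_closure_superset: "has_nonzero S \<Longrightarrow> S \<subseteq> star_closure R s S"
  using span_subset_star_closure module_span_superset[OF R] by blast

lemma star_closure_least:
  assumes "has_nonzero S" "has_nonzero T" "T \<subseteq> star_closure R s S"
  shows "star_closure R s T \<subseteq> star_closure R s S"
proof -
  have "module_span R T \<subseteq> star_closure R s S" by (rule module_span_least[OF R submod_star_closure[OF assms(1)] assms(3)])
  then have "s (module_span R T) \<subseteq> s (star_closure R s S)"
    by (intro SStarD(3)[OF s] has_nonzero_span[OF R] star_closure_Fbar assms)
  also have "s (star_closure R s S) = star_closure R s S" unfolding star_closure_def by (rule SStarD(5)[OF s has_nonzero_span[OF R assms(1)]])
  finally show ?thesis by (simp add: star_closure_def)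
qed

lemma star_closure_mono: "has_nonzero S \<Longrightarrow> S \<subseteq> T \<Longrightarrow> star_closure R s S \<subseteq> star_closure R s T"
  using star_closure_least[of T S] star_closure_superset[of T] has_nonzero_mono by blast

lemma star_closure_scale: "has_nonzero S \<Longrightarrow> z \<noteq> 0 \<Longrightarrow> star_closure R s ((\<lambda>x. z * x) ` S) = (\<lambda>x. z * x) ` star_closure R s S"
  unfolding star_closure_def module_span_scale[OF R] by (rule SStarD(2)[OF s has_nonzero_span[OF R]])

lemma zero_in_star_closure: "has_nonzero S \<Longrightarrow> 0 \<in> star_closure R s S"
  using submodD(1)[OF submod_star_closure] .

lemma insert_0_subset_star_closure: "has_nonzero S \<Longrightarrow> insert 0 S \<subseteq> star_closure R s S"
  using zero_in_star_closure star_closure_superset by blast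

text \<open>For fixed nonzero \<open>t\<close>, multiplication by \<open>t\<close> commutes with the closure; the union over
  \<open>t \<in> T\<close> gives the claim.\<close>

lemma star_closure_times:
  assumes "has_nonzero S" "has_nonzero T" "A \<subseteq> star_closure R s S"
  shows "A * T \<subseteq> star_closure R s (S * T)"
proof
  fix x assume "x \<in> A * T"
  then obtain a t where x: "x = a * t" "a \<in> A" "t \<in> T" by (rule set_times_elim)
  show "x \<in> star_closure R s (S * T)"
  proof (cases "t = 0")
    case True
    then show ?thesis using x zero_in_star_closure[OF has_nonzero_times[OF assms(1,2)]] by simp
  next
    case False
    have nzt: "has_nonzero ((\<lambda>x. t * x) ` S)" using assms(1) False unfolding has_nonzero_def by auto
    have "x \<in> (\<lambda>x. t * x) ` star_closure R s S" using x assms(3) by (auto simp: mult.commute)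
    then have "x \<in> star_closure R s ((\<lambda>x. t * x) ` S)" using star_closure_scale[OF assms(1) False] by simp
    also have "\<dots> \<subseteq> star_closure R s (S * T)"
      by (rule star_closure_mono[OF nzt]) (use x(3) in \<open>auto simp: mult.commute[of t] intro: set_times_intro\<close>)
    finally show ?thesis .
  qed
qed

lemma star_closure_times2:
  assumes "has_nonzero S" "has_nonzero T" "A \<subseteq> star_closure R s S" "B \<subseteq> star_closure R s T"
  shows "A * B \<subseteq> star_closure R s (S * T)"
proof (cases "has_nonzero A")
  case True
  have "A * B = B * A" by (rule mult.commute)
  also have "\<dots> \<subseteq> star_closure R s (T * A)" by (rule star_closure_times[OF assms(2) True assms(4)])
  also have "\<dots> \<subseteq> star_closure R s (S * T)"
    using star_closure_times[OF assms(1,2,3)]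
    by (intro star_closure_least has_nonzero_times assms True) (simp add: mult.commute)
  finally show ?thesis .
next
  case False
  then have "A * B \<subseteq> {0}" unfolding has_nonzero_def set_times_def by auto
  then show ?thesis using zero_in_star_closure[OF has_nonzero_times[OF assms(1,2)]] by blast
qed

lemma coeff_set_add_subset: "has_nonzero S \<Longrightarrow> coeff_set f \<subseteq> star_closure R s S \<Longrightarrow> coeff_set g \<subseteq> star_closure R s S \<Longrightarrow> coeff_set (f + g) \<subseteq> star_closure R s S"
  using submodD(2)[OF submod_star_closure] by (auto simp: coeff_set_subset_iff)

lemma coeff_set_minus_subset:
  assumes "has_nonzero S" "coeff_set f \<subseteq> star_closure R s S"
  shows "coeff_set (- f) \<subseteq> star_closure R s S"
proof -
  have "(- 1) * x \<in> star_closure R s S" if "x \<in> star_closure R s S" for x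
    using submodD(3)[OF submod_star_closure[OF assms(1)] unital_subringD(3)[OF R unital_subringD(1)[OF R]] that] .
  then show ?thesis using assms(2) by (auto simp: coeff_set_subset_iff)
qed

lemma coeff_set_mult_subset:
  assumes "has_nonzero (coeff_set f * coeff_set g)"
  shows "coeff_set (f * g) \<subseteq> star_closure R s (coeff_set f * coeff_set g)"
  unfolding coeff_set_subset_iff coeff_mult
  using star_closure_superset[OF assms] by (intro allI submod_sum[OF submod_star_closure[OF assms]]) (auto intro: set_times_intro)

lemma coeff_set_mult_subset':
  assumes "has_nonzero S" "has_nonzero T" "coeff_set f \<subseteq> star_closure R s S" "coeff_set g \<subseteq> star_closure R s T"
  shows "coeff_set (f * g) \<subseteq> star_closure R s (S * T)"
proof -
  have "coeff_set f * coeff_set g \<subseteq> star_closure R s (S * T)" by (rule star_closure_times2[OF assms])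
  then show ?thesis
    unfolding coeff_set_subset_iff coeff_mult
    by (intro allI submod_sum[OF submod_star_closure[OF has_nonzero_times[OF assms(1,2)]]]) (auto intro: set_times_intro)
qed

end

locale eab_semistar = semistar +
  assumes quot: "\<And>x. \<exists>a\<in>R. \<exists>b\<in>R. b \<noteq> 0 \<and> x = a / b" and eab: "eab R s"
begin

text \<open>The eab property in terms of generators.\<close>

lemma star_closure_cancel:
  assumes "finite S" "has_nonzero S" "finite T" "has_nonzero T" "finite U" "has_nonzero U" "S * T \<subseteq> star_closure R s (S * U)"
  shows "T \<subseteq> star_closure R s U"
proof -
  have fg: "module_span R A \<in> fg_fractional R" if "finite A" "has_nonzero A" for A
    using fg_fractional_iff[OF R quot] that unfolding has_nonzero_def by blast
  have "star_closure R s (S * T) \<subseteq> star_closure R s (S * U)" by (intro star_closure_least has_nonzero_times assms)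
  then have "s (module_prod R (module_span R S) (module_span R T)) \<subseteq> s (module_prod R (module_span R S) (module_span R U))"
    unfolding module_prod_span[OF R] star_closure_def .
  then have "s (module_span R T) \<subseteq> s (module_span R U)"
    using eab fg assms unfolding eab_def by blast
  then show ?thesis using star_closure_superset[OF assms(4)] by (simp add: star_closure_def)
qed

text \<open>Gauss's lemma holds up to closure, by induction on the sum of the degrees. Write
  \<open>f = a X\<^sup>m + f\<^sub>1\<close> and \<open>g = b X\<^sup>n + g\<^sub>1\<close> with leading coefficients \<open>a\<close>, \<open>b\<close>, and let
  \<open>C = c(f g)\<close>. The induction hypothesis for \<open>f g\<^sub>1 = f g - b X\<^sup>n f\<close> shows that \<open>c(f) c(g)\<close> is
  in the closure of \<open>C + b c(f\<^sub>1)\<close>; symmetrically, it is in the closure of \<open>C + a c(g\<^sub>1)\<close>.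
  When the two are multiplied, every one of the four products is in the closure of
  \<open>c(f) c(g) C\<close>, because \<open>a b \<in> C\<close>. So \<open>(c(f) c(g))\<^sup>2\<close> is in that closure, and the eab
  property cancels one factor \<open>c(f) c(g)\<close>.\<close>

lemma gauss_eab:
  assumes "f \<noteq> 0" "g \<noteq> 0"
  shows "coeff_set f * coeff_set g \<subseteq> star_closure R s (coeff_set (f * g))"
  using assms
proof (induction "Polynomial.degree f + Polynomial.degree g" arbitrary: f g rule: less_induct)
  case less
  have tail: "\<exists>a n t. f = Polynomial.monom a n + t \<and> a = Polynomial.coeff f n \<and> n = Polynomial.degree f \<and> a \<noteq> 0 \<and>
      (t \<noteq> 0 \<longrightarrow> Polynomial.degree t < Polynomial.degree f) \<and> coeff_set t \<subseteq> insert 0 (coeff_set f) \<and> coeff_set f \<subseteq> insert a (coeff_set t)"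
    if f: "f \<noteq> 0" for f :: "'a poly"
  proof -
    define n where "n = Polynomial.degree f"
    define a where "a = Polynomial.coeff f n"
    define t where "t = f - Polynomial.monom a n"
    have ct: "Polynomial.coeff t i = (if i = n then 0 else Polynomial.coeff f i)" for i
      unfolding t_def a_def by auto
    have "Polynomial.degree t < n" if "t \<noteq> 0"
    proof -
      have "Polynomial.degree t \<le> n"
        unfolding t_def n_def by (intro degree_diff_le) (auto simp: degree_monom_le)
      moreover have "Polynomial.degree t \<noteq> n"
        using that ct[of n] leading_coeff_0_iff[of t] by auto
      ultimately show ?thesis by simp
    qed
    moreover have "f = Polynomial.monom a n + t" unfolding t_def by simp
    moreover have "a \<noteq> 0" using f unfolding a_def n_def by simp
    moreover have "coeff_set t \<subseteq> insert 0 (coeff_set f)" by (auto simp: coeff_set_subset_iff ct)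
    moreover have "coeff_set f \<subseteq> insert a (coeff_set t)"
      unfolding coeff_set_subset_iff
    proof
      fix i show "Polynomial.coeff f i \<in> insert a (coeff_set t)"
        using coeff_in_coeff_set[of t i] ct[of i] by (cases "i = n") (auto simp: a_def)
    qed
    ultimately show ?thesis unfolding a_def n_def by blast
  qed
  obtain a m f1 where f: "f = Polynomial.monom a m + f1" "a = Polynomial.coeff f m" "m = Polynomial.degree f" "a \<noteq> 0"
    "f1 \<noteq> 0 \<longrightarrow> Polynomial.degree f1 < Polynomial.degree f" "coeff_set f1 \<subseteq> insert 0 (coeff_set f)" "coeff_set f \<subseteq> insert a (coeff_set f1)"
    using tail[OF less.prems(1)] by blast
  obtain b n g1 where g: "g = Polynomial.monom b n + g1" "b = Polynomial.coeff g n" "n = Polynomial.degree g" "b \<noteq> 0"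
    "g1 \<noteq> 0 \<longrightarrow> Polynomial.degree g1 < Polynomial.degree g" "coeff_set g1 \<subseteq> insert 0 (coeff_set g)" "coeff_set g \<subseteq> insert b (coeff_set g1)"
    using tail[OF less.prems(2)] by blast
  define F where "F = coeff_set f" define G where "G = coeff_set g"
  define C where "C = coeff_set (f * g)"
  have fg0: "f * g \<noteq> 0" using less.prems by simp
  have nz: "has_nonzero F" "has_nonzero G" "has_nonzero C" unfolding F_def G_def C_def by (intro has_nonzero_coeff_set less.prems fg0)+
  have ab: "a * b \<in> C"
    using coeff_in_coeff_set[of "f * g" "m + n"] f(2,3) g(2,3) coeff_mult_degree_sum[of f g] by (simp add: C_def)
  \<comment> \<open>The inclusion \<open>c(p) c(q) \<subseteq> (C + b' c(p\<^sub>1))\<^sup>s\<close>, to be used for the pair \<open>(f, g)\<close> and for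
    \<open>(g, f)\<close>.\<close>
  have one_step: "F' * G' \<subseteq> star_closure R s (C \<union> (\<lambda>x. b' * x) ` coeff_set pt)"
    if p: "p = Polynomial.monom a' m' + pt" "a' * b' \<in> C" "p \<noteq> 0" "coeff_set pt \<subseteq> insert 0 (coeff_set p)" "coeff_set p \<subseteq> insert a' (coeff_set pt)"
      and q: "q = Polynomial.monom b' n' + qt" "b' \<noteq> 0" "coeff_set q \<subseteq> insert b' (coeff_set qt)"
      and pq: "coeff_set (p * q) = C" and IH: "qt \<noteq> 0 \<Longrightarrow> coeff_set p * coeff_set qt \<subseteq> star_closure R s (coeff_set (p * qt))"
      and F': "F' = coeff_set p" and G': "G' = coeff_set q"
    for p q pt qt a' b' m' n' F' G'
  proof -
    let ?U = "C \<union> (\<lambda>x. b' * x) ` coeff_set pt"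
    have nzU: "has_nonzero ?U" using nz(3) by (rule has_nonzero_mono) auto
    have bF: "b' * x \<in> star_closure R s ?U" if "x \<in> coeff_set p" for x
    proof -
      have "b' * x \<in> ?U"
      proof (cases "x = a'")
        case True
        then show ?thesis using p(2) by (simp add: mult.commute)
      next
        case False
        then show ?thesis using that p(5) by blast
      qed
      then show ?thesis using star_closure_superset[OF nzU] by blast
    qed
    have "coeff_set p * coeff_set qt \<subseteq> star_closure R s ?U"
    proof (cases "qt = 0")
      case True
      then have "coeff_set p * coeff_set qt \<subseteq> {0}" by (auto simp: set_times_def coeff_set_iff)
      then show ?thesis using zero_in_star_closure[OF nzU] by blast
    next
      case False
      have "p * qt = p * q - Polynomial.monom b' n' * p" unfolding q(1) by (simp add: algebra_simps)
      then have "p * qt = p * q + - (Polynomial.monom b' n' * p)" by simp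
      moreover have "coeff_set (p * q) \<subseteq> star_closure R s ?U" unfolding pq using star_closure_superset[OF nzU] by blast
      moreover have "coeff_set (Polynomial.monom b' n' * p) \<subseteq> star_closure R s ?U"
        using bF zero_in_star_closure[OF nzU] by (auto simp: coeff_set_subset_iff coeff_monom_mult)
      ultimately have "coeff_set (p * qt) \<subseteq> star_closure R s ?U"
        using coeff_set_add_subset[OF nzU] coeff_set_minus_subset[OF nzU] by metis
      then have "star_closure R s (coeff_set (p * qt)) \<subseteq> star_closure R s ?U"
        using p(3) False by (intro star_closure_least[OF nzU] has_nonzero_coeff_set) auto
      then show ?thesis using IH[OF False] by blast
    qed
    show ?thesis
    proof
      fix x assume "x \<in> F' * G'"
      then obtain c d where x: "x = c * d" "c \<in> coeff_set p" "d \<in> coeff_set q" unfolding F' G' by (rule set_times_elim)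
      show "x \<in> star_closure R s ?U"
      proof (cases "d = b'")
        case True
        then show ?thesis using bF[OF x(2)] x(1) by (simp add: mult.commute)
      next
        case False
        then have "d \<in> coeff_set qt" using x(3) q(3) by blast
        then have "x \<in> coeff_set p * coeff_set qt" using x by (auto intro: set_times_intro)
        then show ?thesis using \<open>coeff_set p * coeff_set qt \<subseteq> star_closure R s ?U\<close> by blast
      qed
    qed
  qed
  define U1 where "U1 = C \<union> (\<lambda>x. b * x) ` coeff_set f1"
  define U2 where "U2 = C \<union> (\<lambda>x. a * x) ` coeff_set g1"
  have "F * G \<subseteq> star_closure R s U1"
    unfolding U1_def
  proof (rule one_step[where p = f and q = g and pt = f1 and qt = g1 and a' = a and b' = b and m' = m and n' = n])
    show "coeff_set f * coeff_set g1 \<subseteq> star_closure R s (coeff_set (f * g1))" if "g1 \<noteq> 0"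
      using that g(5) less.prems by (intro less.hyps) auto
  qed (use f g ab less.prems in \<open>simp_all add: F_def G_def C_def\<close>)
  moreover have "G * F \<subseteq> star_closure R s U2"
    unfolding U2_def
  proof (rule one_step[where p = g and q = f and pt = g1 and qt = f1 and a' = b and b' = a and m' = n and n' = m])
    show "coeff_set g * coeff_set f1 \<subseteq> star_closure R s (coeff_set (g * f1))" if "f1 \<noteq> 0"
      using that f(5) less.prems by (intro less.hyps) auto
    show "b * a \<in> C" using ab by (simp add: mult.commute)
    show "coeff_set (g * f) = C" by (simp add: C_def mult.commute)
  qed (use f g less.prems in \<open>simp_all add: F_def G_def\<close>)
  moreover have nzU: "has_nonzero U1" "has_nonzero U2"
    using has_nonzero_mono[OF nz(3), of U1] has_nonzero_mono[OF nz(3), of U2] unfolding U1_def U2_def by auto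
  ultimately have PP: "(F * G) * (F * G) \<subseteq> star_closure R s (U1 * U2)"
    by (intro star_closure_times2) (simp_all add: mult.commute)
  define P where "P = F * G"
  have nzP: "has_nonzero P" and nzPC: "has_nonzero (P * C)" unfolding P_def using has_nonzero_times nz by auto
  have sP: "x * c \<in> star_closure R s (P * C)" if "x \<in> star_closure R s P" "c \<in> C" for x c
    using star_closure_times[OF nzP nz(3) order_refl] that by (auto intro: set_times_intro)
  have CP: "C \<subseteq> star_closure R s P"
    using coeff_set_mult_subset[of f g] nzP unfolding P_def F_def G_def C_def by simp
  have F1: "x * y \<in> insert 0 P" if "x \<in> insert 0 F" "y \<in> insert 0 G" for x y
    using that unfolding P_def by (auto intro: set_times_intro)
  have ins: "x \<in> star_closure R s P" if "x \<in> insert 0 P" for x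
    using that insert_0_subset_star_closure[OF nzP] by blast
  have aF: "a \<in> F" "b \<in> G" using f(2) g(2) by (auto simp: F_def G_def)
  have "U1 * U2 \<subseteq> star_closure R s (P * C)"
  proof
    fix z assume "z \<in> U1 * U2"
    then obtain x y where z: "z = x * y" "x \<in> U1" "y \<in> U2" by (rule set_times_elim)
    have bf: "b * u \<in> star_closure R s P" if "u \<in> coeff_set f1" for u
      using that f(6) aF F1[of u b] ins by (auto simp: F_def mult.commute)
    have ag: "a * u \<in> star_closure R s P" if "u \<in> coeff_set g1" for u
      using that g(6) aF F1[of a u] ins by (auto simp: G_def)
    consider "x \<in> C" "y \<in> C" | u where "x \<in> C" "y = a * u" "u \<in> coeff_set g1"
      | u where "x = b * u" "u \<in> coeff_set f1" "y \<in> C"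
      | u v where "x = b * u" "u \<in> coeff_set f1" "y = a * v" "v \<in> coeff_set g1"
      using z(2,3) unfolding U1_def U2_def by blast
    then show "z \<in> star_closure R s (P * C)"
    proof cases
      case 1
      then show ?thesis using z(1) sP CP by blast
    next
      case 2
      then have "(a * u) * x \<in> star_closure R s (P * C)" using sP[OF ag] by blast
      then show ?thesis using z(1) 2(2) by (simp only: mult.commute[of x])
    next
      case 3
      then show ?thesis using z(1) sP[OF bf] by blast
    next
      case 4
      then have "u \<in> insert 0 F" "v \<in> insert 0 G" using f(6) g(6) unfolding F_def G_def by blast+
      then have "u * v \<in> star_closure R s P" by (rule ins[OF F1])
      then have "(u * v) * (a * b) \<in> star_closure R s (P * C)" by (rule sP[OF _ ab])
      moreover have "z = (u * v) * (a * b)" using z(1) 4 by (simp add: algebra_simps)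
      ultimately show ?thesis by simp
    qed
  qed
  then have "star_closure R s (U1 * U2) \<subseteq> star_closure R s (P * C)" by (intro star_closure_least nzPC has_nonzero_times nzU)
  then have "P * P \<subseteq> star_closure R s (P * C)" using PP unfolding P_def by blast
  moreover have "finite P" "finite C" unfolding P_def F_def G_def C_def by (intro finite_set_times_fields finite_coeff_set)+
  ultimately have "P \<subseteq> star_closure R s C" using star_closure_cancel[of P P C] nzP nz(3) by blast
  then show ?case by (simp add: P_def F_def G_def C_def)
qed

end

section \<open>The Kronecker function ring of an eab operation\<close>

text \<open>The module generated by \<open>T\<close> over the Kronecker function ring of \<open>s\<close>, again described by
  single fractions; the ring itself is the case \<open>T = {1}\<close>.\<close>

definition kron_mod :: "'k::field set \<Rightarrow> ('k set \<Rightarrow> 'k set) \<Rightarrow> 'k set \<Rightarrow> 'k poly fract set" where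
  "kron_mod R s T = {of_poly p / of_poly q | p q. q \<noteq> 0 \<and> coeff_set p \<subseteq> star_closure R s (T * coeff_set q)}"

definition kron :: "'k::field set \<Rightarrow> ('k set \<Rightarrow> 'k set) \<Rightarrow> 'k poly fract set" where
  "kron R s = kron_mod R s {1}"

lemma singleton_1_times: "{1} * S = (S :: 'l::field set)"
  by (auto simp: set_times_def)

lemma has_nonzero_singleton_1: "has_nonzero {1 :: 'l::field}"
  by (simp add: has_nonzero_def)

context eab_semistar
begin

lemma kron_modI: "q \<noteq> 0 \<Longrightarrow> coeff_set p \<subseteq> star_closure R s (T * coeff_set q) \<Longrightarrow> of_poly p / of_poly q \<in> kron_mod R s T"
  unfolding kron_mod_def by blast

lemma kron_modE:
  assumes "x \<in> kron_mod R s T"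
  obtains p q where "q \<noteq> 0" "x = of_poly p / of_poly q" "coeff_set p \<subseteq> star_closure R s (T * coeff_set q)"
  using assms unfolding kron_mod_def by blast

text \<open>Products of contents may be replaced by contents of products; this is the only way in
  which Gauss's lemma enters the arithmetic of fractions.\<close>

lemma star_closure_gauss:
  assumes "has_nonzero T" "f \<noteq> 0" "g \<noteq> 0"
  shows "star_closure R s (T * (coeff_set f * coeff_set g)) \<subseteq> star_closure R s (T * coeff_set (f * g))"
proof (rule star_closure_least)
  show "has_nonzero (T * coeff_set (f * g))" "has_nonzero (T * (coeff_set f * coeff_set g))"
    using assms by (auto intro!: has_nonzero_times has_nonzero_coeff_set)
  have "(coeff_set f * coeff_set g) * T \<subseteq> star_closure R s (coeff_set (f * g) * T)"
    by (rule star_closure_times[OF has_nonzero_coeff_set assms(1) gauss_eab]) (use assms in auto)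
  then show "T * (coeff_set f * coeff_set g) \<subseteq> star_closure R s (T * coeff_set (f * g))" by (simp add: mult.commute)
qed

lemma kron_mod_mult:
  assumes "has_nonzero S" "has_nonzero T" "x \<in> kron_mod R s S" "y \<in> kron_mod R s T"
  shows "x * y \<in> kron_mod R s (S * T)"
proof -
  obtain p q where pq: "q \<noteq> 0" "x = of_poly p / of_poly q" "coeff_set p \<subseteq> star_closure R s (S * coeff_set q)"
    using assms(3) by (rule kron_modE)
  obtain u v where uv: "v \<noteq> 0" "y = of_poly u / of_poly v" "coeff_set u \<subseteq> star_closure R s (T * coeff_set v)"
    using assms(4) by (rule kron_modE)
  have "coeff_set (p * u) \<subseteq> star_closure R s ((S * coeff_set q) * (T * coeff_set v))"
    by (rule coeff_set_mult_subset'[OF has_nonzero_times has_nonzero_times pq(3) uv(3)]) (use assms has_nonzero_coeff_set pq uv in auto)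
  also have "(S * coeff_set q) * (T * coeff_set v) = (S * T) * (coeff_set q * coeff_set v)" by (simp only: mult_ac)
  also have "star_closure R s \<dots> \<subseteq> star_closure R s ((S * T) * coeff_set (q * v))"
    by (rule star_closure_gauss[OF has_nonzero_times]) (use assms pq uv in auto)
  finally show ?thesis using kron_modI[of "q * v" "p * u" "S * T"] pq uv by simp
qed

text \<open>Over the common denominator \<open>q q'\<close> both numerators have coefficients in the closure of
  \<open>T c(q) c(q')\<close>, which Gauss's lemma replaces by \<open>T c(q q')\<close>.\<close>

lemma kron_mod_add:
  assumes "has_nonzero T" "x \<in> kron_mod R s T" "y \<in> kron_mod R s T"
  shows "x + y \<in> kron_mod R s T"
proof -
  obtain p q where pq: "q \<noteq> 0" "x = of_poly p / of_poly q" "coeff_set p \<subseteq> star_closure R s (T * coeff_set q)"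
    using assms(2) by (rule kron_modE)
  obtain u v where uv: "v \<noteq> 0" "y = of_poly u / of_poly v" "coeff_set u \<subseteq> star_closure R s (T * coeff_set v)"
    using assms(3) by (rule kron_modE)
  have nzs: "has_nonzero (T * (coeff_set q * coeff_set v))" using assms(1) pq(1) uv(1) by (auto intro!: has_nonzero_times has_nonzero_coeff_set)
  have self: "coeff_set f \<subseteq> star_closure R s (coeff_set f)" if "f \<noteq> 0" for f using star_closure_superset has_nonzero_coeff_set that by blast
  have "coeff_set (p * v) \<subseteq> star_closure R s ((T * coeff_set q) * coeff_set v)"
    by (rule coeff_set_mult_subset'[OF has_nonzero_times has_nonzero_coeff_set pq(3) self]) (use assms has_nonzero_coeff_set pq uv in auto)
  moreover have "coeff_set (u * q) \<subseteq> star_closure R s ((T * coeff_set v) * coeff_set q)"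
    by (rule coeff_set_mult_subset'[OF has_nonzero_times has_nonzero_coeff_set uv(3) self]) (use assms has_nonzero_coeff_set pq uv in auto)
  ultimately have "coeff_set (p * v + u * q) \<subseteq> star_closure R s (T * (coeff_set q * coeff_set v))"
    by (intro coeff_set_add_subset[OF nzs]) (simp_all only: mult_ac)
  also have "\<dots> \<subseteq> star_closure R s (T * coeff_set (q * v))" by (rule star_closure_gauss[OF assms(1) pq(1) uv(1)])
  finally have "of_poly (p * v + u * q) / of_poly (q * v) \<in> kron_mod R s T"
    using pq uv by (intro kron_modI) auto
  moreover have "of_poly (p * v + u * q) / of_poly (q * v) = x + y"
    using pq uv by (simp add: add_frac_eq)
  ultimately show ?thesis by simp
qed

lemma kron_mod_uminus:
  assumes "has_nonzero T" "x \<in> kron_mod R s T"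
  shows "- x \<in> kron_mod R s T"
proof -
  obtain p q where pq: "q \<noteq> 0" "x = of_poly p / of_poly q" "coeff_set p \<subseteq> star_closure R s (T * coeff_set q)"
    using assms(2) by (rule kron_modE)
  have "coeff_set (- p) \<subseteq> star_closure R s (T * coeff_set q)"
    by (rule coeff_set_minus_subset[OF has_nonzero_times pq(3)]) (use assms has_nonzero_coeff_set pq in auto)
  then show ?thesis using kron_modI[OF pq(1), of "- p" T] pq(2) by simp
qed

lemma content_closed_kron: "content_closed (kron R s)"
  unfolding content_closed_def
proof (intro conjI allI impI)
  have cc: "of_poly f / of_poly h \<in> kron R s" if "h \<noteq> 0" "coeff_set f \<subseteq> insert 0 (coeff_set h)" for f h
    unfolding kron_def
    using that insert_0_subset_star_closure[OF has_nonzero_coeff_set[OF that(1)]] by (intro kron_modI) (auto simp: singleton_1_times)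
  then show "\<And>f h. h \<noteq> 0 \<Longrightarrow> coeff_set f \<subseteq> insert 0 (coeff_set h) \<Longrightarrow> of_poly f / of_poly h \<in> kron R s" .
  have "1 \<in> kron R s" using cc[of 1 1] by auto
  moreover have "x - y \<in> kron R s" if "x \<in> kron R s" "y \<in> kron R s" for x y
    using kron_mod_add[OF has_nonzero_singleton_1, of x "- y"] kron_mod_uminus[OF has_nonzero_singleton_1, of y] that
    unfolding kron_def by simp
  moreover have "x * y \<in> kron R s" if "x \<in> kron R s" "y \<in> kron R s" for x y
    using kron_mod_mult[OF has_nonzero_singleton_1 has_nonzero_singleton_1, of x y] that
    unfolding kron_def singleton_1_times by simp
  ultimately show "unital_subring (kron R s)" unfolding unital_subring_def by blast
qed

lemma const_mem_kron_mod:
  assumes "has_nonzero T" "x \<in> star_closure R s T"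
  shows "const_rat x \<in> kron_mod R s T"
proof -
  have "coeff_set [:x:] \<subseteq> {x, 0}" by (rule coeff_set_const)
  also have "\<dots> \<subseteq> star_closure R s T" using assms zero_in_star_closure by blast
  also have "\<dots> \<subseteq> star_closure R s (T * coeff_set 1)"
  proof (rule star_closure_mono[OF assms(1)], rule subsetI)
    fix t assume "t \<in> T"
    then show "t \<in> T * coeff_set 1" using set_times_intro[OF _ one_in_coeff_set_1, of t T] by simp
  qed
  finally have "of_poly [:x:] / of_poly 1 \<in> kron_mod R s T" by (intro kron_modI) auto
  then show ?thesis by (simp add: const_rat_def)
qed

lemma submod_kron_mod:
  assumes "has_nonzero T"
  shows "submod (kron R s) (kron_mod R s T)"
proof -
  have "const_rat 0 \<in> kron_mod R s T" by (rule const_mem_kron_mod[OF assms zero_in_star_closure[OF assms]])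
  moreover have "a * x \<in> kron_mod R s T" if "a \<in> kron R s" "x \<in> kron_mod R s T" for a x
    using kron_mod_mult[OF has_nonzero_singleton_1 assms] that unfolding kron_def singleton_1_times by blast
  ultimately show ?thesis unfolding submod_def using kron_mod_add[OF assms] by simp
qed

lemma R_subset_kron: "d \<in> R \<Longrightarrow> const_rat d \<in> kron R s"
  unfolding kron_def
proof (rule const_mem_kron_mod[OF has_nonzero_singleton_1])
  assume "d \<in> R"
  then have "d * 1 \<in> star_closure R s {1}"
    using submodD(3)[OF submod_star_closure[OF has_nonzero_singleton_1]] star_closure_superset[OF has_nonzero_singleton_1] by blast
  then show "d \<in> star_closure R s {1}" by simp
qed

text \<open>The coefficients of \<open>x v\<close> are those of \<open>v\<close> multiplied by \<open>x\<close>, and the eab property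
  cancels the content of \<open>v\<close>.\<close>

lemma cancel_content:
  assumes "finite T" "has_nonzero T" "v \<noteq> 0" "coeff_set ([:x:] * v) \<subseteq> star_closure R s (coeff_set v * T)"
  shows "x \<in> star_closure R s T"
proof (cases "x = 0")
  case True then show ?thesis using zero_in_star_closure[OF assms(2)] by simp
next
  case False
  have "coeff_set v * {x} \<subseteq> coeff_set ([:x:] * v)"
  proof
    fix z assume "z \<in> coeff_set v * {x}"
    then obtain w where "w \<in> coeff_set v" "z = w * x" by (auto simp: set_times_def)
    then obtain i where "z = x * Polynomial.coeff v i" by (auto simp: coeff_set_iff)
    then have "z = Polynomial.coeff ([:x:] * v) i" by simp
    then show "z \<in> coeff_set ([:x:] * v)" by (simp only: coeff_in_coeff_set)
  qed
  then have sub: "coeff_set v * {x} \<subseteq> star_closure R s (coeff_set v * T)" using assms(4) by blast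
  have "{x} \<subseteq> star_closure R s T"
    by (rule star_closure_cancel[OF finite_coeff_set has_nonzero_coeff_set[OF assms(3)] _ _ assms(1,2) sub]) (simp_all add: has_nonzero_def False)
  then show ?thesis by simp
qed

text \<open>The denominator of a fraction that represents a constant is cancelled by the eab
  property. So the ring remembers the closure of finite sets.\<close>

lemma const_mem_kron_mod_iff:
  assumes "finite T" "has_nonzero T"
  shows "const_rat x \<in> kron_mod R s T \<longleftrightarrow> x \<in> star_closure R s T"
proof
  assume "const_rat x \<in> kron_mod R s T"
  then obtain p q where pq: "q \<noteq> 0" "const_rat x = of_poly p / of_poly q" "coeff_set p \<subseteq> star_closure R s (T * coeff_set q)"
    by (rule kron_modE)
  have "const_rat x * of_poly q = of_poly p" using pq by simp
  then have "of_poly ([:x:] * q) = of_poly p" unfolding const_rat_def of_poly_simps(3) .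
  then have "[:x:] * q = p" by (simp only: of_poly_eq_iff)
  then show "x \<in> star_closure R s T"
    using pq(3) by (intro cancel_content[OF assms pq(1)]) (simp add: mult.commute)
qed (rule const_mem_kron_mod[OF assms(2)])

text \<open>Each relation \<open>c \<in> c(q)\<^sup>s\<close> is encoded by the membership of one element, whichever
  fraction represents it.\<close>

lemma const_div_mem_kron_iff:
  assumes "q \<noteq> 0"
  shows "const_rat c / of_poly q \<in> kron R s \<longleftrightarrow> c \<in> star_closure R s (coeff_set q)"
proof
  assume "const_rat c / of_poly q \<in> kron R s"
  then obtain u v where uv: "v \<noteq> 0" "const_rat c / of_poly q = of_poly u / of_poly v" "coeff_set u \<subseteq> star_closure R s (coeff_set v)"
    unfolding kron_def by (rule kron_modE) (simp add: singleton_1_times)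
  have "const_rat c * of_poly v = of_poly u * of_poly q" using uv assms by (simp add: frac_eq_eq)
  then have "of_poly ([:c:] * v) = of_poly (u * q)" unfolding const_rat_def of_poly_simps(3) .
  then have eq: "[:c:] * v = u * q" by (simp only: of_poly_eq_iff)
  have "coeff_set (u * q) \<subseteq> star_closure R s (coeff_set v * coeff_set q)"
    by (rule coeff_set_mult_subset'[OF has_nonzero_coeff_set has_nonzero_coeff_set uv(3) star_closure_superset[OF has_nonzero_coeff_set]]) (use uv assms in auto)
  then show "c \<in> star_closure R s (coeff_set q)"
    by (intro cancel_content[OF finite_coeff_set has_nonzero_coeff_set uv(1)]) (use assms eq in auto)
next
  assume c: "c \<in> star_closure R s (coeff_set q)"
  have "coeff_set [:c:] \<subseteq> {c, 0}" by (rule coeff_set_const)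
  also have "\<dots> \<subseteq> star_closure R s (coeff_set q)" using c zero_in_star_closure[OF has_nonzero_coeff_set[OF assms]] by blast
  finally show "const_rat c / of_poly q \<in> kron R s"
    unfolding kron_def const_rat_def using assms by (intro kron_modI) (auto simp: singleton_1_times)
qed

end

text \<open>Localize at a maximal ideal containing the proper ideal of all \<open>b\<close> with \<open>b x \<in> F\<close>. A
  denominator of \<open>x\<close> over the localization of \<open>F\<close> would belong to this ideal.\<close>

lemma ex_localization_avoiding:
  assumes B: "content_closed B" and F: "submod B F" and x: "x \<notin> F"
  shows "\<exists>W \<in> Zar B. x \<notin> val_extension W F"
proof -
  note s = content_closedD(1)[OF B]
  note u = unital_subringD[OF s]
  define I where "I = {b \<in> B. b * x \<in> F}"
  have "submod B I"
    unfolding submod_def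
  proof (intro conjI ballI)
    show "0 \<in> I" using u(2) submodD(1)[OF F] unfolding I_def by simp
  next
    fix a b assume "a \<in> I" "b \<in> I"
    then show "a + b \<in> I" using u(5) submodD(2)[OF F] unfolding I_def by (simp add: distrib_right)
  next
    fix a b assume "a \<in> B" "b \<in> I"
    then show "a * b \<in> I" using u(6) submodD(3)[OF F] unfolding I_def by (simp add: mult.assoc)
  qed
  moreover have "I \<subseteq> B" "1 \<notin> I" using x unfolding I_def by auto
  ultimately obtain N where N: "prime_in B N" "I \<subseteq> N" using ex_prime_in_superset[OF s] by blast
  have "x \<notin> val_extension (localize B N) F"
  proof
    assume "x \<in> val_extension (localize B N) F"
    then obtain e a t where e: "e \<in> F" "e \<noteq> 0" "a \<in> B" "t \<in> B - N" "x / e = a / t"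
      unfolding val_extension_def localize_def by blast
    then have "t \<noteq> 0" using prime_inD(5)[OF N(1)] by auto
    then have "t * x = a * e" using e by (simp add: frac_eq_eq mult.commute)
    then have "t \<in> I" using submodD(3)[OF F e(3,1)] e(4) unfolding I_def by auto
    then show False using e(4) N(2) by blast
  qed
  then show ?thesis using localize_mem_Zar[OF B N(1)] by blast
qed

section \<open>Operations of finite type\<close>

text \<open>Finite type in terms of generators, so that it can be used with closures of finite sets.\<close>

lemma finite_type_iff:
  assumes R: "unital_subring R" and quot: "\<And>x. \<exists>a\<in>R. \<exists>b\<in>R. b \<noteq> 0 \<and> x = a / b" and s: "s \<in> SStar R"
  shows "finite_type R s \<longleftrightarrow> (\<forall>E\<in>Fbar R. \<forall>x\<in>s E. \<exists>S. finite S \<and> has_nonzero S \<and> S \<subseteq> E \<and> x \<in> star_closure R s S)"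
proof -
  interpret semistar R s by unfold_locales (fact R, fact s)
  have fg: "F \<in> fg_fractional R \<longleftrightarrow> (\<exists>S. finite S \<and> has_nonzero S \<and> F = module_span R S)" for F
    using fg_fractional_iff[OF R quot] unfolding has_nonzero_def by blast
  have sub: "star_closure R s S \<subseteq> s E" if "E \<in> Fbar R" "S \<subseteq> E" "has_nonzero S" for S E
  proof -
    have "module_span R S \<subseteq> E" using that Fbar_iff[OF R] by (intro module_span_least[OF R]) auto
    then show ?thesis unfolding star_closure_def by (intro SStarD(3)[OF s has_nonzero_span[OF R that(3)] that(1)])
  qed
  have "s E = \<Union>{s F | F. F \<in> fg_fractional R \<and> F \<subseteq> E} \<longleftrightarrow>
      (\<forall>x\<in>s E. \<exists>S. finite S \<and> has_nonzero S \<and> S \<subseteq> E \<and> x \<in> star_closure R s S)" if E: "E \<in> Fbar R" for E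
  proof
    assume eq: "s E = \<Union>{s F | F. F \<in> fg_fractional R \<and> F \<subseteq> E}"
    show "\<forall>x\<in>s E. \<exists>S. finite S \<and> has_nonzero S \<and> S \<subseteq> E \<and> x \<in> star_closure R s S"
    proof
      fix x assume "x \<in> s E"
      then have "x \<in> \<Union>{s F | F. F \<in> fg_fractional R \<and> F \<subseteq> E}" using eq by metis
      then obtain F where F: "F \<in> fg_fractional R" "F \<subseteq> E" "x \<in> s F" by blast
      then obtain S where "finite S" "has_nonzero S" "F = module_span R S" unfolding fg by blast
      then show "\<exists>S. finite S \<and> has_nonzero S \<and> S \<subseteq> E \<and> x \<in> star_closure R s S"
        using F module_span_superset[OF R, of S] unfolding star_closure_def by blast
    qed
  next
    assume *: "\<forall>x\<in>s E. \<exists>S. finite S \<and> has_nonzero S \<and> S \<subseteq> E \<and> x \<in> star_closure R s S"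
    show "s E = \<Union>{s F | F. F \<in> fg_fractional R \<and> F \<subseteq> E}"
    proof (intro equalityI subsetI)
      fix x assume "x \<in> s E"
      then obtain S where S: "finite S" "has_nonzero S" "S \<subseteq> E" "x \<in> star_closure R s S" using * by blast
      then have "module_span R S \<subseteq> E" using E Fbar_iff[OF R] by (intro module_span_least[OF R]) auto
      moreover have "module_span R S \<in> fg_fractional R" using fg S by blast
      ultimately show "x \<in> \<Union>{s F | F. F \<in> fg_fractional R \<and> F \<subseteq> E}"
        using S(4) unfolding star_closure_def by blast
    next
      fix x assume "x \<in> \<Union>{s F | F. F \<in> fg_fractional R \<and> F \<subseteq> E}"
      then obtain F where F: "F \<in> fg_fractional R" "F \<subseteq> E" "x \<in> s F" by blast
      then have "F \<in> Fbar R" unfolding fg_fractional_def by blast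
      then show "x \<in> s E" using SStarD(3)[OF s _ E F(2)] F(3) by blast
    qed
  qed
  then show ?thesis unfolding finite_type_def by simp
qed

text \<open>At a single \<open>V\<close> a finitely generated \<open>F\<close> becomes principal, generated by a generator \<open>m\<close>
  of \<open>F\<close> of largest value at \<open>V\<close>. As \<open>m\<close> also lies in \<open>F\<close>, from \<open>x \<in> G\<^sup>\<and>\<close> one gets
  \<open>m x \<in> (F G)\<^sup>\<and> \<subseteq> F H V = m H V\<close>, so \<open>x \<in> H V\<close>.\<close>

lemma wedge_eab:
  assumes R: "unital_subring R" and Y: "Y \<subseteq> Zar R"
  shows "eab R (wedge R Y)"
  unfolding eab_def
proof (intro ballI impI)
  fix F G H assume fg: "F \<in> fg_fractional R" "G \<in> fg_fractional R" "H \<in> fg_fractional R"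
    and sub: "wedge R Y (module_prod R F G) \<subseteq> wedge R Y (module_prod R F H)"
  have Fb: "F \<in> Fbar R" "G \<in> Fbar R" "H \<in> Fbar R" using fg unfolding fg_fractional_def by auto
  obtain S where S: "finite S" "F = module_span R S" using fg(1) unfolding fg_fractional_def by blast
  have nzS: "\<exists>s\<in>S. s \<noteq> 0"
  proof (rule ccontr)
    assume "\<not> ?thesis"
    then have "module_span R S \<subseteq> {0}" by (intro module_span_least[OF R]) (auto simp: submod_def)
    then show False using Fb(1) S(2) by (auto simp: Fbar_iff[OF R])
  qed
  have P: "module_prod R A B \<in> Fbar R" "V \<in> Zar R \<Longrightarrow> val_extension V (module_prod R A B) = val_extension V {e * f |e f. e \<in> A \<and> f \<in> B}"
    if AB: "A \<in> Fbar R" "B \<in> Fbar R" for A B V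
  proof -
    obtain a b where ab: "a \<in> A" "a \<noteq> 0" "b \<in> B" "b \<noteq> 0" using AB unfolding Fbar_iff[OF R] by blast
    then have ab': "a * b \<in> {e * f |e f. e \<in> A \<and> f \<in> B}" "a * b \<noteq> 0" by auto
    show "module_prod R A B \<in> Fbar R" unfolding module_prod_def by (rule module_span_Fbar[OF R ab'])
    have ex: "\<exists>s\<in>{e * f |e f. e \<in> A \<and> f \<in> B}. s \<noteq> 0" using ab' by (intro bexI)
    show "val_extension V (module_prod R A B) = val_extension V {e * f |e f. e \<in> A \<and> f \<in> B}" if VZ: "V \<in> Zar R"
      unfolding module_prod_def by (rule val_extension_module_span[OF R VZ ex])
  qed
  have "x \<in> val_extension V H" if x: "x \<in> wedge R Y G" and V: "V \<in> Y" for x V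
  proof -
    have VZ: "V \<in> Zar R" using V Y by blast
    obtain m where m: "m \<in> S" "m \<noteq> 0" "\<forall>t\<in>S. t / m \<in> V" using Zar_max_elem[OF VZ S(1) nzS] by blast
    have mF: "m \<in> F" using m(1) S(2) module_span_superset[OF R] by blast
    have "m * x \<in> val_extension V' (module_prod R F G)" if V': "V' \<in> Y" for V'
    proof -
      have VZ': "V' \<in> Zar R" using V' Y by blast
      obtain g where g: "g \<in> G" "g \<noteq> 0" "x / g \<in> V'"
        using x V' unfolding wedge_eq[OF R Y Fb(2)] val_extension_def by blast
      have "(m * x) / (m * g) \<in> V'" using g(3) m(2) by simp
      moreover have "m * g \<in> {e * f |e f. e \<in> F \<and> f \<in> G}" using mF g(1) by blast
      moreover have "m * g \<noteq> 0" using m(2) g(2) by simp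
      ultimately show ?thesis unfolding P(2)[OF Fb(1,2) VZ'] unfolding val_extension_def by blast
    qed
    then have "m * x \<in> wedge R Y (module_prod R F G)" unfolding wedge_eq[OF R Y P(1)[OF Fb(1,2)]] by blast
    then have "m * x \<in> val_extension V (module_prod R F H)"
      using sub V unfolding wedge_eq[OF R Y P(1)[OF Fb(1,3)]] by blast
    then obtain e h where eh: "e \<in> F" "h \<in> H" "e * h \<noteq> 0" "(m * x) / (e * h) \<in> V"
      unfolding P(2)[OF Fb(1,3) VZ] unfolding val_extension_def by blast
    have "e \<in> val_extension V S"
      using val_extension_superset[OF VZ eh(1)] eh(3) val_extension_module_span[OF R VZ nzS] S(2) by auto
    then obtain t where t: "t \<in> S" "t \<noteq> 0" "e / t \<in> V" unfolding val_extension_def by blast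
    have em: "e / m \<in> V" using Zar_div_trans[OF VZ t(2,3)] m(3) t(1) by blast
    have "x / h = ((m * x) / (e * h)) * (e / m)" using eh(3) m(2) by simp
    then have "x / h \<in> V" using unital_subringD(6)[OF ZarD(1)[OF VZ] eh(4) em] by simp
    then show ?thesis using eh(2,3) unfolding val_extension_def by auto
  qed
  then show "wedge R Y G \<subseteq> wedge R Y H" unfolding wedge_eq[OF R Y Fb(3)] by blast
qed

context quotient_field_domain
begin

text \<open>The valuation rings which correspond to the valuation overrings of \<open>kron D r\<close>.\<close>

definition over_zar :: "('k set \<Rightarrow> 'k set) \<Rightarrow> 'k set set" where
  "over_zar r = {V \<in> Zar D. kron D r \<subseteq> gauss_ext V}"

text \<open>The spectral operation defined by all primes of \<open>Kr(D)\<close> whose localization contains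
  \<open>kron D r\<close>. It turns out to be extension to \<open>kron D r\<close>.\<close>

definition Theta_inv :: "('k set \<Rightarrow> 'k set) \<Rightarrow> 'k poly fract set \<Rightarrow> 'k poly fract set" where
  "Theta_inv r = wedge (Kr D) (gauss_ext ` over_zar r)"

lemma over_zar_subset: "over_zar r \<subseteq> Zar D"
  unfolding over_zar_def by blast

lemma eab_semistarI: "r \<in> SStar_f_eab D \<Longrightarrow> eab_semistar D r"
  unfolding SStar_f_eab_def using D_subring D_quotient by unfold_locales auto

text \<open>Every eab operation dominates the \<open>b\<close>-operation. Indeed, if \<open>c \<notin> c(q)\<^sup>r\<close>, then \<open>c / q\<close>
  is not in \<open>kron D r\<close>, and some valuation overring \<open>W\<close> of this ring omits \<open>c / q\<close>. Since
  \<open>t / q \<in> W\<close> for all coefficients \<open>t\<close> of \<open>q\<close>, the trace of \<open>W\<close> on \<open>K\<close> witnesses that \<open>c\<close> is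
  not in the \<open>b\<close>-closure of the content of \<open>q\<close>.\<close>

lemma Kr_subset_kron:
  assumes r: "r \<in> SStar_f_eab D"
  shows "Kr D \<subseteq> kron D r"
proof
  interpret eab_semistar D r by (rule eab_semistarI[OF r])
  fix x assume x: "x \<in> Kr D"
  obtain p q where pq: "q \<noteq> 0" "x = of_poly p / of_poly q" by (rule fraction_cases)
  have "c \<in> star_closure D r (coeff_set q)" if c: "c \<in> coeff_set p" for c
  proof (rule ccontr)
    assume "c \<notin> star_closure D r (coeff_set q)"
    then have "const_rat c / of_poly q \<notin> kron D r" using const_div_mem_kron_iff[OF pq(1)] by blast
    moreover have "submod (kron D r) (kron D r)"
      by (rule submod_self[OF content_closedD(1)[OF content_closed_kron]])
    ultimately obtain W where W: "W \<in> Zar (kron D r)" "const_rat c / of_poly q \<notin> val_extension W (kron D r)"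
      using ex_localization_avoiding[OF content_closed_kron] by blast
    define V where "V = {x. const_rat x \<in> W}"
    have V: "V \<in> Zar D" unfolding V_def by (rule Zar_trace[OF W(1) R_subset_kron])
    have "c \<in> val_extension V (coeff_set q)" using x c V fraction_mem_Kr[OF pq(1)] pq(2) by blast
    then obtain t where t: "t \<in> coeff_set q" "t \<noteq> 0" "c / t \<in> V" unfolding val_extension_def by blast
    have "const_rat t / of_poly q \<in> W"
      using coeff_div_mem[OF content_closed_kron pq(1) t(1)] ZarD(2)[OF W(1)] by blast
    moreover have "const_rat (c / t) \<in> W" using t(3) unfolding V_def by simp
    ultimately have "const_rat (c / t) * (const_rat t / of_poly q) \<in> W"
      using unital_subringD(6)[OF ZarD(1)[OF W(1)]] by blast
    then have "const_rat c / of_poly q \<in> W" using t(2) by simp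
    moreover have "1 \<in> kron D r" by (rule unital_subringD(1)[OF content_closedD(1)[OF content_closed_kron]])
    ultimately have "const_rat c / of_poly q \<in> val_extension W (kron D r)" unfolding val_extension_def by (intro CollectI bexI[of _ 1]) auto
    then show False using W(2) by blast
  qed
  then show "x \<in> kron D r"
    unfolding kron_def pq(2) using pq(1) by (intro kron_modI) (auto simp: singleton_1_times)
qed

text \<open>An element outside \<open>F kron D r\<close> is separated from it by a valuation overring of
  \<open>kron D r\<close>. That ring contains \<open>Kr(D)\<close>, so it is Gaussian and takes part in the intersection
  that defines the operation.\<close>

lemma Theta_inv_eq_span:
  assumes r: "r \<in> SStar_f_eab D" and F: "F \<in> Fbar (Kr D)"
  shows "Theta_inv r F = module_span (kron D r) F"
proof -
  interpret eab_semistar D r by (rule eab_semistarI[OF r])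
  note B = content_closedD(1)[OF content_closed_kron]
  have nzF: "\<exists>e\<in>F. e \<noteq> 0" using F by (simp add: Fbar_iff[OF Kr_subring])
  have eq: "Theta_inv r F = (\<Inter>V\<in>over_zar r. val_extension (gauss_ext V) F)"
    unfolding Theta_inv_def by (rule wedge_Kr_eq[OF over_zar_subset F])
  show ?thesis
  proof
    show "module_span (kron D r) F \<subseteq> Theta_inv r F"
      unfolding eq
    proof (rule module_span_least[OF B])
      have Z: "gauss_ext V \<in> Zar (Kr D)" "kron D r \<subseteq> gauss_ext V" if "V \<in> over_zar r" for V
        using that gauss_ext_mem_Zar_Kr unfolding over_zar_def by blast+
      show "submod (kron D r) (\<Inter>V\<in>over_zar r. val_extension (gauss_ext V) F)"
        by (rule submod_Int) (rule submod_subring_mono[OF submod_val_extension[OF Z(1) nzF] Z(2)])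
      show "F \<subseteq> (\<Inter>V\<in>over_zar r. val_extension (gauss_ext V) F)"
      proof (intro subsetI INT_I)
        fix x V assume "x \<in> F" "V \<in> over_zar r"
        then show "x \<in> val_extension (gauss_ext V) F"
          using val_extension_superset[OF Z(1)] submodD(1)[OF submod_val_extension[OF Z(1) nzF]] by (cases "x = 0") auto
      qed
    qed
    show "Theta_inv r F \<subseteq> module_span (kron D r) F"
    proof (rule subsetI, rule ccontr)
      fix x assume x: "x \<in> Theta_inv r F" "x \<notin> module_span (kron D r) F"
      obtain W where W: "W \<in> Zar (kron D r)" "x \<notin> val_extension W (module_span (kron D r) F)"
        using ex_localization_avoiding[OF content_closed_kron submod_module_span[OF B] x(2)] by blast
      have WK: "W \<in> Zar (Kr D)" using W(1) Kr_subset_kron[OF r] unfolding Zar_iff by blast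
      define V where "V = {x. const_rat x \<in> W}"
      have V: "V \<in> Zar D" "W = gauss_ext V"
        unfolding V_def using Zar_trace[OF WK const_mem_Kr] Zar_Kr_eq_gauss_ext[OF WK] by blast+
      then have "V \<in> over_zar r" unfolding over_zar_def using ZarD(2)[OF W(1)] by blast
      then have "x \<in> val_extension W F" using x(1) V(2) unfolding eq by blast
      then show False using W(2) val_extension_mono[OF module_span_superset[OF B]] by blast
    qed
  qed
qed

lemma Theta_inv_mem_SStar_f_sp:
  assumes r: "r \<in> SStar_f_eab D"
  shows "Theta_inv r \<in> SStar_f_sp (Kr D)"
proof -
  interpret eab_semistar D r by (rule eab_semistarI[OF r])
  note B = content_closedD(1)[OF content_closed_kron]
  have sp: "Theta_inv r \<in> SStar_sp (Kr D)" unfolding Theta_inv_def SStar_sp_eq using over_zar_subset by blast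
  have "finite_type (Kr D) (Theta_inv r)"
    unfolding finite_type_iff[OF Kr_subring Kr_domain subsetD[OF SStar_sp_subset sp]]
  proof (intro ballI)
    fix F x assume F: "F \<in> Fbar (Kr D)" and "x \<in> Theta_inv r F"
    then have "x \<in> module_span (kron D r) F" using Theta_inv_eq_span[OF r F] by blast
    then obtain T where T: "finite T" "T \<subseteq> F" "x \<in> module_span (kron D r) T"
      using module_span_finite_support[OF B] by blast
    obtain e where e: "e \<in> F" "e \<noteq> 0" using F by (auto simp: Fbar_iff[OF Kr_subring])
    define T' where "T' = insert e T"
    have nz: "has_nonzero T'" using e unfolding has_nonzero_def T'_def by auto
    have "T' \<subseteq> module_span (kron D r) (module_span (Kr D) T')"
      using module_span_superset[OF Kr_subring] module_span_superset[OF B] by blast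
    then have "module_span (kron D r) T' \<subseteq> module_span (kron D r) (module_span (Kr D) T')"
      by (rule module_span_least[OF B submod_module_span[OF B]])
    then have "x \<in> module_span (kron D r) (module_span (Kr D) T')"
      using T(3) module_span_mono[OF B, of T T'] unfolding T'_def by blast
    then have "x \<in> star_closure (Kr D) (Theta_inv r) T'"
      unfolding star_closure_def Theta_inv_eq_span[OF r has_nonzero_span[OF Kr_subring nz]] .
    then show "\<exists>S. finite S \<and> has_nonzero S \<and> S \<subseteq> F \<and> x \<in> star_closure (Kr D) (Theta_inv r) S"
      using T e nz unfolding T'_def by (intro exI[of _ "insert e T"]) auto
  qed
  then show ?thesis using sp unfolding SStar_f_sp_def by blast
qed

text \<open>Finite sets of constants are traded for polynomials, whose content is then available as
  a denominator.\<close>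

lemma ex_poly_coeff_set:
  assumes "finite S"
  shows "\<exists>f :: 'k poly. coeff_set f = insert 0 S"
proof -
  obtain xs where xs: "set xs = S" using finite_list[OF assms] by blast
  have "coeff_set (Poly xs) = insert 0 S"
  proof
    show "coeff_set (Poly xs) \<subseteq> insert 0 S" using xs by (auto simp: coeff_set_subset_iff nth_default_def)
    show "insert 0 S \<subseteq> coeff_set (Poly xs)"
    proof
      fix x assume "x \<in> insert 0 S"
      then consider "x = 0" | i where "i < length xs" "x = xs ! i" using xs by (auto simp: in_set_conv_nth)
      then show "x \<in> coeff_set (Poly xs)"
      proof cases
        case 1
        have "Polynomial.coeff (Poly xs) (length xs) = 0" by (simp add: nth_default_def)
        then show ?thesis using 1 by (metis coeff_in_coeff_set)
      next
        case 2
        then have "Polynomial.coeff (Poly xs) i = x" by (simp add: nth_default_def)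
        then show ?thesis by (metis coeff_in_coeff_set)
      qed
    qed
  qed
  then show ?thesis by blast
qed

text \<open>In one direction, a relation over \<open>kron D r\<close> involves finitely many elements of \<open>E\<close>, and
  a constant in the module generated by these is in their \<open>r\<close>-closure. In the other, if \<open>x\<close> is
  in the closure of a finite set \<open>S\<close> and \<open>f\<close> is a polynomial with coefficients \<open>S\<close>, then
  \<open>x = (x / f) f\<close> with \<open>x / f\<close> in \<open>kron D r\<close> and \<open>f\<close> in the module generated by \<open>E\<close>.\<close>

lemma const_mem_span_kron_iff:
  assumes r: "r \<in> SStar_f_eab D" and E: "E \<in> Fbar D"
  shows "const_rat x \<in> module_span (kron D r) (extend E) \<longleftrightarrow> x \<in> r E"
proof -
  interpret eab_semistar D r by (rule eab_semistarI[OF r])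
  note B = content_closedD(1)[OF content_closed_kron]
  have ft: "finite_type D r" and rS: "r \<in> SStar D" using r unfolding SStar_f_eab_def by auto
  have gen: "module_span (kron D r) (extend E) = module_span (kron D r) (const_rat ` E)"
  proof
    have "extend E \<subseteq> module_span (kron D r) (const_rat ` E)"
      unfolding extend_def
      by (intro module_span_least[OF Kr_subring] module_span_superset[OF B]
          submod_subring_mono[OF submod_module_span[OF B] Kr_subset_kron[OF r]])
    then show "module_span (kron D r) (extend E) \<subseteq> module_span (kron D r) (const_rat ` E)"
      by (rule module_span_least[OF B submod_module_span[OF B]])
    show "module_span (kron D r) (const_rat ` E) \<subseteq> module_span (kron D r) (extend E)"
      unfolding extend_def by (rule module_span_mono[OF B module_span_superset[OF Kr_subring]])
  qed
  note M = submodD[OF submod_module_span[OF B, of "const_rat ` E"]]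
  show ?thesis
    unfolding gen
  proof
    assume "const_rat x \<in> module_span (kron D r) (const_rat ` E)"
    then obtain T where T: "finite T" "T \<subseteq> const_rat ` E" "const_rat x \<in> module_span (kron D r) T"
      using module_span_finite_support[OF B] by blast
    obtain T' where T': "T' \<subseteq> E" "finite T'" "T = const_rat ` T'" using T(1,2) by (metis finite_subset_image)
    obtain e where e: "e \<in> E" "e \<noteq> 0" using E by (auto simp: Fbar_iff[OF D_subring])
    define S where "S = insert e T'"
    have S: "finite S" "has_nonzero S" "S \<subseteq> E" using T' e unfolding S_def has_nonzero_def by auto
    have "T \<subseteq> kron_mod D r S"
      using T'(3) const_mem_kron_mod[OF S(2)] star_closure_superset[OF S(2)] unfolding S_def by blast
    then have "const_rat x \<in> kron_mod D r S"
      using module_span_least[OF B submod_kron_mod[OF S(2)]] T(3) by blast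
    then have "x \<in> star_closure D r S" using const_mem_kron_mod_iff[OF S(1,2)] by blast
    moreover have "module_span D S \<subseteq> E"
      using E S(3) Fbar_iff[OF D_subring] by (intro module_span_least[OF D_subring]) auto
    then have "star_closure D r S \<subseteq> r E" unfolding star_closure_def by (rule SStarD(3)[OF rS has_nonzero_span[OF D_subring S(2)] E])
    ultimately show "x \<in> r E" by blast
  next
    assume "x \<in> r E"
    then obtain S where S: "finite S" "has_nonzero S" "S \<subseteq> E" "x \<in> star_closure D r S"
      using ft E unfolding finite_type_iff[OF D_subring D_quotient rS] by blast
    obtain f where f: "coeff_set f = insert 0 S" using ex_poly_coeff_set[OF S(1)] by blast
    have f0: "f \<noteq> 0" using S(2) f unfolding has_nonzero_def by (auto simp: coeff_set_def)
    have "S \<subseteq> coeff_set f" using f by blast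
    then have "x \<in> star_closure D r (coeff_set f)" using star_closure_mono[OF S(2)] S(4) by blast
    then have 1: "const_rat x / of_poly f \<in> kron D r" using const_div_mem_kron_iff[OF f0] by blast
    have 2: "of_poly f \<in> module_span (kron D r) (const_rat ` E)"
    proof (rule of_poly_mem_submod[OF content_closed_kron submod_module_span[OF B]])
      fix i
      have "Polynomial.coeff f i \<in> insert 0 S" using f by blast
      then show "const_rat (Polynomial.coeff f i) \<in> module_span (kron D r) (const_rat ` E)"
        using S(3) M(1) module_span_superset[OF B, of "const_rat ` E"] by auto
    qed
    have "(const_rat x / of_poly f) * of_poly f \<in> module_span (kron D r) (const_rat ` E)"
      by (rule M(3)[OF 1 2])
    then show "const_rat x \<in> module_span (kron D r) (const_rat ` E)" using f0 by simp
  qed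
qed

lemma Theta_Theta_inv:
  assumes r: "r \<in> SStar_f_eab D"
  shows "Theta (Theta_inv r) = r"
proof
  fix E
  have rS: "r \<in> SStar D" using r unfolding SStar_f_eab_def by auto
  show "Theta (Theta_inv r) E = r E"
  proof (cases "E \<in> Fbar D")
    case True
    then have "\<exists>e\<in>E. e \<noteq> 0" by (simp add: Fbar_iff[OF D_subring])
    then show ?thesis
      using Theta_inv_eq_span[OF r extend_mem_Fbar] const_mem_span_kron_iff[OF r True] True
      unfolding Theta_def by simp
  next
    case False
    then show ?thesis using SStarD(6)[OF rS] unfolding Theta_def by (simp add: extensional_def)
  qed
qed

text \<open>A finite subset of \<open>E Kr(D)\<close> lies in \<open>U Kr(D)\<close> for a finite \<open>U \<subseteq> E\<close>, so finite type is
  inherited; the eab property is shared by all valutative operations.\<close>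

lemma Theta_mem_SStar_f_eab:
  assumes s: "s \<in> SStar_f_sp (Kr D)"
  shows "Theta s \<in> SStar_f_eab D"
proof -
  have sp: "s \<in> SStar_sp (Kr D)" "finite_type (Kr D) s" using s unfolding SStar_f_sp_def by auto
  obtain Y where Y: "Y \<subseteq> Zar D" "s = wedge (Kr D) (gauss_ext ` Y)" using sp(1) unfolding SStar_sp_eq by blast
  have T: "Theta s = wedge D Y" using Theta_wedge[OF Y(1)] Y(2) by simp
  have TS: "Theta s \<in> SStar D" unfolding T by (rule wedge_mem_SStar[OF D_subring Y(1)])
  have sS: "s \<in> SStar (Kr D)" using sp(1) SStar_sp_subset by blast
  have "finite_type D (Theta s)"
    unfolding finite_type_iff[OF D_subring D_quotient TS]
  proof (intro ballI)
    fix E x assume E: "E \<in> Fbar D" and "x \<in> Theta s E"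
    then have x: "const_rat x \<in> s (extend E)" unfolding Theta_def by simp
    obtain e where e: "e \<in> E" "e \<noteq> 0" using E by (auto simp: Fbar_iff[OF D_subring])
    then have "extend E \<in> Fbar (Kr D)" using extend_mem_Fbar by blast
    then obtain S where S: "finite S" "has_nonzero S" "S \<subseteq> extend E" "const_rat x \<in> star_closure (Kr D) s S"
      using sp(2) x unfolding finite_type_iff[OF Kr_subring Kr_domain sS] by blast
    have "\<exists>T. finite T \<and> T \<subseteq> E \<and> y \<in> module_span (Kr D) (const_rat ` T)" if "y \<in> S" for y
    proof -
      have "y \<in> module_span (Kr D) (const_rat ` E)" using that S(3) unfolding extend_def by blast
      then obtain U where "finite U" "U \<subseteq> const_rat ` E" "y \<in> module_span (Kr D) U"
        using module_span_finite_support[OF Kr_subring] by blast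
      then show ?thesis by (metis finite_subset_image)
    qed
    then obtain T where T: "\<And>y. y \<in> S \<Longrightarrow> finite (T y) \<and> T y \<subseteq> E \<and> y \<in> module_span (Kr D) (const_rat ` T y)"
      by metis
    define U where "U = insert e (\<Union>y\<in>S. T y)"
    have U: "finite U" "has_nonzero U" "U \<subseteq> E" using T S(1) e unfolding U_def has_nonzero_def by auto
    have SU: "S \<subseteq> extend (module_span D U)"
    proof
      fix y assume y: "y \<in> S"
      have "const_rat ` T y \<subseteq> const_rat ` module_span D U"
        using module_span_superset[OF D_subring, of U] y unfolding U_def by blast
      then show "y \<in> extend (module_span D U)"
        unfolding extend_def using T[OF y] module_span_mono[OF Kr_subring] by blast
    qed
    have FU: "extend (module_span D U) \<in> Fbar (Kr D)"
      using has_nonzero_span[OF D_subring U(2)] by (intro extend_mem_Fbar) (simp add: Fbar_iff[OF D_subring])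
    have "module_span (Kr D) S \<subseteq> extend (module_span D U)"
      by (rule module_span_least[OF Kr_subring _ SU]) (simp add: extend_def submod_module_span[OF Kr_subring])
    then have "const_rat x \<in> s (extend (module_span D U))"
      using S(4) SStarD(3)[OF sS has_nonzero_span[OF Kr_subring S(2)] FU] unfolding star_closure_def by blast
    then have "x \<in> star_closure D (Theta s) U"
      unfolding star_closure_def Theta_def using has_nonzero_span[OF D_subring U(2)] by simp
    then show "\<exists>S. finite S \<and> has_nonzero S \<and> S \<subseteq> E \<and> x \<in> star_closure D (Theta s) S" using U by blast
  qed
  moreover have "eab D (Theta s)" unfolding T by (rule wedge_eab[OF D_subring Y(1)])
  ultimately show ?thesis using TS unfolding SStar_f_eab_def by blast
qed

text \<open>Both sides are spectral with the same image under \<open>\<Theta>\<close>, which is injective.\<close>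

lemma Theta_inv_Theta:
  assumes s: "s \<in> SStar_f_sp (Kr D)"
  shows "Theta_inv (Theta s) = s"
proof -
  note r = Theta_mem_SStar_f_eab[OF s]
  have "Theta_inv (Theta s) \<in> SStar_sp (Kr D)" "s \<in> SStar_sp (Kr D)"
    using Theta_inv_mem_SStar_f_sp[OF r] s unfolding SStar_f_sp_def by auto
  then show ?thesis
    using Theta_Theta_inv[OF r] bij_betw_imp_inj_on[OF bij_betw_Theta] by (meson inj_onD)
qed

text \<open>Scaling moves \<open>c\<close> to 1.\<close>

lemma openin_mem:
  assumes E: "E \<in> Fbar D"
  shows "openin (sstar_topology D) {s \<in> SStar D. c \<in> s E}"
proof (cases "c = 0")
  case True
  have "0 \<in> s E" if "s \<in> SStar D" for s
  proof -
    have "submod D (s E)" using SStarD(1)[OF that E] by (simp add: Fbar_iff[OF D_subring])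
    then show ?thesis by (rule submodD(1))
  qed
  then have "{s \<in> SStar D. c \<in> s E} = topspace (sstar_topology D)"
    unfolding topspace_sstar_topology[OF D_subring] using True by blast
  then show ?thesis by simp
next
  case False
  then have i: "inverse c \<noteq> 0" by simp
  have "c \<in> s E \<longleftrightarrow> 1 \<in> s ((\<lambda>x. inverse c * x) ` E)" if "s \<in> SStar D" for s
    unfolding SStarD(2)[OF that E i] using False by (auto simp: image_iff field_simps)
  then have "{s \<in> SStar D. c \<in> s E} = {s \<in> SStar D. 1 \<in> s ((\<lambda>x. inverse c * x) ` E)}" by blast
  then show ?thesis
    unfolding sstar_topology_def using Fbar_scale[OF D_subring E i] by (auto intro!: topology_generated_by_Basis)
qed

text \<open>Around \<open>r\<close>, write 1 as a finite sum of products of elements of \<open>F\<close> by fractions \<open>p / q\<close>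
  in \<open>kron D r\<close>. The finitely many relations \<open>c \<in> c(q)\<^sup>r\<close>, for the coefficients \<open>c\<close> of \<open>p\<close>,
  define an open set, on which the same sum is a witness.\<close>

lemma openin_mem_span_kron:
  assumes F: "F \<in> Fbar (Kr D)"
  shows "openin (subtopology (sstar_topology D) (SStar_f_eab D)) {r \<in> SStar_f_eab D. 1 \<in> module_span (kron D r) F}"
proof (subst openin_subopen, intro ballI)
  fix r assume "r \<in> {r \<in> SStar_f_eab D. 1 \<in> module_span (kron D r) F}"
  then have r: "r \<in> SStar_f_eab D" "1 \<in> module_span (kron D r) F" by auto
  have B: "unital_subring (kron D r)" if "r \<in> SStar_f_eab D" for r
    using content_closedD(1)[OF eab_semistar.content_closed_kron[OF eab_semistarI[OF that]]] .
  obtain T where T: "finite T" "T \<subseteq> F" "1 \<in> module_span (kron D r) T"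
    using module_span_finite_support[OF B[OF r(1)] r(2)] by blast
  obtain a where a: "\<forall>t\<in>T. a t \<in> kron D r" "1 = (\<Sum>t\<in>T. a t * t)"
    using module_span_finite_sum[OF B[OF r(1)] T(1,3)] by blast
  have "\<forall>t\<in>T. \<exists>p q. q \<noteq> 0 \<and> a t = of_poly p / of_poly q \<and> coeff_set p \<subseteq> star_closure D r (coeff_set q)"
    using a(1) unfolding kron_def kron_mod_def singleton_1_times by blast
  then obtain p q where pq: "\<And>t. t \<in> T \<Longrightarrow> q t \<noteq> 0 \<and> a t = of_poly (p t) / of_poly (q t) \<and> coeff_set (p t) \<subseteq> star_closure D r (coeff_set (q t))"
    by metis
  define \<U> where "\<U> = topspace (sstar_topology D) \<inter> (\<Inter>t\<in>T. \<Inter>c\<in>coeff_set (p t). {s \<in> SStar D. c \<in> s (module_span D (coeff_set (q t)))})"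
  have op: "openin (sstar_topology D) {s \<in> SStar D. c \<in> s (module_span D (coeff_set (q t)))}" if "t \<in> T" for c t
    using has_nonzero_span[OF D_subring has_nonzero_coeff_set] pq[OF that] by (intro openin_mem) blast
  have open_U: "openin (sstar_topology D) \<U>"
  proof -
    have "\<U> = topspace (sstar_topology D) \<inter> \<Inter>((\<lambda>(t, c). {s \<in> SStar D. c \<in> s (module_span D (coeff_set (q t)))}) ` (SIGMA t:T. coeff_set (p t)))"
      unfolding \<U>_def by auto
    also have "openin (sstar_topology D) \<dots>"
    proof (rule openin_Int_Inter)
      show "finite ((\<lambda>(t, c). {s \<in> SStar D. c \<in> s (module_span D (coeff_set (q t)))}) ` (SIGMA t:T. coeff_set (p t)))"
        using T(1) finite_coeff_set by blast
    qed (auto simp: op)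
    finally show ?thesis .
  qed
  have rU: "r \<in> \<U>"
    using r(1) pq unfolding \<U>_def topspace_sstar_topology[OF D_subring] SStar_f_eab_def star_closure_def by blast
  have sub: "\<U> \<inter> SStar_f_eab D \<subseteq> {r \<in> SStar_f_eab D. 1 \<in> module_span (kron D r) F}"
  proof
    fix r' assume r': "r' \<in> \<U> \<inter> SStar_f_eab D"
    then have f: "r' \<in> SStar_f_eab D" by blast
    have "a t \<in> kron D r'" if t: "t \<in> T" for t
    proof -
      have "coeff_set (p t) \<subseteq> star_closure D r' (coeff_set (q t))" using r' t unfolding \<U>_def star_closure_def by blast
      then show ?thesis
        using pq[OF t] eab_semistar.kron_modI[OF eab_semistarI[OF f]] unfolding kron_def by (simp add: singleton_1_times)
    qed
    then have "(\<Sum>t\<in>T. a t * t) \<in> module_span (kron D r') F"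
      using T(2) module_span_superset[OF B[OF f], of F]
      by (intro submod_sum[OF submod_module_span[OF B[OF f]]] submodD(3)[OF submod_module_span[OF B[OF f]]]) auto
    then show "r' \<in> {r \<in> SStar_f_eab D. 1 \<in> module_span (kron D r) F}" using f a(2) by simp
  qed
  show "\<exists>U. openin (subtopology (sstar_topology D) (SStar_f_eab D)) U \<and> r \<in> U \<and>
      U \<subseteq> {r \<in> SStar_f_eab D. 1 \<in> module_span (kron D r) F}"
    using open_U rU sub r(1) by (intro exI[of _ "\<U> \<inter> SStar_f_eab D"]) (auto simp: openin_subtopology)
qed

lemma SStar_f_subsets: "SStar_f_sp (Kr D) \<subseteq> SStar (Kr D)" "SStar_f_eab D \<subseteq> SStar D"
  using SStar_sp_subset unfolding SStar_f_sp_def SStar_f_eab_def by auto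

lemma continuous_map_Theta_inv:
  "continuous_map (subtopology (sstar_topology D) (SStar_f_eab D))
     (subtopology (sstar_topology (Kr D)) (SStar_f_sp (Kr D))) Theta_inv"
proof -
  have top: "topspace (subtopology (sstar_topology D) (SStar_f_eab D)) = SStar_f_eab D"
    using SStar_f_subsets by (auto simp: topspace_sstar_topology[OF D_subring])
  have "continuous_map (subtopology (sstar_topology D) (SStar_f_eab D)) (sstar_topology (Kr D)) Theta_inv"
  proof (rule continuous_map_into_generated[OF sstar_topology_def])
    show "Theta_inv ` topspace (subtopology (sstar_topology D) (SStar_f_eab D)) \<subseteq> topspace (sstar_topology (Kr D))"
      unfolding top using Theta_inv_mem_SStar_f_sp SStar_f_subsets(1) by (auto simp: topspace_sstar_topology[OF Kr_subring])
  next
    fix U assume "U \<in> {{s \<in> SStar (Kr D). 1 \<in> s F} |F. F \<in> Fbar (Kr D)}"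
    then obtain F where F: "F \<in> Fbar (Kr D)" "U = {s \<in> SStar (Kr D). 1 \<in> s F}" by blast
    have "Theta_inv -` U \<inter> SStar_f_eab D = {r \<in> SStar_f_eab D. 1 \<in> module_span (kron D r) F}"
      using Theta_inv_mem_SStar_f_sp SStar_f_subsets(1) Theta_inv_eq_span[OF _ F(1)] F(2) by auto
    then show "openin (subtopology (sstar_topology D) (SStar_f_eab D))
        (Theta_inv -` U \<inter> topspace (subtopology (sstar_topology D) (SStar_f_eab D)))"
      unfolding top using openin_mem_span_kron[OF F(1)] by simp
  qed
  then show ?thesis
    using Theta_inv_mem_SStar_f_sp top by (auto simp: continuous_map_in_subtopology)
qed

lemma homeomorphic_map_Theta:
  "homeomorphic_map (subtopology (sstar_topology (Kr D)) (SStar_f_sp (Kr D)))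
     (subtopology (sstar_topology D) (SStar_f_eab D)) Theta"
proof (rule homeomorphic_maps_imp_map)
  have top: "topspace (subtopology (sstar_topology D) (SStar_f_eab D)) = SStar_f_eab D"
    "topspace (subtopology (sstar_topology (Kr D)) (SStar_f_sp (Kr D))) = SStar_f_sp (Kr D)"
    using SStar_f_subsets
    by (auto simp: topspace_sstar_topology[OF D_subring] topspace_sstar_topology[OF Kr_subring])
  show "homeomorphic_maps (subtopology (sstar_topology (Kr D)) (SStar_f_sp (Kr D)))
     (subtopology (sstar_topology D) (SStar_f_eab D)) Theta Theta_inv"
    unfolding homeomorphic_maps_def top
    using continuous_map_Theta[OF SStar_f_subsets(1) _ SStar_f_subsets(2)] Theta_mem_SStar_f_eab
      continuous_map_Theta_inv Theta_inv_Theta Theta_Theta_inv by blast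
qed

end

section \<open>Polynomials in arbitrarily many variables, graded by a set of variables\<close>

text \<open>With coefficients in the field with two elements a polynomial is just a finite set of
  monomials. This keeps its encoding by sets simple.\<close>

type_synonym 'i mpoly2 = "('i \<Rightarrow>\<^sub>0 nat) \<Rightarrow>\<^sub>0 bit"

text \<open>The degree in the variables outside \<open>F\<close>.\<close>

definition weight :: "'i set \<Rightarrow> ('i \<Rightarrow>\<^sub>0 nat) \<Rightarrow> nat" where
  "weight F m = (\<Sum>i\<in>Poly_Mapping.keys m - F. Poly_Mapping.lookup m i)"

lemma weight_eq:
  assumes "finite A" "Poly_Mapping.keys m \<subseteq> A"
  shows "weight F m = (\<Sum>i\<in>A - F. Poly_Mapping.lookup m i)"
  unfolding weight_def
  by (rule sum.mono_neutral_left) (use assms in \<open>auto simp: in_keys_iff\<close>)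

lemma weight_add: "weight F (m + m') = weight F m + weight F m'"
proof -
  let ?A = "Poly_Mapping.keys m \<union> Poly_Mapping.keys m'"
  have "weight F (m + m') = (\<Sum>i\<in>?A - F. Poly_Mapping.lookup (m + m') i)"
    by (rule weight_eq[OF _ Poly_Mapping.keys_add]) simp
  also have "\<dots> = (\<Sum>i\<in>?A - F. Poly_Mapping.lookup m i) + (\<Sum>i\<in>?A - F. Poly_Mapping.lookup m' i)"
    by (simp add: lookup_add sum.distrib)
  also have "\<dots> = weight F m + weight F m'"
    using weight_eq[of ?A m F] weight_eq[of ?A m' F] by simp
  finally show ?thesis .
qed

lemma weight_0 [simp]: "weight F 0 = 0"
  by (simp add: weight_def)

lemma weight_single: "weight F (Poly_Mapping.single i n) = (if i \<in> F then 0 else n)"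
  by (simp add: weight_def insert_Diff_if)

lemma weight_UNIV [simp]: "weight UNIV m = 0"
  by (simp add: weight_def)

lemma weight_Int: "Poly_Mapping.keys m \<subseteq> A \<Longrightarrow> weight (F \<inter> A) m = weight F m"
  unfolding weight_def by (rule sum.cong) auto

lift_definition graded_part :: "'i set \<Rightarrow> nat \<Rightarrow> 'i mpoly2 \<Rightarrow> 'i mpoly2" is
  "\<lambda>F n p m. p m when weight F m = n"
  by (rule finite_subset) (auto simp: when_def split: if_splits)

lemma graded_part_add: "graded_part F n (p + q) = graded_part F n p + graded_part F n q"
  by transfer (auto simp: when_def fun_eq_iff)

lemma graded_part_0 [simp]: "graded_part F n 0 = 0"
  by transfer auto

lemma graded_part_single: "graded_part F n (Poly_Mapping.single m c) = (if weight F m = n then Poly_Mapping.single m c else 0)"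
  by transfer (auto simp: when_def fun_eq_iff)

lemma lookup_graded_part: "Poly_Mapping.lookup (graded_part F n p) m = (if weight F m = n then Poly_Mapping.lookup p m else 0)"
  by transfer (auto simp: when_def)

lemma poly_mapping_sum_single: "p = (\<Sum>m\<in>Poly_Mapping.keys p. Poly_Mapping.single m (Poly_Mapping.lookup p m))"
proof (rule poly_mapping_eqI)
  fix k
  have "Poly_Mapping.lookup (\<Sum>m\<in>Poly_Mapping.keys p. Poly_Mapping.single m (Poly_Mapping.lookup p m)) k =
    (\<Sum>m\<in>Poly_Mapping.keys p. if m = k then Poly_Mapping.lookup p m else 0)"
    unfolding lookup_sum by (intro sum.cong) (auto simp: lookup_single when_def)
  also have "\<dots> = Poly_Mapping.lookup p k" by (simp add: in_keys_iff)
  finally show "Poly_Mapping.lookup p k =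
    Poly_Mapping.lookup (\<Sum>m\<in>Poly_Mapping.keys p. Poly_Mapping.single m (Poly_Mapping.lookup p m)) k" ..
qed

text \<open>The substitution of \<open>z t\<^sub>i\<close> for \<open>t\<^sub>i\<close>, for all \<open>i\<close> outside \<open>F\<close>, read as a power series
  in the new variable \<open>z\<close>. It is an embedding of rings, and setting \<open>z = 0\<close> kills the
  variables outside \<open>F\<close>. The coefficients are taken in the fraction field, in order to have
  division of power series.\<close>

definition expand :: "'i::linorder set \<Rightarrow> 'i mpoly2 \<Rightarrow> 'i mpoly2 fract fps" where
  "expand F p = Abs_fps (\<lambda>n. to_fract (graded_part F n p))"

lemma expand_add: "expand F (p + q) = expand F p + expand F q"
  by (rule fps_ext) (simp add: expand_def graded_part_add)

lemma expand_0 [simp]: "expand F 0 = 0"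
  by (rule fps_ext) (simp add: expand_def)

lemma expand_sum: "expand F (sum f I) = (\<Sum>i\<in>I. expand F (f i))"
  by (induction I rule: infinite_finite_induct) (auto simp: expand_add)

lemma expand_single:
  "expand F (Poly_Mapping.single m c) = fps_const (to_fract (Poly_Mapping.single m c)) * fps_X ^ weight F m"
  by (rule fps_ext) (simp add: expand_def graded_part_single fps_X_power_iff)

lemma expand_mult: "expand F (p * q) = expand F p * expand F q"
proof -
  let ?s = "\<lambda>p m. Poly_Mapping.single m (Poly_Mapping.lookup p m)"
  have 1: "expand F (Poly_Mapping.single m c * Poly_Mapping.single m' c') =
      expand F (Poly_Mapping.single m c) * expand F (Poly_Mapping.single m' c')" for m m' c c'
  proof -
    have "to_fract (Poly_Mapping.single (m + m') (c * c')) =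
        to_fract (Poly_Mapping.single m c) * to_fract (Poly_Mapping.single m' c')"
      by (simp only: mult_single to_fract_mult[symmetric])
    then show ?thesis
      unfolding mult_single expand_single weight_add power_add
      by (simp only: fps_const_mult[symmetric] mult_ac)
  qed
  have "p * q = (\<Sum>m\<in>Poly_Mapping.keys p. \<Sum>m'\<in>Poly_Mapping.keys q. ?s p m * ?s q m')"
    by (subst poly_mapping_sum_single[of p], subst poly_mapping_sum_single[of q]) (rule sum_product)
  then have "expand F (p * q) = (\<Sum>m\<in>Poly_Mapping.keys p. \<Sum>m'\<in>Poly_Mapping.keys q. expand F (?s p m) * expand F (?s q m'))"
    by (simp only: expand_sum 1)
  also have "\<dots> = (\<Sum>m\<in>Poly_Mapping.keys p. expand F (?s p m)) * (\<Sum>m'\<in>Poly_Mapping.keys q. expand F (?s q m'))"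
    by (rule sum_product[symmetric])
  also have "\<dots> = expand F p * expand F q"
    by (simp only: expand_sum[symmetric] poly_mapping_sum_single[symmetric])
  finally show ?thesis .
qed

lemma expand_eq_0_iff [simp]: "expand F p = 0 \<longleftrightarrow> p = 0"
proof
  assume *: "expand F p = 0"
  show "p = 0"
  proof (rule poly_mapping_eqI)
    fix m
    have "to_fract (graded_part F (weight F m) p) = 0" using arg_cong[OF *, of "\<lambda>a. fps_nth a (weight F m)"] by (simp add: expand_def)
    then have "graded_part F (weight F m) p = 0" by simp
    then show "Poly_Mapping.lookup p m = Poly_Mapping.lookup 0 m" using lookup_graded_part[of F "weight F m" p m] by simp
  qed
qed simp

lemma expand_UNIV: "expand UNIV p = fps_const (to_fract p)"
proof -
  have "graded_part UNIV n p = (if n = 0 then p else 0)" for n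
    by (rule poly_mapping_eqI) (simp add: lookup_graded_part)
  then show ?thesis by (intro fps_ext) (simp add: expand_def)
qed

definition variables :: "'i mpoly2 \<Rightarrow> 'i set" where
  "variables p = (\<Union>m\<in>Poly_Mapping.keys p. Poly_Mapping.keys m)"

lemma finite_variables: "finite (variables p)"
  by (simp add: variables_def)

text \<open>Variables that do not occur in \<open>p\<close> do not matter.\<close>

lemma expand_Int:
  assumes "variables p \<subseteq> A"
  shows "expand (F \<inter> A) p = expand F p"
proof -
  have "graded_part (F \<inter> A) n p = graded_part F n p" for n
  proof (rule poly_mapping_eqI)
    fix m
    show "Poly_Mapping.lookup (graded_part (F \<inter> A) n p) m = Poly_Mapping.lookup (graded_part F n p) m"
    proof (cases "m \<in> Poly_Mapping.keys p")
      case True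
      then have "weight (F \<inter> A) m = weight F m" using assms by (intro weight_Int) (auto simp: variables_def)
      then show ?thesis by (simp add: lookup_graded_part)
    next
      case False
      then show ?thesis by (simp add: lookup_graded_part in_keys_iff)
    qed
  qed
  then show ?thesis by (simp add: expand_def)
qed

text \<open>The order in \<open>z\<close> is at most the total degree, whatever \<open>F\<close> is.\<close>

lemma ex_subdegree_expand_bound: "\<exists>N. \<forall>F. subdegree (expand F p) < N"
proof (cases "p = 0")
  case True then show ?thesis by (intro exI[of _ 1]) simp
next
  case False
  then obtain m where m: "m \<in> Poly_Mapping.keys p" using Poly_Mapping.keys_eq_empty[of p] by blast
  have "subdegree (expand F p) \<le> weight {} m" for F
  proof -
    have "Poly_Mapping.lookup (graded_part F (weight F m) p) m \<noteq> 0" using m by (simp add: lookup_graded_part in_keys_iff)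
    then have "graded_part F (weight F m) p \<noteq> 0" by auto
    then have "fps_nth (expand F p) (weight F m) \<noteq> 0" by (simp add: expand_def)
    then have "subdegree (expand F p) \<le> weight F m" by (rule subdegree_leI)
    also have "\<dots> \<le> weight {} m" unfolding weight_def by (intro sum_mono2) auto
    finally show ?thesis .
  qed
  then show ?thesis by (intro exI[of _ "Suc (weight {} m)"]) (simp add: less_Suc_eq_le)
qed

section \<open>Specialization of rational functions\<close>

text \<open>The expansion of the rational function \<open>h\<close>, in case it has no pole along \<open>z = 0\<close>. The
  value is characterized by an equation instead of a quotient, so that it extends the
  expansion of polynomials without Laurent series.\<close>

definition series :: "'i::linorder set \<Rightarrow> 'i mpoly2 fract \<Rightarrow> 'i mpoly2 fract fps \<Rightarrow> bool" where
  "series F h a \<longleftrightarrow> (\<exists>p q. q \<noteq> 0 \<and> h = to_fract p / to_fract q \<and> expand F p = a * expand F q)"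

lemma mfraction_cases:
  obtains p q where "q \<noteq> 0" "(h :: 'i::linorder mpoly2 fract) = to_fract p / to_fract q"
proof (cases h)
  case (Fract a b)
  then show ?thesis using that[of b a] by (simp add: Fract_conv_to_fract)
qed

lemma series_fraction_iff:
  fixes p q :: "'i::linorder mpoly2"
  assumes q: "q \<noteq> 0"
  shows "series F (to_fract p / to_fract q) a \<longleftrightarrow> expand F p = a * expand F q"
proof
  assume "series F (to_fract p / to_fract q) a"
  then obtain p' q' where q': "q' \<noteq> 0" "to_fract p / to_fract q = to_fract p' / to_fract q'"
    "expand F p' = a * expand F q'" unfolding series_def by blast
  then have "to_fract (p * q') = to_fract (p' * q)" using q by (simp add: frac_eq_eq)
  then have "p * q' = p' * q" by (simp only: to_fract_eq_iff)
  then have "expand F p * expand F q' = expand F p' * expand F q" by (metis expand_mult)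
  then have "expand F p * expand F q' = a * expand F q' * expand F q" using q'(3) by simp
  then have "(expand F p - a * expand F q) * expand F q' = 0" by (simp add: algebra_simps)
  then show "expand F p = a * expand F q" using q'(1) by simp
qed (use q in \<open>auto simp: series_def\<close>)

lemma series_unique: "series F h a \<Longrightarrow> series F h b \<Longrightarrow> a = b"
proof -
  assume *: "series F h a" "series F h b"
  obtain p q where pq: "q \<noteq> 0" "h = to_fract p / to_fract q" by (rule mfraction_cases)
  have e: "expand F p = a * expand F q" "expand F p = b * expand F q"
    using * unfolding pq(2) series_fraction_iff[OF pq(1)] .
  have "a * expand F q = b * expand F q" by (rule trans[OF e(1)[symmetric] e(2)])
  then have "(a - b) * expand F q = 0" by (simp add: algebra_simps)
  then show "a = b" using pq(1) by simp
qed

lemma series_add: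
  assumes "series F h a" "series F h' b"
  shows "series F (h + h') (a + b)"
proof -
  obtain p q where pq: "q \<noteq> 0" "h = to_fract p / to_fract q" "expand F p = a * expand F q"
    using assms(1) unfolding series_def by blast
  obtain u v where uv: "v \<noteq> 0" "h' = to_fract u / to_fract v" "expand F u = b * expand F v"
    using assms(2) unfolding series_def by blast
  have "h + h' = to_fract (p * v + u * q) / to_fract (q * v)" using pq uv by (simp add: add_frac_eq)
  moreover have "expand F (p * v + u * q) = (a + b) * expand F (q * v)"
    by (simp add: expand_add expand_mult pq(3) uv(3) algebra_simps)
  ultimately show ?thesis unfolding series_def using pq(1) uv(1) by (intro exI[of _ "p * v + u * q"] exI[of _ "q * v"]) simp
qed

lemma series_mult:
  assumes "series F h a" "series F h' b"
  shows "series F (h * h') (a * b)"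
proof -
  obtain p q where pq: "q \<noteq> 0" "h = to_fract p / to_fract q" "expand F p = a * expand F q"
    using assms(1) unfolding series_def by blast
  obtain u v where uv: "v \<noteq> 0" "h' = to_fract u / to_fract v" "expand F u = b * expand F v"
    using assms(2) unfolding series_def by blast
  have "h * h' = to_fract (p * u) / to_fract (q * v)" using pq uv by simp
  moreover have "expand F (p * u) = (a * b) * expand F (q * v)"
    by (simp add: expand_mult pq(3) uv(3) mult_ac)
  ultimately show ?thesis unfolding series_def using pq(1) uv(1) by (intro exI[of _ "p * u"] exI[of _ "q * v"]) simp
qed

lemma series_poly: "series F (to_fract p) (expand F p)"
proof -
  have "expand F (1 :: 'a mpoly2) = 1"
    using expand_single[of F 0 1] by (simp add: single_one)
  then show ?thesis unfolding series_def by (intro exI[of _ p] exI[of _ 1]) simp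
qed

lemma series_0: "series F 0 0" and series_1: "series F 1 1"
proof -
  have "expand F (1 :: 'a mpoly2) = 1"
    using expand_single[of F 0 1] by (simp add: single_one)
  then show "series F 0 0" "series F 1 1" using series_poly[of F 0] series_poly[of F 1] by simp_all
qed

lemma series_uminus: "series F h a \<Longrightarrow> series F (- h) (- a)"
proof -
  have "expand F (1 + - 1 :: 'a mpoly2) = expand F 1 + expand F (- 1)" by (rule expand_add)
  moreover have "expand F (1 :: 'a mpoly2) = 1"
    using expand_single[of F 0 1] by (simp add: single_one)
  ultimately have "expand F (- 1 :: 'a mpoly2) = - 1" by (simp add: add_eq_0_iff)
  then have "series F (- 1) (- 1)" using series_poly[of F "- 1"] by simp
  then show "series F h a \<Longrightarrow> series F (- h) (- a)" using series_mult[of F "- 1" "- 1" h a] by simp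
qed

lemma series_divide:
  assumes "series F h (d * a)" "series F g a" "g \<noteq> 0"
  shows "series F (h / g) d"
proof -
  obtain p q where pq: "q \<noteq> 0" "h = to_fract p / to_fract q" "expand F p = (d * a) * expand F q"
    using assms(1) unfolding series_def by blast
  obtain u v where uv: "v \<noteq> 0" "g = to_fract u / to_fract v" "expand F u = a * expand F v"
    using assms(2) unfolding series_def by blast
  have u: "u \<noteq> 0" using assms(3) uv by auto
  have "h / g = to_fract (p * v) / to_fract (q * u)" using pq uv by simp
  moreover have "expand F (p * v) = d * expand F (q * u)"
    by (simp add: expand_mult pq(3) uv(3) mult_ac)
  ultimately show ?thesis unfolding series_def using pq(1) u by (intro exI[of _ "p * v"] exI[of _ "q * u"]) simp
qed

lemma series_eq_0: "series F h 0 \<Longrightarrow> h = 0"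
  unfolding series_def by auto

text \<open>The value of \<open>h\<close> at \<open>z = 0\<close>, that is, the result of letting the variables outside \<open>F\<close>
  tend to zero simultaneously. It is a relation, since \<open>h\<close> may have a pole.\<close>

definition specializes :: "'i::linorder set \<Rightarrow> 'i mpoly2 fract \<Rightarrow> 'i mpoly2 fract \<Rightarrow> bool" where
  "specializes F h u \<longleftrightarrow> (\<exists>a. series F h a \<and> fps_nth a 0 = u)"

lemma specializes_unique: "specializes F h u \<Longrightarrow> specializes F h v \<Longrightarrow> u = v"
  unfolding specializes_def using series_unique by blast

lemma specializes_add: "specializes F h u \<Longrightarrow> specializes F h' u' \<Longrightarrow> specializes F (h + h') (u + u')"
  unfolding specializes_def using series_add by (metis fps_add_nth)

lemma specializes_mult: "specializes F h u \<Longrightarrow> specializes F h' u' \<Longrightarrow> specializes F (h * h') (u * u')"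
  unfolding specializes_def using series_mult by (metis fps_mult_nth_0)

lemma specializes_uminus: "specializes F h u \<Longrightarrow> specializes F (- h) (- u)"
  unfolding specializes_def using series_uminus by (metis fps_neg_nth)

lemma specializes_diff: "specializes F h u \<Longrightarrow> specializes F h' u' \<Longrightarrow> specializes F (h - h') (u - u')"
  using specializes_add[of F h u "- h'" "- u'"] specializes_uminus by auto

lemma specializes_0: "specializes F 0 0" and specializes_1: "specializes F 1 1"
  unfolding specializes_def using series_0 series_1 by (metis fps_zero_nth, metis fps_one_nth)

lemma specializes_sum:
  "(\<And>i. i \<in> I \<Longrightarrow> specializes F (f i) (g i)) \<Longrightarrow> specializes F (sum f I) (sum g I)"
  by (induction I rule: infinite_finite_induct) (auto simp: specializes_0 specializes_add)

lemma specializes_prod: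
  "(\<And>i. i \<in> I \<Longrightarrow> specializes F (f i) (g i)) \<Longrightarrow> specializes F (prod f I) (prod g I)"
  by (induction I rule: infinite_finite_induct) (auto simp: specializes_1 specializes_mult)

lemma specializes_UNIV: "specializes UNIV h h"
proof -
  obtain p q where pq: "q \<noteq> 0" "h = to_fract p / to_fract q" by (rule mfraction_cases)
  have "expand UNIV p = fps_const h * expand UNIV q" using pq by (simp add: expand_UNIV)
  then have "series UNIV h (fps_const h)" unfolding series_def using pq by blast
  then show ?thesis unfolding specializes_def by (intro exI[of _ "fps_const h"]) simp
qed

text \<open>Only the variables of a numerator and a denominator matter. So each rational function
  has just finitely many specializations.\<close>

lemma ex_finite_variables:
  "\<exists>A. finite A \<and> (\<forall>F u. specializes (F \<inter> A) h u \<longleftrightarrow> specializes F h u)"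
proof -
  obtain p q where pq: "q \<noteq> 0" "h = to_fract p / to_fract q" by (rule mfraction_cases)
  let ?A = "variables p \<union> variables q"
  have "expand (F \<inter> ?A) p = expand F p" "expand (F \<inter> ?A) q = expand F q" for F
    by (rule expand_Int, simp)+
  then have "series (F \<inter> ?A) h a \<longleftrightarrow> series F h a" for F a
    unfolding pq(2) series_fraction_iff[OF pq(1)] by simp
  then show ?thesis unfolding specializes_def by (intro exI[of _ ?A]) (simp add: finite_variables)
qed

text \<open>The order of the expansion of a quotient is at most that of the numerator.\<close>

lemma ex_subdegree_bound:
  assumes "g \<noteq> 0"
  shows "\<exists>N. \<forall>F a. series F g a \<longrightarrow> subdegree a < N"
proof -
  obtain p q where pq: "q \<noteq> 0" "g = to_fract p / to_fract q" by (rule mfraction_cases)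
  obtain N where N: "\<And>F. subdegree (expand F p) < N" using ex_subdegree_expand_bound by blast
  have p: "p \<noteq> 0" using assms pq by auto
  have "subdegree a < N" if "series F g a" for F a
  proof -
    have eq: "expand F p = a * expand F q" using that unfolding pq(2) series_fraction_iff[OF pq(1)] .
    then have "a \<noteq> 0" using p by auto
    then have "subdegree (expand F p) = subdegree a + subdegree (expand F q)" using eq pq(1) by simp
    then show ?thesis using N[of F] by simp
  qed
  then show ?thesis by blast
qed

text \<open>If the value \<open>v\<close> of \<open>g\<close> is nonzero, the expansion of \<open>g\<close> is invertible. Otherwise the
  value of \<open>h\<close> is zero as well, so the expansion of \<open>h ^ N\<close> has order at least \<open>N\<close>, which
  exceeds the order of \<open>g\<close>; the quotient is then a power series without constant term, in
  accordance with the convention \<open>x / 0 = 0\<close>.\<close>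

lemma specializes_divide:
  assumes h: "specializes F h u" and g: "specializes F g v" and uv: "v = 0 \<Longrightarrow> u = 0"
    and N: "0 < N" "\<And>a. g \<noteq> 0 \<Longrightarrow> series F g a \<Longrightarrow> subdegree a < N"
  shows "specializes F (h ^ N / g) (u ^ N / v)"
proof (cases "g = 0")
  case True
  then have "v = 0" using specializes_unique[OF g] specializes_0 by blast
  then show ?thesis using True specializes_0 by simp
next
  case False
  obtain a where a: "series F g a" "fps_nth a 0 = v" using g unfolding specializes_def by blast
  obtain b where b: "series F h b" "fps_nth b 0 = u" using h unfolding specializes_def by blast
  have bN: "series F (h ^ n) (b ^ n)" for n
    by (induction n) (auto simp: series_1 intro: series_mult b)
  have a0: "a \<noteq> 0" using a False series_eq_0 by blast
  have dvd: "a dvd b ^ N"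
  proof (cases "b = 0")
    case True then show ?thesis using N(1) by (simp add: zero_power)
  next
    case b0: False
    show ?thesis
    proof (cases "v = 0")
      case True
      then have "subdegree b > 0" using uv b b0 subdegree_eq_0_iff[of b] by auto
      then have "N \<le> subdegree (b ^ N)" using N(1) by simp
      then have "subdegree a \<le> subdegree (b ^ N)" using N(2)[OF False a(1)] by linarith
      then show ?thesis using a0 b0 by (subst fps_dvd_iff) auto
    next
      case v: False
      then have "subdegree a = 0" using a by (simp add: subdegree_eq_0_iff)
      then show ?thesis using a0 b0 by (simp add: fps_dvd_iff)
    qed
  qed
  then obtain d where d: "b ^ N = d * a" by (metis dvdE mult.commute)
  have "series F (h ^ N / g) d" by (rule series_divide[OF _ a(1) False]) (use bN[of N] d in simp)
  moreover have "fps_nth d 0 = u ^ N / v"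
  proof (cases "v = 0")
    case False
    have "fps_nth (b ^ N) 0 = fps_nth d 0 * v" using d a(2) by simp
    then have "u ^ N = fps_nth d 0 * v" using b(2) by (simp add: fps_power_zeroth)
    then show ?thesis using False by simp
  next
    case True
    have "fps_nth d 0 = 0"
    proof (cases "b = 0")
      case True
      then have "d * a = 0" using d N(1) by (simp add: zero_power)
      then show ?thesis using a0 by simp
    next
      case b0: False
      then have d0: "d \<noteq> 0" using d by auto
      have "subdegree b > 0" using True uv b b0 subdegree_eq_0_iff[of b] by auto
      then have "N \<le> subdegree (b ^ N)" by simp
      also have "\<dots> = subdegree d + subdegree a" using d d0 a0 by simp
      finally have "subdegree d > 0" using N(2)[OF False a(1)] by simp
      then show ?thesis by (rule nth_less_subdegree_zero)
    qed
    then show ?thesis using True by simp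
  qed
  ultimately show ?thesis unfolding specializes_def by blast
qed

section \<open>The space of models of a Horn theory is spectral\<close>

text \<open>A pair \<open>(T, i)\<close> is the Horn clause whose premises are the atoms in \<open>T\<close> and whose
  conclusion is \<open>i\<close>.\<close>

definition models :: "('i set \<times> 'i) set \<Rightarrow> 'i set set" where
  "models H = {F. \<forall>(T, i)\<in>H. T \<subseteq> F \<longrightarrow> i \<in> F}"

text \<open>The whole set is adjoined to the subbasis, since the empty set may be a model, and it is
  in no other subbasic set.\<close>

definition models_topology :: "('i set \<times> 'i) set \<Rightarrow> 'i set topology" where
  "models_topology H = topology_generated_by (insert (models H) {{F \<in> models H. i \<in> F} | i. True})"

lemma topspace_models_topology: "topspace (models_topology H) = models H"
  unfolding models_topology_def topology_generated_by_topspace by blast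

text \<open>An arbitrary value if there is a pole.\<close>

definition specialization :: "'i::linorder set \<Rightarrow> 'i mpoly2 fract \<Rightarrow> 'i mpoly2 fract" where
  "specialization F h = (THE u. specializes F h u)"

lemma specialization_eq: "specializes F h u \<Longrightarrow> specialization F h = u"
  unfolding specialization_def using specializes_unique by blast

definition var :: "'i::linorder \<Rightarrow> 'i mpoly2 fract" where
  "var i = to_fract (Poly_Mapping.single (Poly_Mapping.single i 1) 1)"

lemma specializes_var: "specializes F (var i) (if i \<in> F then var i else 0)"
proof -
  have "series F (var i) (fps_const (var i) * fps_X ^ (if i \<in> F then 0 else 1))"
    using series_poly[of F "Poly_Mapping.single (Poly_Mapping.single i 1) 1"]
    unfolding expand_single weight_single var_def .
  then show ?thesis
    unfolding specializes_def by (intro exI[of _ "fps_const (var i) * fps_X ^ (if i \<in> F then 0 else 1)"]) auto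
qed

lemma prod_var: "prod var T = to_fract (Poly_Mapping.single (\<Sum>i\<in>T. Poly_Mapping.single i 1) 1)"
proof (induction T rule: infinite_finite_induct)
  case (insert x T)
  then show ?case by (simp add: var_def mult_single flip: to_fract_mult)
qed auto

lemma specializes_prod_var:
  assumes "finite T"
  shows "specializes F (prod var T) (if T \<subseteq> F then prod var T else 0)"
proof -
  have "specializes F (prod var T) (\<Prod>i\<in>T. if i \<in> F then var i else 0)"
    by (intro specializes_prod specializes_var)
  also have "(\<Prod>i\<in>T. if i \<in> F then var i else 0) = (if T \<subseteq> F then prod var T else 0)"
  proof (cases "T \<subseteq> F")
    case True
    then show ?thesis by (auto intro!: prod.cong)
  next
    case False
    then show ?thesis using assms by (auto intro!: prod_zero)
  qed
  finally show ?thesis .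
qed

text \<open>Distinct squarefree monomials are linearly independent.\<close>

lemma sum_prod_var_eq_0_iff:
  assumes \<T>: "finite \<T>" "\<And>T. T \<in> \<T> \<Longrightarrow> finite T"
  shows "(\<Sum>T\<in>\<T>. prod var T) = (0 :: 'i::linorder mpoly2 fract) \<longleftrightarrow> \<T> = {}"
proof
  assume *: "(\<Sum>T\<in>\<T>. prod var T) = (0 :: 'i mpoly2 fract)"
  let ?m = "\<lambda>T :: 'i set. \<Sum>i\<in>T. Poly_Mapping.single i (1 :: nat)"
  have keys: "Poly_Mapping.lookup (?m T) i = (if i \<in> T then 1 else 0)" if "finite T" for T i
    using that by (simp add: lookup_sum lookup_single when_def)
  have inj: "T = T'" if "T \<in> \<T>" "T' \<in> \<T>" "?m T = ?m T'" for T T'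
  proof -
    have "(if i \<in> T then 1 else 0 :: nat) = (if i \<in> T' then 1 else 0)" for i
      using that(3) keys[OF \<T>(2)[OF that(1)], of i] keys[OF \<T>(2)[OF that(2)], of i] by metis
    then have "(i \<in> T) = (i \<in> T')" for i by (metis zero_neq_one)
    then show ?thesis by blast
  qed
  have "to_fract (\<Sum>T\<in>\<T>. Poly_Mapping.single (?m T) (1 :: bit)) = 0"
    using * by (simp add: prod_var)
  then have z: "(\<Sum>T\<in>\<T>. Poly_Mapping.single (?m T) (1 :: bit)) = 0" by (simp only: to_fract_eq_0_iff)
  show "\<T> = {}"
  proof (rule ccontr)
    assume "\<T> \<noteq> {}"
    then obtain T0 where T0: "T0 \<in> \<T>" by blast
    have "(0 :: bit) = Poly_Mapping.lookup (\<Sum>T\<in>\<T>. Poly_Mapping.single (?m T) (1 :: bit)) (?m T0)"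
      using z by simp
    also have "\<dots> = (\<Sum>T\<in>\<T>. if T = T0 then 1 else 0)"
      unfolding lookup_sum using inj[OF _ T0] by (intro sum.cong) (auto simp: lookup_single when_def)
    also have "\<dots> = 1" using T0 \<T>(1) by simp
    finally show False by simp
  qed
qed simp

locale horn =
  fixes H :: "('i::linorder set \<times> 'i) set"
  assumes finite_premises: "(T, i) \<in> H \<Longrightarrow> finite T"
begin

text \<open>The values at two comparable models are linked: the value at the smaller one is obtained
  by specializing further. This is what forces nonvanishing to be inherited by larger models,
  as it has to be in a space where \<open>F\<close> specializes to \<open>G\<close> for \<open>G \<subseteq> F\<close>.\<close>

definition specializing_ring :: "'i mpoly2 fract set" where
  "specializing_ring = {h. (\<forall>F\<in>models H. specializes F h (specialization F h)) \<and>
     (\<forall>F\<in>models H. \<forall>G\<in>models H. G \<subseteq> F \<longrightarrow> specializes G (specialization F h) (specialization G h))}"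

lemma UNIV_model: "UNIV \<in> models H"
  by (auto simp: models_def)

text \<open>The smallest model that contains \<open>T\<close>.\<close>

definition model_hull :: "'i set \<Rightarrow> 'i set" where
  "model_hull T = \<Inter>{F \<in> models H. T \<subseteq> F}"

lemma model_hull_model: "model_hull T \<in> models H"
  unfolding models_def model_hull_def by blast

lemma model_hull_superset: "T \<subseteq> model_hull T"
  unfolding model_hull_def by blast

lemma model_hull_least: "F \<in> models H \<Longrightarrow> T \<subseteq> F \<Longrightarrow> model_hull T \<subseteq> F"
  unfolding model_hull_def by blast

lemma specializing_ringD:
  assumes "h \<in> specializing_ring"
  shows "F \<in> models H \<Longrightarrow> specializes F h (specialization F h)"
    "F \<in> models H \<Longrightarrow> G \<in> models H \<Longrightarrow> G \<subseteq> F \<Longrightarrow> specializes G (specialization F h) (specialization G h)"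
  using assms unfolding specializing_ring_def by auto

lemma specializing_ringI:
  assumes "\<And>F. F \<in> models H \<Longrightarrow> specializes F h (\<rho> F)"
    "\<And>F G. F \<in> models H \<Longrightarrow> G \<in> models H \<Longrightarrow> G \<subseteq> F \<Longrightarrow> specializes G (\<rho> F) (\<rho> G)"
  shows "h \<in> specializing_ring"
  using assms specialization_eq[OF assms(1)] unfolding specializing_ring_def by simp

lemma specialization_UNIV: "specialization UNIV h = h"
  by (rule specialization_eq[OF specializes_UNIV])

lemma specialization_simps:
  assumes "F \<in> models H" "g \<in> specializing_ring" "h \<in> specializing_ring"
  shows "specialization F (g + h) = specialization F g + specialization F h" "specialization F (g - h) = specialization F g - specialization F h" "specialization F (g * h) = specialization F g * specialization F h"
proof -
  have s: "specializes F g (specialization F g)" "specializes F h (specialization F h)" using assms specializing_ringD(1) by auto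
  show "specialization F (g + h) = specialization F g + specialization F h" by (rule specialization_eq[OF specializes_add[OF s]])
  show "specialization F (g - h) = specialization F g - specialization F h" by (rule specialization_eq[OF specializes_diff[OF s]])
  show "specialization F (g * h) = specialization F g * specialization F h" by (rule specialization_eq[OF specializes_mult[OF s]])
qed

lemma unital_subring_specializing_ring: "unital_subring specializing_ring"
  unfolding unital_subring_def
proof (intro conjI ballI)
  show "1 \<in> specializing_ring" by (rule specializing_ringI[of _ "\<lambda>_. 1"]) (rule specializes_1)+
  fix x y assume xy: "x \<in> specializing_ring" "y \<in> specializing_ring"
  show "x - y \<in> specializing_ring"
    by (rule specializing_ringI[of _ "\<lambda>F. specialization F x - specialization F y"])
      (auto intro!: specializes_diff specializing_ringD[OF xy(1)] specializing_ringD[OF xy(2)])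
  show "x * y \<in> specializing_ring"
    by (rule specializing_ringI[of _ "\<lambda>F. specialization F x * specialization F y"])
      (auto intro!: specializes_mult specializing_ringD[OF xy(1)] specializing_ringD[OF xy(2)])
qed

lemma prod_var_mem: "finite T \<Longrightarrow> prod var T \<in> specializing_ring"
proof (rule specializing_ringI[of _ "\<lambda>F. if T \<subseteq> F then prod var T else 0"])
  fix F G :: "'i set" assume "finite T" "G \<subseteq> F"
  then show "specializes G (if T \<subseteq> F then prod var T else 0) (if T \<subseteq> G then prod var T else 0)"
    using specializes_prod_var[of T G] specializes_0 by (auto split: if_splits)
qed (rule specializes_prod_var)

lemma specialization_prod_var: "finite T \<Longrightarrow> specialization F (prod var T) = (if T \<subseteq> F then prod var T else 0)"
  by (rule specialization_eq[OF specializes_prod_var])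

lemma prod_var_nonzero: "finite T \<Longrightarrow> prod var T \<noteq> (0 :: 'i mpoly2 fract)"
  using sum_prod_var_eq_0_iff[of "{T}"] by simp

lemma var_mem: "var i \<in> specializing_ring" and specialization_var: "specialization F (var i) = (if i \<in> F then var i else 0)" and var_nonzero: "var i \<noteq> (0 :: 'i mpoly2 fract)"
  using prod_var_mem[of "{i}"] specialization_prod_var[of "{i}" F] prod_var_nonzero[of "{i}"] by auto

text \<open>There is one value for each set of relevant variables.\<close>

lemma finite_specialization: "finite (range (\<lambda>F. specialization F h))"
proof -
  obtain A where A: "finite A" "\<And>F u. specializes (F \<inter> A) h u \<longleftrightarrow> specializes F h u"
    using ex_finite_variables by blast
  have "range (\<lambda>F. specialization F h) \<subseteq> (\<lambda>B. specialization B h) ` Pow A"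
  proof
    fix u assume "u \<in> range (\<lambda>F. specialization F h)"
    then obtain F where "u = specialization F h" by blast
    then have "u = specialization (F \<inter> A) h" unfolding specialization_def A(2) .
    then show "u \<in> (\<lambda>B. specialization B h) ` Pow A" by blast
  qed
  then show ?thesis using A(1) finite_subset by blast
qed

text \<open>The exponent has to exceed the order of the expansions of \<open>g\<close> and of all its
  specializations. There are finitely many of these, so a common bound exists.\<close>

lemma ex_divide_mem:
  assumes h: "h \<in> specializing_ring" and g: "g \<in> specializing_ring"
    and van: "\<And>F. F \<in> models H \<Longrightarrow> specialization F g = 0 \<Longrightarrow> specialization F h = 0"
  shows "\<exists>N>0. h ^ N / g \<in> specializing_ring"
proof -
  have "\<exists>N. \<forall>F a. u \<noteq> 0 \<longrightarrow> series F u a \<longrightarrow> subdegree a < N" for u :: "'i mpoly2 fract"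
    using ex_subdegree_bound[of u] by blast
  then obtain b where b: "\<And>F a u. u \<noteq> 0 \<Longrightarrow> series F u a \<Longrightarrow> subdegree a < b (u :: 'i mpoly2 fract)" by metis
  define N where "N = Suc (Max (b ` range (\<lambda>F. specialization F g)))"
  have bN: "b (specialization F g) < N" for F
    unfolding N_def using finite_specialization[of g] by (intro le_imp_less_Suc Max_ge) auto
  have N: "subdegree a < N" if "specialization F g \<noteq> 0" "series G (specialization F g) a" for F G a
    using b[OF that] bN[of F] by simp
  have "h ^ N / g \<in> specializing_ring"
  proof (rule specializing_ringI[of _ "\<lambda>F. specialization F h ^ N / specialization F g"])
    fix F assume F: "F \<in> models H"
    show "specializes F (h ^ N / g) (specialization F h ^ N / specialization F g)"
    proof (rule specializes_divide[OF specializing_ringD(1)[OF h F] specializing_ringD(1)[OF g F]])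
      show "0 < N" by (simp add: N_def)
      show "subdegree a < N" if "g \<noteq> 0" "series F g a" for a using N[of UNIV F a] that by (simp add: specialization_UNIV)
    qed (rule van[OF F])
    fix G assume G: "G \<in> models H" "G \<subseteq> F"
    show "specializes G (specialization F h ^ N / specialization F g) (specialization G h ^ N / specialization G g)"
    proof (rule specializes_divide[OF specializing_ringD(2)[OF h F G] specializing_ringD(2)[OF g F G]])
      show "0 < N" by (simp add: N_def)
    qed (use N van[OF G(1)] in auto)
  qed
  then show ?thesis unfolding N_def by blast
qed

text \<open>Every prime ideal is radical, and \<open>h ^ N\<close> is a multiple of \<open>g\<close>.\<close>

lemma prime_transfer:
  assumes P: "prime_in specializing_ring P" and h: "h \<in> specializing_ring" and g: "g \<in> P"
    and van: "\<And>F. F \<in> models H \<Longrightarrow> specialization F g = 0 \<Longrightarrow> specialization F h = 0"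
  shows "h \<in> P"
proof -
  have gR: "g \<in> specializing_ring" using g prime_inD(2)[OF P] by blast
  obtain N where N: "N > 0" "h ^ N / g \<in> specializing_ring" using ex_divide_mem[OF h gR van] by blast
  have "h = 0" if "g = 0" using van[OF UNIV_model] that by (simp add: specialization_UNIV)
  then have "h ^ N = (h ^ N / g) * g" using N(1) by (cases "g = 0") (auto simp: zero_power)
  then have "h ^ N \<in> P" using submodD(3)[OF prime_inD(1)[OF P] N(2) g] by simp
  moreover have "h ^ n \<in> P \<Longrightarrow> 0 < n \<Longrightarrow> h \<in> P" for n
  proof (induction n)
    case (Suc n)
    then show ?case
      using prime_inD(4)[OF P h unital_subring_power[OF unital_subring_specializing_ring h], of n] prime_inD(3)[OF P]
      by (cases "n = 0") auto
  qed simp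
  ultimately show ?thesis using N(1) by blast
qed

text \<open>Let \<open>A\<close> be a finite set containing the variables of \<open>h\<close>. A model \<open>F\<close> and the smallest
  model that contains \<open>F \<inter> A\<close> have the same trace on \<open>A\<close>, hence \<open>h\<close> has the same value at
  both. So it suffices to list those subsets \<open>T\<close> of \<open>A\<close> for which \<open>h\<close> does not vanish at the
  smallest model above \<open>T\<close>.\<close>

lemma ex_basic_cover:
  assumes h: "h \<in> specializing_ring"
  shows "\<exists>\<T>. finite \<T> \<and> (\<forall>T\<in>\<T>. finite T) \<and> (\<forall>F\<in>models H. specialization F h \<noteq> 0 \<longleftrightarrow> (\<exists>T\<in>\<T>. T \<subseteq> F))"
proof -
  obtain A where A: "finite A" "\<And>F u. specializes (F \<inter> A) h u \<longleftrightarrow> specializes F h u"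
    using ex_finite_variables by blast
  have rA: "specialization (F \<inter> A) h = specialization F h" for F unfolding specialization_def A(2) ..
  define \<T> where "\<T> = {T. T \<subseteq> A \<and> specialization (model_hull T) h \<noteq> 0}"
  have "specialization F h \<noteq> 0 \<longleftrightarrow> (\<exists>T\<in>\<T>. T \<subseteq> F)" if F: "F \<in> models H" for F
  proof
    assume nz: "specialization F h \<noteq> 0"
    have "model_hull (F \<inter> A) \<subseteq> F" by (rule model_hull_least[OF F]) blast
    then have "model_hull (F \<inter> A) \<inter> A = F \<inter> A" using model_hull_superset[of "F \<inter> A"] by blast
    then have "specialization (model_hull (F \<inter> A)) h = specialization F h" using rA[of "model_hull (F \<inter> A)"] rA[of F] by simp
    then have "F \<inter> A \<in> \<T>" using nz unfolding \<T>_def by simp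
    then show "\<exists>T\<in>\<T>. T \<subseteq> F" by blast
  next
    assume "\<exists>T\<in>\<T>. T \<subseteq> F"
    then obtain T where T: "T \<subseteq> F" "specialization (model_hull T) h \<noteq> 0" unfolding \<T>_def by blast
    have "specializes (model_hull T) (specialization F h) (specialization (model_hull T) h)"
      by (rule specializing_ringD(2)[OF h F model_hull_model model_hull_least[OF F T(1)]])
    then show "specialization F h \<noteq> 0" using T(2) specializes_0 specializes_unique by metis
  qed
  moreover have "finite \<T>" "\<forall>T\<in>\<T>. finite T"
    using A(1) finite_subset unfolding \<T>_def by auto
  ultimately show ?thesis by blast
qed

text \<open>The prime ideal of a model, and the set of atoms of a prime ideal, will be inverse to
  each other.\<close>

definition point :: "'i set \<Rightarrow> 'i mpoly2 fract set" where
  "point F = {h \<in> specializing_ring. specialization F h = 0}"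

definition support :: "'i mpoly2 fract set \<Rightarrow> 'i set" where
  "support P = {i. var i \<notin> P}"

lemma prime_in_point:
  assumes F: "F \<in> models H"
  shows "prime_in specializing_ring (point F)"
proof -
  note u = unital_subringD[OF unital_subring_specializing_ring]
  have "specialization F 1 = 1" "specialization F 0 = 0" by (auto intro!: specialization_eq specializes_1 specializes_0)
  then show ?thesis
    unfolding prime_in_def submod_def point_def using u specialization_simps[OF F] by auto
qed

lemma support_point: "support (point F) = F"
  unfolding support_def point_def using var_mem specialization_var var_nonzero by auto

lemma prod_mem_prime: "prime_in specializing_ring P \<Longrightarrow> finite T \<Longrightarrow> prod var T \<in> P \<Longrightarrow> \<exists>i\<in>T. var i \<in> P"
proof (induction T rule: infinite_finite_induct)
  case empty
  then show ?case using prime_inD(3) by auto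
next
  case (insert x T)
  then have "var x * prod var T \<in> P" by simp
  then show ?case using insert prime_inD(4)[OF insert.prems(1) var_mem prod_var_mem[OF insert.hyps(1)]] by blast
qed auto

text \<open>For a clause with premises \<open>T\<close> and conclusion \<open>i\<close>, the product of the variables of \<open>T\<close>
  vanishes at all models where \<open>t\<^sub>i\<close> vanishes. So if \<open>t\<^sub>i\<close> is in \<open>P\<close>, a factor of the product
  is, too.\<close>

lemma support_model:
  assumes P: "prime_in specializing_ring P"
  shows "support P \<in> models H"
proof -
  have "i \<in> support P" if Ti: "(T, i) \<in> H" "T \<subseteq> support P" for T i
  proof (rule ccontr)
    assume "i \<notin> support P"
    then have i: "var i \<in> P" by (simp add: support_def)
    have fin: "finite T" using finite_premises Ti(1) .
    have "prod var T \<in> P"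
    proof (rule prime_transfer[OF P prod_var_mem[OF fin] i])
      fix F assume F: "F \<in> models H" "specialization F (var i) = 0"
      then have "i \<notin> F" using specialization_var var_nonzero by metis
      then have "\<not> T \<subseteq> F" using F(1) Ti(1) unfolding models_def by blast
      then show "specialization F (prod var T) = 0" using specialization_prod_var[OF fin] by simp
    qed
    then show False using prod_mem_prime[OF P fin] Ti(2) unfolding support_def by blast
  qed
  then show ?thesis unfolding models_def by blast
qed

text \<open>By the finite cover, \<open>h\<close> vanishes at the same models as a sum \<open>s\<close> of squarefree
  monomials, and it does not vanish where one of these monomials does not. Transfer along
  these inclusions shows that \<open>h \<in> P\<close> if and only if all the monomials are in \<open>P\<close>, that is, if
  and only if \<open>h\<close> vanishes at the support of \<open>P\<close>.\<close>

lemma point_support: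
  assumes P: "prime_in specializing_ring P"
  shows "point (support P) = P"
proof -
  note mod = support_model[OF P]
  note m = prime_inD(1)[OF P]
  have "h \<in> P \<longleftrightarrow> specialization (support P) h = 0" if h: "h \<in> specializing_ring" for h
  proof -
    obtain \<T> where \<T>: "finite \<T>" "\<And>T. T \<in> \<T> \<Longrightarrow> finite T"
      "\<And>F. F \<in> models H \<Longrightarrow> specialization F h \<noteq> 0 \<longleftrightarrow> (\<exists>T\<in>\<T>. T \<subseteq> F)"
      using ex_basic_cover[OF h] by blast
    \<comment> \<open>Over the models containing none of the sets in the cover, \<open>s\<close> vanishes; over all
      others, its value is a nonempty sum of distinct monomials.\<close>
    define s where "s = (\<Sum>T\<in>\<T>. prod var T :: 'i mpoly2 fract)"
    have s: "s \<in> specializing_ring" unfolding s_def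
      by (rule unital_subring_sum[OF unital_subring_specializing_ring]) (rule prod_var_mem[OF \<T>(2)])
    have rs: "specialization F s = (\<Sum>T\<in>{T \<in> \<T>. T \<subseteq> F}. prod var T)" for F
    proof -
      have "specializes F s (\<Sum>T\<in>\<T>. if T \<subseteq> F then prod var T else 0)"
        unfolding s_def by (rule specializes_sum) (rule specializes_prod_var[OF \<T>(2)])
      also have "(\<Sum>T\<in>\<T>. if T \<subseteq> F then prod var T else 0) = (\<Sum>T\<in>{T \<in> \<T>. T \<subseteq> F}. prod var T :: 'i mpoly2 fract)"
        by (simp add: sum.inter_filter[OF \<T>(1)])
      finally show ?thesis by (rule specialization_eq)
    qed
    have rs0: "specialization F s = 0 \<longleftrightarrow> \<not> (\<exists>T\<in>\<T>. T \<subseteq> F)" for F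
      unfolding rs using sum_prod_var_eq_0_iff[of "{T \<in> \<T>. T \<subseteq> F}"] \<T>(1,2) by auto
    show ?thesis
    proof
      assume hP: "h \<in> P"
      show "specialization (support P) h = 0"
      proof (rule ccontr)
        assume "specialization (support P) h \<noteq> 0"
        then obtain T where T: "T \<in> \<T>" "T \<subseteq> support P" using \<T>(3)[OF mod] by blast
        have "prod var T \<in> P"
        proof (rule prime_transfer[OF P prod_var_mem[OF \<T>(2)[OF T(1)]] hP])
          fix F assume "F \<in> models H" "specialization F h = 0"
          then have "\<not> T \<subseteq> F" using \<T>(3) T(1) by blast
          then show "specialization F (prod var T) = 0" using specialization_prod_var[OF \<T>(2)[OF T(1)]] by simp
        qed
        then show False using prod_mem_prime[OF P \<T>(2)[OF T(1)]] T(2) unfolding support_def by blast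
      qed
    next
      assume "specialization (support P) h = 0"
      then have none: "\<not> T \<subseteq> support P" if "T \<in> \<T>" for T using that \<T>(3)[OF mod] by blast
      have "prod var T \<in> P" if T: "T \<in> \<T>" for T
      proof -
        obtain i where i: "i \<in> T" "var i \<in> P" using none[OF T] unfolding support_def by blast
        have "prod var T = prod var (T - {i}) * var i"
          using prod.remove[OF \<T>(2)[OF T] i(1), of var] by (simp add: mult.commute)
        then show ?thesis
          using submodD(3)[OF m prod_var_mem i(2), of "T - {i}"] \<T>(2)[OF T] by simp
      qed
      then have "s \<in> P" unfolding s_def by (intro submod_sum[OF m])
      then show "h \<in> P"
        by (rule prime_transfer[OF P h]) (use rs0 \<T>(3) in blast)
    qed
  qed
  then show ?thesis unfolding point_def using prime_inD(2)[OF P] by blast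
qed

lemma topspace_zariski_specializing_ring: "topspace (zariski_spec (sub_ring specializing_ring)) = {P. prime_in specializing_ring P}"
  using topspace_zariski_spec[OF sub_ring_cring[OF unital_subring_specializing_ring]]
  by (simp add: Spec_sub_ring[OF unital_subring_specializing_ring])

text \<open>The subbasic set of the atom \<open>i\<close> corresponds to the basic open set of \<open>t\<^sub>i\<close>; conversely,
  the nonvanishing locus of \<open>h\<close> is a finite union of finite intersections of such sets.\<close>

lemma homeomorphic_models_zariski: "models_topology H homeomorphic_space zariski_spec (sub_ring specializing_ring)"
  unfolding homeomorphic_space_def
proof (intro exI)
  have cont1: "continuous_map (models_topology H) (zariski_spec (sub_ring specializing_ring)) point"
  proof (rule continuous_map_into_generated[OF zariski_spec_def])
    show "point ` topspace (models_topology H) \<subseteq> topspace (zariski_spec (sub_ring specializing_ring))"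
      unfolding topspace_zariski_specializing_ring topspace_models_topology using prime_in_point by blast
  next
    fix U assume "U \<in> {{P \<in> Spec (sub_ring specializing_ring). h \<notin> P} |h. h \<in> carrier (sub_ring specializing_ring)}"
    then obtain h where h: "h \<in> specializing_ring" "U = {P \<in> Spec (sub_ring specializing_ring). h \<notin> P}" by auto
    obtain \<T> where "finite \<T> \<and> (\<forall>T\<in>\<T>. finite T) \<and> (\<forall>F\<in>models H. specialization F h \<noteq> 0 \<longleftrightarrow> (\<exists>T\<in>\<T>. T \<subseteq> F))"
      using ex_basic_cover[OF h(1)] ..
    then have \<T>: "\<And>T. T \<in> \<T> \<Longrightarrow> finite T"
      "\<And>F. F \<in> models H \<Longrightarrow> specialization F h \<noteq> 0 \<longleftrightarrow> (\<exists>T\<in>\<T>. T \<subseteq> F)" by simp_all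
    have "point -` U \<inter> topspace (models_topology H) = {F \<in> models H. specialization F h \<noteq> 0}"
      unfolding h(2) topspace_models_topology using prime_in_point h(1)
      by (auto simp: Spec_sub_ring[OF unital_subring_specializing_ring] point_def)
    also have "\<dots> = (\<Union>T\<in>\<T>. topspace (models_topology H) \<inter> (\<Inter>i\<in>T. {F \<in> models H. i \<in> F}))"
    proof (intro equalityI subsetI)
      fix F assume "F \<in> {F \<in> models H. specialization F h \<noteq> 0}"
      then have F: "F \<in> models H" "specialization F h \<noteq> 0" by auto
      then obtain T where "T \<in> \<T>" "T \<subseteq> F" using \<T>(2)[OF F(1)] by auto
      then show "F \<in> (\<Union>T\<in>\<T>. topspace (models_topology H) \<inter> (\<Inter>i\<in>T. {F \<in> models H. i \<in> F}))"
        using F(1) unfolding topspace_models_topology by (intro UN_I[of T]) auto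
    next
      fix F assume "F \<in> (\<Union>T\<in>\<T>. topspace (models_topology H) \<inter> (\<Inter>i\<in>T. {F \<in> models H. i \<in> F}))"
      then obtain T where "T \<in> \<T>" "F \<in> models H" "T \<subseteq> F"
        unfolding topspace_models_topology by auto
      then show "F \<in> {F \<in> models H. specialization F h \<noteq> 0}" using \<T>(2)[of F] by auto
    qed
    also have "openin (models_topology H) \<dots>"
    proof (intro openin_Union ballI, clarify)
      fix T assume "T \<in> \<T>"
      show "openin (models_topology H) (topspace (models_topology H) \<inter> (\<Inter>i\<in>T. {F \<in> models H. i \<in> F}))"
      proof (rule openin_Int_Inter)
        show "finite ((\<lambda>i. {F \<in> models H. i \<in> F}) ` T)" using \<T>(1)[OF \<open>T \<in> \<T>\<close>] by blast
      qed (auto simp: models_topology_def intro!: topology_generated_by_Basis)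
    qed
    finally show "openin (models_topology H) (point -` U \<inter> topspace (models_topology H))" .
  qed
  have cont2: "continuous_map (zariski_spec (sub_ring specializing_ring)) (models_topology H) support"
  proof (rule continuous_map_into_generated[OF models_topology_def])
    show "support ` topspace (zariski_spec (sub_ring specializing_ring)) \<subseteq> topspace (models_topology H)"
      unfolding topspace_zariski_specializing_ring topspace_models_topology using support_model by blast
  next
    fix U assume "U \<in> insert (models H) {{F \<in> models H. i \<in> F} |i. True}"
    then consider "U = models H" | i where "U = {F \<in> models H. i \<in> F}" by blast
    then show "openin (zariski_spec (sub_ring specializing_ring)) (support -` U \<inter> topspace (zariski_spec (sub_ring specializing_ring)))"
    proof cases
      case 1
      have "support -` U \<inter> topspace (zariski_spec (sub_ring specializing_ring)) = topspace (zariski_spec (sub_ring specializing_ring))"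
        unfolding 1 topspace_zariski_specializing_ring using support_model by blast
      then show ?thesis by simp
    next
      case 2
      have "support -` U \<inter> topspace (zariski_spec (sub_ring specializing_ring)) = {P \<in> Spec (sub_ring specializing_ring). var i \<notin> P}"
        unfolding 2 topspace_zariski_specializing_ring using support_model
        by (auto simp: Spec_sub_ring[OF unital_subring_specializing_ring] support_def)
      then show ?thesis
        unfolding zariski_spec_def using var_mem by (auto intro!: topology_generated_by_Basis)
    qed
  qed
  show "homeomorphic_maps (models_topology H) (zariski_spec (sub_ring specializing_ring)) point support"
    unfolding homeomorphic_maps_def topspace_models_topology topspace_zariski_specializing_ring
    using cont1 cont2 support_point point_support by blast
qed

end

section \<open>Transporting a ring along an injection\<close>

text \<open>Copy the operations along the injection; ideals and prime ideals are copied with them.\<close>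

lemma zariski_spec_homeomorphic_image_ring:
  fixes R :: "('a, 'b) ring_scheme" and e :: "'a \<Rightarrow> 'c"
  assumes R: "cring R" and e: "inj_on e (carrier R)"
  shows "\<exists>A :: 'c ring. cring A \<and> zariski_spec R homeomorphic_space zariski_spec A"
proof -
  interpret R: cring R by (rule R)
  define A where "A = image_ring e R"
  have iso: "e \<in> ring_iso R A" unfolding A_def by (rule inj_imp_image_ring_iso[OF e])
  have "image_ring e R\<lparr>zero := e \<zero>\<^bsub>R\<^esub>\<rparr> = image_ring e R"
    by (simp add: image_ring_def image_group_def monoid.defs)
  then have A: "cring A"
    unfolding A_def using R.ring_iso_imp_img_cring[OF inj_imp_image_ring_iso[OF e]] by simp
  interpret A: cring A by (rule A)
  define d where "d = inv_into (carrier R) e"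
  have iso': "d \<in> ring_iso A R" unfolding d_def by (rule ring_iso_set_sym[OF R.ring_axioms iso])
  have cA: "carrier A = e ` carrier R" unfolding A_def by (rule image_ring_carrier)
  have de: "d (e x) = x" if "x \<in> carrier R" for x unfolding d_def using e that by simp
  have eA: "e x \<in> carrier A" if "x \<in> carrier R" for x using that cA by blast
  have ed: "e (d y) = y" "d y \<in> carrier R" if "y \<in> carrier A" for y using that cA de by auto
  interpret he: ring_hom_ring R A e
    by (rule ring_hom_ringI2[OF R.ring_axioms A.ring_axioms]) (use iso in \<open>simp add: ring_iso_def\<close>)
  interpret hd: ring_hom_ring A R d
    by (rule ring_hom_ringI2[OF A.ring_axioms R.ring_axioms]) (use iso' in \<open>simp add: ring_iso_def\<close>)
  define \<Phi> where "\<Phi> P = {y \<in> carrier A. d y \<in> P}" for P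
  define \<Psi> where "\<Psi> Q = {x \<in> carrier R. e x \<in> Q}" for Q
  have \<Phi>: "primeideal (\<Phi> P) A" if "primeideal P R" for P
    unfolding \<Phi>_def by (rule hd.primeideal_vimage[OF A that])
  have \<Psi>: "primeideal (\<Psi> Q) R" if "primeideal Q A" for Q
    unfolding \<Psi>_def by (rule he.primeideal_vimage[OF R that])
  have subA: "P \<subseteq> carrier A" if "primeideal P A" for P
    using ideal.axioms(1)[OF primeideal.axioms(1)[OF that]] additive_subgroup.a_subset by blast
  have subR: "P \<subseteq> carrier R" if "primeideal P R" for P
    using ideal.axioms(1)[OF primeideal.axioms(1)[OF that]] additive_subgroup.a_subset by blast
  have \<Psi>\<Phi>: "\<Psi> (\<Phi> P) = P" if "primeideal P R" for P
    using subR[OF that] de eA unfolding \<Psi>_def \<Phi>_def by auto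
  have \<Phi>\<Psi>: "\<Phi> (\<Psi> Q) = Q" if "primeideal Q A" for Q
    using subA[OF that] ed unfolding \<Psi>_def \<Phi>_def by auto
  note topR = topspace_zariski_spec[OF R] and topA = topspace_zariski_spec[OF A]
  have c1: "continuous_map (zariski_spec R) (zariski_spec A) \<Phi>"
  proof (rule continuous_map_into_generated[OF zariski_spec_def])
    show "\<Phi> ` topspace (zariski_spec R) \<subseteq> topspace (zariski_spec A)"
      unfolding topR topA using \<Phi> by (auto simp: Spec_def)
  next
    fix U assume "U \<in> {{P \<in> Spec A. f \<notin> P} |f. f \<in> carrier A}"
    then obtain f where f: "f \<in> carrier A" "U = {P \<in> Spec A. f \<notin> P}" by blast
    have "\<Phi> -` U \<inter> topspace (zariski_spec R) = {P \<in> Spec R. d f \<notin> P}"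
      unfolding topR f(2) using \<Phi> f(1) by (auto simp: Spec_def \<Phi>_def)
    then show "openin (zariski_spec R) (\<Phi> -` U \<inter> topspace (zariski_spec R))"
      unfolding zariski_spec_def using ed(2)[OF f(1)] by (auto intro!: topology_generated_by_Basis)
  qed
  have c2: "continuous_map (zariski_spec A) (zariski_spec R) \<Psi>"
  proof (rule continuous_map_into_generated[OF zariski_spec_def])
    show "\<Psi> ` topspace (zariski_spec A) \<subseteq> topspace (zariski_spec R)"
      unfolding topR topA using \<Psi> by (auto simp: Spec_def)
  next
    fix U assume "U \<in> {{P \<in> Spec R. f \<notin> P} |f. f \<in> carrier R}"
    then obtain f where f: "f \<in> carrier R" "U = {P \<in> Spec R. f \<notin> P}" by blast
    have "\<Psi> -` U \<inter> topspace (zariski_spec A) = {P \<in> Spec A. e f \<notin> P}"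
      unfolding topA f(2) using \<Psi> f(1) by (auto simp: Spec_def \<Psi>_def)
    then show "openin (zariski_spec A) (\<Psi> -` U \<inter> topspace (zariski_spec A))"
      unfolding zariski_spec_def using f(1) cA by (auto intro!: topology_generated_by_Basis)
  qed
  have "homeomorphic_maps (zariski_spec R) (zariski_spec A) \<Phi> \<Psi>"
    unfolding homeomorphic_maps_def topR topA using c1 c2 \<Psi>\<Phi> \<Phi>\<Psi> by (auto simp: Spec_def)
  then have "zariski_spec R homeomorphic_space zariski_spec A"
    unfolding homeomorphic_space_def by (intro exI)
  then show ?thesis using A by (intro exI[of _ A] conjI)
qed

text \<open>The finite graph of the exponent function. Since no exponent in it is 0, the elements
  with first component 0 remain free for use as tags.\<close>

definition encode_monomial :: "('i \<Rightarrow> 'x) \<Rightarrow> ('i \<Rightarrow>\<^sub>0 nat) \<Rightarrow> (nat \<times> 'x) set" where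
  "encode_monomial \<iota> m = (\<lambda>i. (Poly_Mapping.lookup m i, \<iota> i)) ` Poly_Mapping.keys m"

lemma inj_encode_monomial:
  assumes "inj \<iota>"
  shows "inj (encode_monomial \<iota>)"
proof (rule injI)
  fix m m' assume eq: "encode_monomial \<iota> m = encode_monomial \<iota> m'"
  have *: "Poly_Mapping.lookup m i = n \<longleftrightarrow> (n, \<iota> i) \<in> encode_monomial \<iota> m" if "n \<noteq> 0" for m n i
    using that assms unfolding encode_monomial_def by (auto simp: in_keys_iff inj_eq)
  show "m = m'"
  proof (rule poly_mapping_eqI)
    fix i
    have "Poly_Mapping.lookup m i = n \<longleftrightarrow> Poly_Mapping.lookup m' i = n" if "n \<noteq> 0" for n
      using *[OF that, of m i] *[OF that, of m' i] eq by simp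
    then show "Poly_Mapping.lookup m i = Poly_Mapping.lookup m' i" by metis
  qed
qed

text \<open>A fraction is coded by the monomials of a numerator and of a denominator, the latter
  marked by an additional element with first component 0. A polynomial over the field with two
  elements is determined by its set of monomials.\<close>

lemma ex_inj_mpoly2_fract:
  assumes \<iota>: "inj (\<iota> :: 'i::linorder \<Rightarrow> 'x)"
  shows "\<exists>e :: 'i mpoly2 fract \<Rightarrow> (nat \<times> 'x) set set. inj e"
proof -
  have "\<forall>h :: 'i mpoly2 fract. \<exists>pq. snd pq \<noteq> 0 \<and> h = to_fract (fst pq) / to_fract (snd pq)"
    using mfraction_cases by (metis fst_conv snd_conv)
  then obtain r where r: "\<And>h :: 'i mpoly2 fract. h = to_fract (fst (r h)) / to_fract (snd (r h))" by metis
  \<comment> \<open>The tag of a monomial of the denominator.\<close>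
  define z :: "nat \<times> 'x" where "z = (0, undefined)"
  define c where "c = encode_monomial \<iota>"
  have zc: "z \<notin> c m" for m unfolding z_def c_def encode_monomial_def by (auto simp: in_keys_iff)
  define e where "e h = c ` Poly_Mapping.keys (fst (r h)) \<union> (\<lambda>m. insert z (c m)) ` Poly_Mapping.keys (snd (r h))" for h
  have inj_c: "inj c" unfolding c_def by (rule inj_encode_monomial[OF \<iota>])
  have inj_zc: "inj (\<lambda>m. insert z (c m))"
  proof (rule injI)
    fix m m' assume "insert z (c m) = insert z (c m')"
    then have "c m = c m'" using zc by (metis insert_ident)
    then show "m = m'" using inj_c by (simp add: inj_eq)
  qed
  have k1: "m \<in> Poly_Mapping.keys (fst (r h)) \<longleftrightarrow> c m \<in> e h" for m h
  proof -
    have "c m \<noteq> insert z (c m')" for m' using zc[of m] by blast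
    then show ?thesis unfolding e_def using inj_c by (auto simp: inj_eq)
  qed
  have k2: "m \<in> Poly_Mapping.keys (snd (r h)) \<longleftrightarrow> insert z (c m) \<in> e h" for m h
  proof -
    have "insert z (c m) \<noteq> c m'" for m' using zc[of m'] by blast
    moreover have "insert z (c m) = insert z (c m') \<longleftrightarrow> m = m'" for m'
      using inj_zc by (auto simp: inj_def)
    ultimately show ?thesis unfolding e_def by (auto simp: image_iff)
  qed
  have bit: "p = q" if "Poly_Mapping.keys p = Poly_Mapping.keys q" for p q :: "'i mpoly2"
  proof (rule poly_mapping_eqI)
    fix m
    have "Poly_Mapping.lookup p m \<noteq> 0 \<longleftrightarrow> Poly_Mapping.lookup q m \<noteq> 0"
      using that by (metis in_keys_iff)
    then show "Poly_Mapping.lookup p m = Poly_Mapping.lookup q m" by (metis bit_not_one_iff)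
  qed
  have "inj e"
  proof (rule injI)
    fix g h assume "e g = e h"
    then have "fst (r g) = fst (r h)" "snd (r g) = snd (r h)"
      using k1[of _ g] k1[of _ h] k2[of _ g] k2[of _ h] by (auto intro!: bit)
    then show "g = h" using r[of g] r[of h] by simp
  qed
  then show ?thesis by blast
qed

theorem spectral_space_if_homeomorphic_models:
  fixes T :: "'x topology" and H :: "('i::linorder set \<times> 'i) set"
  assumes T: "T homeomorphic_space models_topology H" and fin: "\<And>P i. (P, i) \<in> H \<Longrightarrow> finite P"
    and \<iota>: "inj (\<iota> :: 'i \<Rightarrow> 'x)"
  shows "spectral_space T"
proof -
  interpret horn H by unfold_locales (rule fin)
  obtain e :: "'i mpoly2 fract \<Rightarrow> (nat \<times> 'x) set set" where "inj e" using ex_inj_mpoly2_fract[OF \<iota>] by blast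
  then have "inj_on e (carrier (sub_ring specializing_ring))" by (rule inj_on_subset) simp
  then obtain A :: "(nat \<times> 'x) set set ring"
    where A: "cring A" "zariski_spec (sub_ring specializing_ring) homeomorphic_space zariski_spec A"
    using zariski_spec_homeomorphic_image_ring[OF sub_ring_cring[OF unital_subring_specializing_ring]] by blast
  then show ?thesis
    unfolding spectral_space_def
    using A(1) homeomorphic_space_trans[OF T homeomorphic_space_trans[OF homeomorphic_models_zariski A(2)]]
    by (intro exI[of _ A] conjI)
qed

section \<open>Arbitrary index sets\<close>

text \<open>A linear order of the variables induces one of the monomials, by which polynomials are
  seen to have no zero divisors. Every type carries a linear order; the copy of the type
  serves to name one as part of a class instance.\<close>

typedef 'a well_ordered = "UNIV :: 'a set" ..

definition some_well_order :: "('a well_ordered \<times> 'a well_ordered) set" where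
  "some_well_order = (SOME r. well_order_on UNIV r)"

lemma some_well_order: "well_order_on UNIV some_well_order"
  unfolding some_well_order_def by (rule someI_ex) (rule well_order_on)

instantiation well_ordered :: (type) linorder
begin

definition less_eq_well_ordered :: "'a well_ordered \<Rightarrow> 'a well_ordered \<Rightarrow> bool" where
  "x \<le> y \<longleftrightarrow> (x, y) \<in> some_well_order"

definition less_well_ordered :: "'a well_ordered \<Rightarrow> 'a well_ordered \<Rightarrow> bool" where
  "x < y \<longleftrightarrow> (x, y) \<in> some_well_order \<and> x \<noteq> y"

instance
proof
  have *: "refl_on UNIV (some_well_order :: ('a well_ordered \<times> 'a well_ordered) set)"
    "trans (some_well_order :: ('a well_ordered \<times> 'a well_ordered) set)"
    "antisym (some_well_order :: ('a well_ordered \<times> 'a well_ordered) set)"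
    "total_on UNIV (some_well_order :: ('a well_ordered \<times> 'a well_ordered) set)"
    using some_well_order
    unfolding well_order_on_def linear_order_on_def partial_order_on_def preorder_on_def by auto
  fix x y z :: "'a well_ordered"
  show "(x < y) = (x \<le> y \<and> \<not> y \<le> x)"
    using *(3) unfolding less_eq_well_ordered_def less_well_ordered_def antisym_def by auto
  show "x \<le> x" using *(1) unfolding less_eq_well_ordered_def refl_on_def by auto
  show "x \<le> y \<Longrightarrow> y \<le> z \<Longrightarrow> x \<le> z" using *(2) unfolding less_eq_well_ordered_def trans_def by blast
  show "x \<le> y \<Longrightarrow> y \<le> x \<Longrightarrow> x = y" using *(3) unfolding less_eq_well_ordered_def antisym_def by blast
  show "x \<le> y \<or> y \<le> x"
    using *(1,4) unfolding less_eq_well_ordered_def total_on_def refl_on_def by (cases "x = y") auto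
qed

end

lemma models_topology_homeomorphic_image:
  fixes f :: "'i \<Rightarrow> 'j" and H :: "('i set \<times> 'i) set"
  assumes f: "bij f"
  shows "models_topology H homeomorphic_space models_topology ((\<lambda>(T, i). (f ` T, f i)) ` H)"
    (is "_ homeomorphic_space models_topology ?H")
proof -
  have inj: "f x = f y \<longleftrightarrow> x = y" for x y using f by (simp add: bij_is_inj inj_eq)
  have sub: "f ` T \<subseteq> F \<longleftrightarrow> T \<subseteq> f -` F" for T F by auto
  have vim: "f -` F \<in> models H \<longleftrightarrow> F \<in> models ?H" for F
    unfolding models_def using sub by auto
  have im: "f -` (f ` G) = G" for G using inj by auto
  have im': "f ` (f -` F) = F" for F using f by (simp add: bij_is_surj surj_image_vimage_eq)
  have img: "f ` G \<in> models ?H \<longleftrightarrow> G \<in> models H" for G using vim[of "f ` G"] im by simp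
  have c1: "continuous_map (models_topology H) (models_topology ?H) ((`) f)"
  proof (rule continuous_map_into_generated[OF models_topology_def])
    show "(`) f ` topspace (models_topology H) \<subseteq> topspace (models_topology ?H)"
      unfolding topspace_models_topology using img by auto
  next
    fix U assume "U \<in> insert (models ?H) {{F \<in> models ?H. i \<in> F} |i. True}"
    then consider "U = models ?H" | j where "U = {F \<in> models ?H. j \<in> F}" by blast
    then show "openin (models_topology H) ((`) f -` U \<inter> topspace (models_topology H))"
    proof cases
      case 1
      have "(`) f -` U \<inter> topspace (models_topology H) = topspace (models_topology H)"
        unfolding 1 topspace_models_topology using img by auto
      then show ?thesis by simp
    next
      case 2
      obtain i where i: "j = f i" using f by (metis bij_pointE)
      have "(`) f -` U \<inter> topspace (models_topology H) = {G \<in> models H. i \<in> G}"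
        unfolding 2 i topspace_models_topology using img inj by auto
      then show ?thesis unfolding models_topology_def by (auto intro!: topology_generated_by_Basis)
    qed
  qed
  have c2: "continuous_map (models_topology ?H) (models_topology H) ((-`) f)"
  proof (rule continuous_map_into_generated[OF models_topology_def])
    show "(-`) f ` topspace (models_topology ?H) \<subseteq> topspace (models_topology H)"
      unfolding topspace_models_topology using vim by auto
  next
    fix U assume "U \<in> insert (models H) {{F \<in> models H. i \<in> F} |i. True}"
    then consider "U = models H" | i where "U = {F \<in> models H. i \<in> F}" by blast
    then show "openin (models_topology ?H) ((-`) f -` U \<inter> topspace (models_topology ?H))"
    proof cases
      case 1
      have "(-`) f -` U \<inter> topspace (models_topology ?H) = topspace (models_topology ?H)"
        unfolding 1 topspace_models_topology using vim by auto
      then show ?thesis by simp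
    next
      case 2
      have "(-`) f -` U \<inter> topspace (models_topology ?H) = {F \<in> models ?H. f i \<in> F}"
        unfolding 2 topspace_models_topology using vim by auto
      then show ?thesis unfolding models_topology_def by (auto intro!: topology_generated_by_Basis)
    qed
  qed
  have "homeomorphic_maps (models_topology H) (models_topology ?H) ((`) f) ((-`) f)"
    unfolding homeomorphic_maps_def using c1 c2 im im' by simp
  then show ?thesis unfolding homeomorphic_space_def by blast
qed

theorem spectral_space_if_homeomorphic_models':
  fixes T :: "'x topology" and H :: "('i set \<times> 'i) set"
  assumes T: "T homeomorphic_space models_topology H" and fin: "\<And>P i. (P, i) \<in> H \<Longrightarrow> finite P"
    and \<iota>: "inj (\<iota> :: 'i \<Rightarrow> 'x)"
  shows "spectral_space T"
proof -
  let ?f = "Abs_well_ordered :: 'i \<Rightarrow> 'i well_ordered"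
  have "bij ?f"
    by (rule bij_betw_byWitness[of _ Rep_well_ordered]) (auto simp: Abs_well_ordered_inverse Rep_well_ordered_inverse)
  note h = homeomorphic_space_trans[OF T models_topology_homeomorphic_image[OF this, of H]]
  show ?thesis
  proof (rule spectral_space_if_homeomorphic_models[OF h])
    show "inj (\<iota> \<circ> Rep_well_ordered)"
      using \<iota> Rep_well_ordered_inject by (auto simp: inj_def)
    show "finite P" if "(P, i) \<in> (\<lambda>(T, i). (?f ` T, ?f i)) ` H" for P i
      using that fin by auto
  qed
qed

section \<open>Eab operations of finite type as models of a Horn theory\<close>

text \<open>The operation on finite sets by which \<open>x \<in> S\<^sup>r\<close> becomes \<open>1 \<in> (scaled x S)\<^sup>r\<close>.\<close>

abbreviation scaled :: "'l::field \<Rightarrow> 'l set \<Rightarrow> 'l set" where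
  "scaled x S \<equiv> (\<lambda>y. inverse x * y) ` S"

lemma scaled_scaled: "scaled x (scaled y S) = scaled (x * y) S"
  by (auto simp: image_image mult.assoc mult.commute mult.left_commute)

lemma image_mult_eq_set_times: "(\<lambda>y. c * y) ` U = {c} * (U :: 'l::field set)"
  by (auto simp: set_times_def)

lemma has_nonzero_scaled: "x \<noteq> 0 \<Longrightarrow> has_nonzero (scaled x S) \<longleftrightarrow> has_nonzero S"
  unfolding has_nonzero_def by auto

text \<open>The atoms are sets \<open>S\<close>, and \<open>S\<close> stands for the assertion \<open>1 \<in> S\<^sup>r\<close>, so that for \<open>t \<noteq> 0\<close>
  the atom \<open>scaled t S\<close> stands for \<open>t \<in> S\<^sup>r\<close>. The first group makes all sets true that are not
  of interest, since a model has to decide about them in a fixed way. The second says that the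
  closure contains the generated module. The third is transitivity: from \<open>1 \<in> T\<^sup>r\<close> and
  \<open>T \<subseteq> S\<^sup>r\<close> one gets \<open>1 \<in> S\<^sup>r\<close>. The fourth is the eab property, in the form that \<open>S \<subseteq> (S U)\<^sup>r\<close>
  implies \<open>1 \<in> U\<^sup>r\<close>.\<close>

definition eab_rules :: "'l::field set \<Rightarrow> ('l set set \<times> 'l set) set" where
  "eab_rules R =
     {({}, S) | S. \<not> (finite S \<and> has_nonzero S)} \<union>
     {({}, S) | S. finite S \<and> has_nonzero S \<and> 1 \<in> module_span R S} \<union>
     {(insert T ((\<lambda>t. scaled t S) ` (T - {0})), S) | S T. finite S \<and> has_nonzero S \<and> finite T \<and> has_nonzero T} \<union>
     {((\<lambda>s. scaled s (S * U)) ` (S - {0}), U) | S U. finite S \<and> has_nonzero S \<and> finite U \<and> has_nonzero U}"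

lemma finite_eab_rules: "(P, i) \<in> eab_rules R \<Longrightarrow> finite P"
  unfolding eab_rules_def by auto

lemma eab_rulesD:
  assumes "F \<in> models (eab_rules R)"
  shows "\<not> (finite S \<and> has_nonzero S) \<Longrightarrow> S \<in> F"
    "finite S \<Longrightarrow> has_nonzero S \<Longrightarrow> 1 \<in> module_span R S \<Longrightarrow> S \<in> F"
    "finite S \<Longrightarrow> has_nonzero S \<Longrightarrow> finite T \<Longrightarrow> has_nonzero T \<Longrightarrow> T \<in> F \<Longrightarrow> (\<And>t. t \<in> T \<Longrightarrow> t \<noteq> 0 \<Longrightarrow> scaled t S \<in> F) \<Longrightarrow> S \<in> F"
    "finite S \<Longrightarrow> has_nonzero S \<Longrightarrow> finite U \<Longrightarrow> has_nonzero U \<Longrightarrow> (\<And>s. s \<in> S \<Longrightarrow> s \<noteq> 0 \<Longrightarrow> scaled s (S * U) \<in> F) \<Longrightarrow> U \<in> F"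
proof -
  have r: "S \<in> F" if "(P, S) \<in> eab_rules R" "P \<subseteq> F" for P S
    using assms that unfolding models_def by blast
  show "S \<in> F" if "\<not> (finite S \<and> has_nonzero S)"
    by (rule r[of "{}"]) (use that in \<open>auto simp: eab_rules_def\<close>)
  show "S \<in> F" if "finite S" "has_nonzero S" "1 \<in> module_span R S"
    by (rule r[of "{}"]) (use that in \<open>auto simp: eab_rules_def\<close>)
  show "S \<in> F" if *: "finite S" "has_nonzero S" "finite T" "has_nonzero T" "T \<in> F" "\<And>t. t \<in> T \<Longrightarrow> t \<noteq> 0 \<Longrightarrow> scaled t S \<in> F"
  proof (rule r[of "insert T ((\<lambda>t. scaled t S) ` (T - {0}))"])
    have "(insert T ((\<lambda>t. scaled t S) ` (T - {0})), S) \<in>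
        {(insert T ((\<lambda>t. scaled t S) ` (T - {0})), S) | S T. finite S \<and> has_nonzero S \<and> finite T \<and> has_nonzero T}"
      using *(1-4) by (intro CollectI exI[of _ S] exI[of _ T]) simp
    then show "(insert T ((\<lambda>t. scaled t S) ` (T - {0})), S) \<in> eab_rules R" unfolding eab_rules_def by simp
  qed (use *(5,6) in auto)
  show "U \<in> F" if *: "finite S" "has_nonzero S" "finite U" "has_nonzero U" "\<And>s. s \<in> S \<Longrightarrow> s \<noteq> 0 \<Longrightarrow> scaled s (S * U) \<in> F"
  proof (rule r[of "(\<lambda>s. scaled s (S * U)) ` (S - {0})"])
    have "((\<lambda>s. scaled s (S * U)) ` (S - {0}), U) \<in>
        {((\<lambda>s. scaled s (S * U)) ` (S - {0}), U) | S U. finite S \<and> has_nonzero S \<and> finite U \<and> has_nonzero U}"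
      using *(1-4) by (intro CollectI exI[of _ S] exI[of _ U]) simp
    then show "((\<lambda>s. scaled s (S * U)) ` (S - {0}), U) \<in> eab_rules R" unfolding eab_rules_def by simp
  qed (use *(5) in auto)
qed

text \<open>All sets that are not finite or have no nonzero element belong to the family, to agree
  with the first group of rules.\<close>

definition theory_of :: "'l::field set \<Rightarrow> ('l set \<Rightarrow> 'l set) \<Rightarrow> 'l set set" where
  "theory_of R r = {S. finite S \<and> has_nonzero S \<longrightarrow> 1 \<in> star_closure R r S}"

text \<open>The closure of a finite set \<open>S\<close> as encoded in the family \<open>F\<close>.\<close>

definition consequences :: "'l::field set set \<Rightarrow> 'l set \<Rightarrow> 'l set" where
  "consequences F S = {x. x = 0 \<or> scaled x S \<in> F}"

text \<open>The operation of finite type with the given closures of finite sets.\<close>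

definition op_of :: "'l::field set \<Rightarrow> 'l set set \<Rightarrow> 'l set \<Rightarrow> 'l set" where
  "op_of R F = (\<lambda>E\<in>Fbar R. {x. \<exists>S. finite S \<and> has_nonzero S \<and> S \<subseteq> E \<and> x \<in> consequences F S})"

lemma (in semistar) mem_star_closure_iff_scaled:
  assumes "has_nonzero S" "x \<noteq> 0"
  shows "x \<in> star_closure R s S \<longleftrightarrow> 1 \<in> star_closure R s (scaled x S)"
proof -
  have "star_closure R s (scaled x S) = scaled x (star_closure R s S)" using assms by (intro star_closure_scale) auto
  moreover have "1 \<in> scaled x (star_closure R s S) \<longleftrightarrow> x \<in> star_closure R s S" using assms(2) by (auto simp: image_iff field_simps)
  ultimately show ?thesis by simp
qed

locale eab_model =
  fixes R :: "'l::field set" and F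
  assumes R: "unital_subring R" and quot: "\<And>x. \<exists>a\<in>R. \<exists>b\<in>R. b \<noteq> 0 \<and> x = a / b"
    and F: "F \<in> models (eab_rules R)"
begin

lemma consequences_span:
  assumes "finite S" "has_nonzero S" "x \<in> module_span R S"
  shows "x \<in> consequences F S"
proof (cases "x = 0")
  case False
  then have "1 \<in> module_span R (scaled x S)"
    unfolding module_span_scale[OF R] using assms(3) by (auto simp: image_iff field_simps)
  then have "scaled x S \<in> F" using assms False by (intro eab_rulesD(2)[OF F]) (auto simp: has_nonzero_scaled)
  then show ?thesis by (simp add: consequences_def)
qed (simp add: consequences_def)

lemma consequences_trans:
  assumes "finite S" "has_nonzero S" "finite T" "has_nonzero T" "T \<subseteq> consequences F S" "x \<in> consequences F T"
  shows "x \<in> consequences F S"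
proof (cases "x = 0")
  case False
  then have T: "scaled x T \<in> F" using assms(6) by (simp add: consequences_def)
  have "scaled x S \<in> F"
  proof (rule eab_rulesD(3)[OF F _ _ _ _ T])
    fix t assume "t \<in> scaled x T" "t \<noteq> 0"
    then obtain u where u: "u \<in> T" "t = inverse x * u" "u \<noteq> 0" using False by auto
    then have "scaled u S \<in> F" using assms(5) by (auto simp: consequences_def)
    moreover have "t * x = u" using u(2) False by simp
    then have "scaled t (scaled x S) = scaled u S" by (simp only: scaled_scaled)
    ultimately show "scaled t (scaled x S) \<in> F" by simp
  qed (use assms False in \<open>simp_all add: has_nonzero_scaled\<close>)
  then show ?thesis by (simp add: consequences_def)
qed (simp add: consequences_def)

lemma consequences_superset: "finite S \<Longrightarrow> has_nonzero S \<Longrightarrow> S \<subseteq> consequences F S"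
  using consequences_span module_span_superset[OF R] by blast

lemma consequences_mono:
  assumes "finite S" "has_nonzero S" "finite T" "S \<subseteq> T"
  shows "consequences F S \<subseteq> consequences F T"
proof -
  have T: "has_nonzero T" using has_nonzero_mono assms by blast
  show ?thesis using consequences_trans[OF assms(3) T assms(1,2)] consequences_superset[OF assms(3) T] assms(4) by blast
qed

lemma op_of_eq: "E \<in> Fbar R \<Longrightarrow> op_of R F E = {x. \<exists>S. finite S \<and> has_nonzero S \<and> S \<subseteq> E \<and> x \<in> consequences F S}"
  by (simp add: op_of_def)

lemma op_ofI: "E \<in> Fbar R \<Longrightarrow> finite S \<Longrightarrow> has_nonzero S \<Longrightarrow> S \<subseteq> E \<Longrightarrow> x \<in> consequences F S \<Longrightarrow> x \<in> op_of R F E"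
  unfolding op_of_eq by blast

text \<open>Finitely many supports can be united.\<close>

lemma op_of_finite_support:
  assumes E: "E \<in> Fbar R" and "finite T" "T \<subseteq> op_of R F E"
  shows "\<exists>S. finite S \<and> has_nonzero S \<and> S \<subseteq> E \<and> T \<subseteq> consequences F S"
proof -
  obtain e where e: "e \<in> E" "e \<noteq> 0" using E by (auto simp: Fbar_iff[OF R])
  have "\<forall>t\<in>T. \<exists>S. finite S \<and> has_nonzero S \<and> S \<subseteq> E \<and> t \<in> consequences F S" using assms(3) op_of_eq[OF E] by blast
  then obtain S where S: "\<And>t. t \<in> T \<Longrightarrow> finite (S t) \<and> has_nonzero (S t) \<and> S t \<subseteq> E \<and> t \<in> consequences F (S t)" by metis
  define U where "U = insert e (\<Union>t\<in>T. S t)"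
  have U: "finite U" "has_nonzero U" "U \<subseteq> E" using S assms(2) e unfolding U_def has_nonzero_def by auto
  have "t \<in> consequences F U" if t: "t \<in> T" for t
    using consequences_mono[of "S t" U] S[OF t] U(1) t unfolding U_def by blast
  then show ?thesis using U by blast
qed

lemma op_of_SStar: "op_of R F \<in> SStar R"
proof -
  have sup: "E \<subseteq> op_of R F E" if E: "E \<in> Fbar R" for E
  proof
    fix x assume x: "x \<in> E"
    obtain e where e: "e \<in> E" "e \<noteq> 0" using E by (auto simp: Fbar_iff[OF R])
    have S: "finite {x, e}" "has_nonzero {x, e}" "{x, e} \<subseteq> E" using x e by (auto simp: has_nonzero_def)
    show "x \<in> op_of R F E" by (rule op_ofI[OF E S]) (use consequences_superset[OF S(1,2)] in blast)
  qed
  have sm: "submod R (op_of R F E)" if E: "E \<in> Fbar R" for E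
    unfolding submod_def
  proof (intro conjI ballI)
    show "0 \<in> op_of R F E" using sup[OF E] E submodD(1) Fbar_iff[OF R] by blast
  next
    fix x y assume "x \<in> op_of R F E" "y \<in> op_of R F E"
    then obtain S where S: "finite S" "has_nonzero S" "S \<subseteq> E" "{x, y} \<subseteq> consequences F S"
      using op_of_finite_support[OF E, of "{x, y}"] by blast
    show "x + y \<in> op_of R F E"
    proof (cases "has_nonzero {x, y}")
      case True
      have "x + y \<in> module_span R {x, y}"
        using module_span_superset[OF R, of "{x, y}"] by (intro submodD(2)[OF submod_module_span[OF R]]) auto
      then have c: "x + y \<in> consequences F {x, y}" by (intro consequences_span True) auto
      have "x + y \<in> consequences F S" by (rule consequences_trans[OF S(1,2) _ True S(4) c]) simp
      then show ?thesis by (rule op_ofI[OF E S(1-3)])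
    next
      case False
      then show ?thesis using \<open>x \<in> op_of R F E\<close> by (simp add: has_nonzero_def)
    qed
  next
    fix a x assume a: "a \<in> R" and x: "x \<in> op_of R F E"
    then obtain S where S: "finite S" "has_nonzero S" "S \<subseteq> E" "{x} \<subseteq> consequences F S"
      using op_of_finite_support[OF E, of "{x}"] by blast
    show "a * x \<in> op_of R F E"
    proof (cases "has_nonzero {x}")
      case True
      have "a * x \<in> module_span R {x}"
        using module_span_superset[OF R, of "{x}"] a by (intro submodD(3)[OF submod_module_span[OF R]]) auto
      then have c: "a * x \<in> consequences F {x}" by (intro consequences_span True) auto
      have "a * x \<in> consequences F S" by (rule consequences_trans[OF S(1,2) _ True S(4) c]) simp
      then show ?thesis by (rule op_ofI[OF E S(1-3)])
    next
      case False
      then show ?thesis using x by (simp add: has_nonzero_def)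
    qed
  qed
  have Fb: "op_of R F E \<in> Fbar R" if E: "E \<in> Fbar R" for E
    using sm[OF E] sup[OF E] E unfolding Fbar_iff[OF R] by blast
  have idem: "op_of R F (op_of R F E) \<subseteq> op_of R F E" if E: "E \<in> Fbar R" for E
  proof
    fix x assume "x \<in> op_of R F (op_of R F E)"
    then obtain T where T: "finite T" "has_nonzero T" "T \<subseteq> op_of R F E" "x \<in> consequences F T"
      unfolding op_of_eq[OF Fb[OF E]] by blast
    then obtain S where S: "finite S" "has_nonzero S" "S \<subseteq> E" "T \<subseteq> consequences F S"
      using op_of_finite_support[OF E] by blast
    show "x \<in> op_of R F E" by (rule op_ofI[OF E S(1-3) consequences_trans[OF S(1,2) T(1,2) S(4) T(4)]])
  qed
  have scs: "(\<lambda>x. z * x) ` op_of R F E \<subseteq> op_of R F ((\<lambda>x. z * x) ` E)" if E: "E \<in> Fbar R" and z: "z \<noteq> 0" for E z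
  proof
    fix x assume "x \<in> (\<lambda>x. z * x) ` op_of R F E"
    then obtain y S where y: "x = z * y" "finite S" "has_nonzero S" "S \<subseteq> E" "y \<in> consequences F S"
      unfolding op_of_eq[OF E] by blast
    have sc: "scaled x ((\<lambda>x. z * x) ` S) = scaled y S" if "y \<noteq> 0"
      unfolding image_image by (rule image_cong) (use that z y(1) in \<open>simp_all add: field_simps\<close>)
    have "x \<in> consequences F ((\<lambda>x. z * x) ` S)"
    proof (cases "y = 0")
      case True
      then show ?thesis using y(1) by (simp add: consequences_def)
    next
      case False
      then have "scaled y S \<in> F" using y(5) by (simp add: consequences_def)
      then have "scaled x ((\<lambda>x. z * x) ` S) \<in> F" by (simp only: sc[OF False])
      then show ?thesis unfolding consequences_def by blast
    qed
    then show "x \<in> op_of R F ((\<lambda>x. z * x) ` E)"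
      using y z by (intro op_ofI[OF Fbar_scale[OF R E z], of "(\<lambda>x. z * x) ` S"]) (auto simp: has_nonzero_def)
  qed
  have sc: "op_of R F ((\<lambda>x. z * x) ` E) = (\<lambda>x. z * x) ` op_of R F E" if E: "E \<in> Fbar R" and z: "z \<noteq> 0" for E z
  proof
    have "inverse z \<noteq> 0" using z by simp
    from scs[OF Fbar_scale[OF R E z] this]
    have *: "(\<lambda>x. inverse z * x) ` op_of R F ((\<lambda>x. z * x) ` E) \<subseteq> op_of R F E"
      using z by (simp add: image_image flip: mult.assoc)
    show "op_of R F ((\<lambda>x. z * x) ` E) \<subseteq> (\<lambda>x. z * x) ` op_of R F E"
    proof
      fix x assume "x \<in> op_of R F ((\<lambda>x. z * x) ` E)"
      then have "inverse z * x \<in> op_of R F E" using * by blast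
      moreover have "x = z * (inverse z * x)" using z by simp
      ultimately show "x \<in> (\<lambda>x. z * x) ` op_of R F E" by blast
    qed
  qed (rule scs[OF E z])
  have mono: "op_of R F E \<subseteq> op_of R F E'" if "E \<in> Fbar R" "E' \<in> Fbar R" "E \<subseteq> E'" for E E'
    unfolding op_of_eq[OF that(1)] op_of_eq[OF that(2)] using that(3) by blast
  show ?thesis
    unfolding SStar_def
  proof (intro CollectI conjI ballI allI impI)
    show "op_of R F \<in> Fbar R \<rightarrow>\<^sub>E Fbar R" using Fb by (simp add: PiE_def op_of_def)
    fix E assume E: "E \<in> Fbar R"
    show "E \<subseteq> op_of R F E" by (rule sup[OF E])
    show "op_of R F (op_of R F E) = op_of R F E" using idem[OF E] sup[OF Fb[OF E]] by blast
  qed (simp_all add: sc mono)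
qed

text \<open>A finite subset of the module generated by \<open>S\<close> consists of consequences of \<open>S\<close>, and
  consequences of consequences are consequences.\<close>

lemma star_closure_op_of:
  assumes "finite S" "has_nonzero S"
  shows "star_closure R (op_of R F) S = consequences F S"
proof
  note E = has_nonzero_span[OF R assms(2)]
  show "consequences F S \<subseteq> star_closure R (op_of R F) S"
    unfolding star_closure_def using op_ofI[OF E assms module_span_superset[OF R]] by blast
  show "star_closure R (op_of R F) S \<subseteq> consequences F S"
  proof
    fix x assume "x \<in> star_closure R (op_of R F) S"
    then obtain T where T: "finite T" "has_nonzero T" "T \<subseteq> module_span R S" "x \<in> consequences F T"
      unfolding star_closure_def op_of_eq[OF E] by blast
    then have "T \<subseteq> consequences F S" using consequences_span[OF assms] by blast
    then show "x \<in> consequences F S" using consequences_trans[OF assms T(1,2) _ T(4)] by blast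
  qed
qed

text \<open>Cancelling an arbitrary factor amounts to cancelling with a single element \<open>t\<close> of the
  other factor, which scaling turns into 1; this is the case covered by the last group of
  rules.\<close>

lemma op_of_mem: "op_of R F \<in> SStar_f_eab R"
proof -
  have ft: "finite_type R (op_of R F)"
    unfolding finite_type_iff[OF R quot op_of_SStar]
  proof (intro ballI)
    fix E x assume E: "E \<in> Fbar R" and "x \<in> op_of R F E"
    then obtain S where "finite S" "has_nonzero S" "S \<subseteq> E" "x \<in> consequences F S"
      unfolding op_of_eq[OF E] by blast
    then show "\<exists>S. finite S \<and> has_nonzero S \<and> S \<subseteq> E \<and> x \<in> star_closure R (op_of R F) S"
      by (intro exI[of _ S]) (simp add: star_closure_op_of)
  qed
  interpret semistar R "op_of R F" by unfold_locales (rule R, rule op_of_SStar)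
  have "eab R (op_of R F)"
    unfolding eab_def
  proof (intro ballI impI)
    fix A B C assume "A \<in> fg_fractional R" "B \<in> fg_fractional R" "C \<in> fg_fractional R"
      and sub: "op_of R F (module_prod R A B) \<subseteq> op_of R F (module_prod R A C)"
    then obtain S T U where S: "finite S" "has_nonzero S" "A = module_span R S" and T: "finite T" "has_nonzero T" "B = module_span R T"
      and U: "finite U" "has_nonzero U" "C = module_span R U"
      unfolding fg_fractional_iff[OF R quot] has_nonzero_def[symmetric] by blast
    have SU: "finite (S * U)" "has_nonzero (S * U)" using S U finite_set_times_fields has_nonzero_times by auto
    have "star_closure R (op_of R F) (S * T) \<subseteq> star_closure R (op_of R F) (S * U)"
      using sub unfolding S(3) T(3) U(3) module_prod_span[OF R] star_closure_def .
    then have ST: "S * T \<subseteq> consequences F (S * U)"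
      using star_closure_superset[OF has_nonzero_times[OF S(2) T(2)]] star_closure_op_of[OF SU] by blast
    have "t \<in> consequences F U" if t: "t \<in> T" for t
    proof (cases "t = 0")
      case False
      have "scaled t U \<in> F"
      proof (rule eab_rulesD(4)[OF F S(1,2)])
        fix s assume s: "s \<in> S" "s \<noteq> 0"
        have "s * t \<in> consequences F (S * U)" using ST s(1) t by (auto intro: set_times_intro)
        then have "scaled (s * t) (S * U) \<in> F" using s(2) False by (simp add: consequences_def)
        moreover have "S * scaled t U = scaled t (S * U)"
          unfolding image_mult_eq_set_times by (rule mult.left_commute)
        ultimately show "scaled s (S * scaled t U) \<in> F" by (simp only: scaled_scaled)
      qed (use U False in \<open>simp_all add: has_nonzero_scaled\<close>)
      then show ?thesis by (simp add: consequences_def)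
    qed (simp add: consequences_def)
    then have "T \<subseteq> star_closure R (op_of R F) U" unfolding star_closure_op_of[OF U(1,2)] by blast
    then have "star_closure R (op_of R F) T \<subseteq> star_closure R (op_of R F) U" by (rule star_closure_least[OF U(2) T(2)])
    then show "op_of R F B \<subseteq> op_of R F C" unfolding T(3) U(3) star_closure_def .
  qed
  then show ?thesis using ft op_of_SStar unfolding SStar_f_eab_def by blast
qed

lemma theory_of_op_of: "theory_of R (op_of R F) = F"
  unfolding theory_of_def using star_closure_op_of eab_rulesD(1)[OF F] by (auto simp: consequences_def)

end

context quotient_field_domain
begin

lemma theory_of_model:
  assumes r: "r \<in> SStar_f_eab D"
  shows "theory_of D r \<in> models (eab_rules D)"
proof -
  interpret eab_semistar D r by (rule eab_semistarI[OF r])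
  have sc: "t \<in> star_closure D r S" if "has_nonzero S" "finite S" "t \<noteq> 0" "scaled t S \<in> theory_of D r" for t S
    using that mem_star_closure_iff_scaled[OF that(1,3)] by (simp add: theory_of_def has_nonzero_scaled)
  have "S \<in> theory_of D r" if rule: "(P, S) \<in> eab_rules D" and P: "P \<subseteq> theory_of D r" for P S
  proof -
    consider "\<not> (finite S \<and> has_nonzero S)" | "finite S" "has_nonzero S" "1 \<in> module_span D S"
      | T where "P = insert T ((\<lambda>t. scaled t S) ` (T - {0}))" "finite S" "has_nonzero S" "finite T" "has_nonzero T"
      | T where "P = (\<lambda>s. scaled s (T * S)) ` (T - {0})" "finite T" "has_nonzero T" "finite S" "has_nonzero S"
      using rule unfolding eab_rules_def by blast
    then show ?thesis
    proof cases
      case 1 then show ?thesis by (auto simp: theory_of_def)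
    next
      case 2 then show ?thesis using span_subset_star_closure by (auto simp: theory_of_def)
    next
      case 3
      have "t \<in> star_closure D r S" if t: "t \<in> T" for t
        using sc[OF 3(3,2), of t] P t zero_in_star_closure[OF 3(3)] unfolding 3(1) by (cases "t = 0") auto
      then have "star_closure D r T \<subseteq> star_closure D r S" by (intro star_closure_least 3) blast
      moreover have "1 \<in> star_closure D r T" using P 3 by (simp add: theory_of_def)
      ultimately show ?thesis by (auto simp: theory_of_def)
    next
      case 4
      note TS = has_nonzero_times[OF 4(3,5)] finite_set_times_fields[OF 4(2,4)]
      \<comment> \<open>The premises say \<open>T \<subseteq> (T S)\<^sup>r\<close>; now cancel \<open>T\<close>.\<close>
      have "t \<in> star_closure D r (T * S)" if t: "t \<in> T" for t
        using sc[OF TS, of t] P t zero_in_star_closure[OF TS(1)] unfolding 4(1) by (cases "t = 0") auto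
      then have T1: "T * {1} \<subseteq> star_closure D r (T * S)" by (auto simp: set_times_def)
      have "{1} \<subseteq> star_closure D r S"
        by (rule star_closure_cancel[OF 4(2,3) _ has_nonzero_singleton_1 4(4,5) T1]) simp
      then show ?thesis by (auto simp: theory_of_def)
    qed
  qed
  then show ?thesis unfolding models_def by blast
qed

lemma op_of_theory_of:
  assumes r: "r \<in> SStar_f_eab D"
  shows "op_of D (theory_of D r) = r"
proof
  interpret eab_semistar D r by (rule eab_semistarI[OF r])
  have ft: "finite_type D r" and rS: "r \<in> SStar D" using r unfolding SStar_f_eab_def by auto
  fix E
  show "op_of D (theory_of D r) E = r E"
  proof (cases "E \<in> Fbar D")
    case E: True
    have c: "x \<in> consequences (theory_of D r) S \<longleftrightarrow> x \<in> star_closure D r S" if "finite S" "has_nonzero S" for x S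
      using that mem_star_closure_iff_scaled[OF that(2), of x] zero_in_star_closure[OF that(2)]
      by (cases "x = 0") (auto simp: consequences_def theory_of_def has_nonzero_scaled)
    have sub: "star_closure D r S \<subseteq> r E" if "S \<subseteq> E" "has_nonzero S" for S
    proof -
      have "module_span D S \<subseteq> E" using that E Fbar_iff[OF D_subring] by (intro module_span_least[OF D_subring]) auto
      then show ?thesis unfolding star_closure_def by (intro SStarD(3)[OF rS has_nonzero_span[OF D_subring that(2)] E])
    qed
    have "x \<in> op_of D (theory_of D r) E \<longleftrightarrow> x \<in> r E" for x
    proof
      assume "x \<in> op_of D (theory_of D r) E"
      then obtain S where "finite S" "has_nonzero S" "S \<subseteq> E" "x \<in> consequences (theory_of D r) S"
        unfolding op_of_def using E by auto
      then show "x \<in> r E" using c sub by blast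
    next
      assume "x \<in> r E"
      then obtain S where "finite S" "has_nonzero S" "S \<subseteq> E" "x \<in> star_closure D r S"
        using ft E unfolding finite_type_iff[OF D_subring D_quotient rS] by blast
      then show "x \<in> op_of D (theory_of D r) E" unfolding op_of_def using E c by auto
    qed
    then show ?thesis by blast
  next
    case False
    then show ?thesis using SStarD(6)[OF rS] by (simp add: op_of_def extensional_def)
  qed
qed

lemma eab_modelI: "F \<in> models (eab_rules D) \<Longrightarrow> eab_model D F"
  using D_subring D_quotient by unfold_locales auto

text \<open>The atom \<open>S\<close> corresponds to the condition \<open>1 \<in> S\<^sup>r\<close>, which is a subbasic open condition;
  conversely \<open>1 \<in> E\<^sup>r\<close> is the union of the conditions \<open>1 \<in> S\<^sup>r\<close> for the finite \<open>S \<subseteq> E\<close>.\<close>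

lemma homeomorphic_models_eab:
  "subtopology (sstar_topology D) (SStar_f_eab D) homeomorphic_space models_topology (eab_rules D)"
proof -
  let ?T = "subtopology (sstar_topology D) (SStar_f_eab D)"
  have top: "topspace ?T = SStar_f_eab D"
    using SStar_f_subsets by (auto simp: topspace_sstar_topology[OF D_subring])
  have op: "op_of D F \<in> SStar_f_eab D" "theory_of D (op_of D F) = F" if "F \<in> models (eab_rules D)" for F
    using eab_model.op_of_mem[OF eab_modelI[OF that]] eab_model.theory_of_op_of[OF eab_modelI[OF that]] by auto
  have c1: "continuous_map ?T (models_topology (eab_rules D)) (theory_of D)"
  proof (rule continuous_map_into_generated[OF models_topology_def])
    show "theory_of D ` topspace ?T \<subseteq> topspace (models_topology (eab_rules D))"
      unfolding top topspace_models_topology using theory_of_model by blast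
  next
    fix U assume "U \<in> insert (models (eab_rules D)) {{F \<in> models (eab_rules D). S \<in> F} |S. True}"
    then consider "U = models (eab_rules D)" | S where "U = {F \<in> models (eab_rules D). S \<in> F}" by blast
    then show "openin ?T (theory_of D -` U \<inter> topspace ?T)"
    proof cases
      case 1
      have "theory_of D -` U \<inter> topspace ?T = topspace ?T" unfolding 1 top using theory_of_model by blast
      then show ?thesis by (simp only: openin_topspace)
    next
      case 2
      show ?thesis
      proof (cases "finite S \<and> has_nonzero S")
        case False
        have "theory_of D -` U \<inter> topspace ?T = topspace ?T"
          unfolding 2 top using theory_of_model False by (auto simp: theory_of_def)
        then show ?thesis by (simp only: openin_topspace)
      next
        case True
        have eq: "theory_of D -` U \<inter> topspace ?T = {s \<in> SStar D. 1 \<in> s (module_span D S)} \<inter> SStar_f_eab D"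
          unfolding 2 top using theory_of_model True SStar_f_subsets(2) by (auto simp: theory_of_def star_closure_def)
        have "openin (sstar_topology D) {s \<in> SStar D. 1 \<in> s (module_span D S)}"
          using True by (intro openin_mem has_nonzero_span[OF D_subring]) simp
        then show ?thesis unfolding eq openin_subtopology by blast
      qed
    qed
  qed
  have c2: "continuous_map (models_topology (eab_rules D)) (sstar_topology D) (op_of D)"
  proof (rule continuous_map_into_generated[OF sstar_topology_def])
    show "op_of D ` topspace (models_topology (eab_rules D)) \<subseteq> topspace (sstar_topology D)"
      unfolding topspace_models_topology topspace_sstar_topology[OF D_subring] using op(1) SStar_f_subsets(2) by blast
  next
    fix U assume "U \<in> {{s \<in> SStar D. 1 \<in> s E} |E. E \<in> Fbar D}"
    then obtain E where E: "E \<in> Fbar D" "U = {s \<in> SStar D. 1 \<in> s E}" by blast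
    have "op_of D -` U \<inter> topspace (models_topology (eab_rules D)) =
        (\<Union>S\<in>{S. finite S \<and> has_nonzero S \<and> S \<subseteq> E}. {F \<in> models (eab_rules D). S \<in> F})"
      unfolding E(2) topspace_models_topology using op(1) SStar_f_subsets(2) E(1)
      by (auto simp: op_of_def consequences_def)
    moreover have "openin (models_topology (eab_rules D)) {F \<in> models (eab_rules D). S \<in> F}" for S
      unfolding models_topology_def by (rule topology_generated_by_Basis) blast
    ultimately show "openin (models_topology (eab_rules D)) (op_of D -` U \<inter> topspace (models_topology (eab_rules D)))"
      by (auto intro!: openin_Union)
  qed
  have "continuous_map (models_topology (eab_rules D)) ?T (op_of D)"
    using c2 op(1) by (auto simp: continuous_map_in_subtopology topspace_models_topology)
  then have "homeomorphic_maps ?T (models_topology (eab_rules D)) (theory_of D) (op_of D)"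
    unfolding homeomorphic_maps_def top topspace_models_topology using c1 op_of_theory_of op(2) by blast
  then show ?thesis unfolding homeomorphic_space_def by (intro exI)
qed

text \<open>The points of the space are functions from sets to sets, so their type is large enough
  to contain the atoms, as constant functions.\<close>

lemma spectral_space_SStar_f_eab: "spectral_space (subtopology (sstar_topology D) (SStar_f_eab D))"
proof (rule spectral_space_if_homeomorphic_models'[OF homeomorphic_models_eab finite_eab_rules])
  show "inj (\<lambda>S :: 'k set. (\<lambda>_ :: 'k set. S))" by (auto simp: inj_def fun_eq_iff)
qed

end

section \<open>The induced maps between spaces of semistar operations\<close>

theorem theorem5p11:
  fixes D :: "'k::field set"
  assumes "domain_with_quotient_field D"
  shows
    "homeomorphic_map (zariski_spec (sub_ring (Kr D))) (zar_topology D) (theta D) \<and>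
     (\<forall>Y \<subseteq> Spec (sub_ring (Kr D)). Zset D Y = theta D ` Y) \<and>
     (\<exists>\<Theta>.
        \<comment> \<open>(1)\<close>
        (\<forall>Y \<subseteq> Spec (sub_ring (Kr D)). \<Theta> (spectral_op (Kr D) Y) = wedge D (Zset D Y)) \<and>
        bij_betw \<Theta> (SStar_sp (Kr D)) (SStar_val D) \<and>
        continuous_map (subtopology (sstar_topology (Kr D)) (SStar_sp (Kr D)))
                       (subtopology (sstar_topology D) (SStar_val D)) \<Theta> \<and>
        \<comment> \<open>(2)\<close>
        homeomorphic_map (subtopology (sstar_topology (Kr D)) (SStar_f_sp (Kr D)))
                         (subtopology (sstar_topology D) (SStar_f_eab D)) \<Theta>) \<and>
     \<comment> \<open>(3)\<close>
     spectral_space (subtopology (sstar_topology D) (SStar_f_eab D))"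
proof -
  interpret quotient_field_domain D by unfold_locales (rule assms)
  have "continuous_map (subtopology (sstar_topology (Kr D)) (SStar_sp (Kr D)))
      (subtopology (sstar_topology D) (SStar_val D)) Theta"
    by (rule continuous_map_Theta[OF SStar_sp_subset _ SStar_val_subset])
      (use bij_betw_Theta in \<open>simp add: bij_betw_def\<close>)
  then show ?thesis
    using homeomorphic_map_theta Zset_eq Theta_spectral_op bij_betw_Theta homeomorphic_map_Theta
      spectral_space_SStar_f_eab
    by (intro conjI allI impI exI[of _ Theta])
qed

end
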